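(* Let $\mathcal{D}$ be a triangulated K3 category, let $\sigma\in \mathrm{Stab}(\mathcal{D})$ be a stability condition, and let $f\in \mathrm{Aut}(\mathcal{D})$ be an autoequivalence such that $f(A)\cong A$ for every $\sigma$-stable spherical object $A\in\mathcal{D}$. Then $f(E)\cong E$ for every rigid object $E\in \mathcal{D}$.
   Context: Triangulated categories are $\mathbb{C}$-linear with finite-dimensional $\mathrm{Hom}$-spaces, and autoequivalences are exact and $\mathbb{C}$-linear. A triangulated category $\mathcal{D}$ is a K3 category if the square $[2]$ of the shift functor is a Serre functor for $\mathcal{D}$. An object $E\in\mathcal{D}$ is spherical if $\dim \mathrm{Hom}(E,E[i])=1$ for $i=0,2$ and $\mathrm{Hom}(E,E[i])=0$ for all other $i$. An object $E$ is rigid if $\mathrm{Hom}(E,E[1])=0$. $\mathrm{Stab}(\mathcal{D})$ is the space of (locally finite) Bridgeland stability conditions $\sigma=(Z,\mathcal{P})$ on $\mathcal{D}$. An object is $\sigma$-stable of phase $\varphi$ if it is a simple object of the abelian category $\mathcal{P}(\varphi)$ of semistable objects of phase $\varphi$. *)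

theory Defs
  imports
    Complex_Main
    "HOL-Algebra.Free_Abelian_Groups"
    "HOL-Algebra.Generated_Groups"
    "Jordan_Normal_Form.VS_Connect"
begin

hide_const (open) Modules.module_hom

section \<open>Linear categories\<close>

text \<open>The \<open>mult\<close> and \<open>one\<close> fields of the module records \<open>Hom X Y\<close> carry no meaning.\<close>

record ('o, 'm) lin_cat =
  Obj :: "'o set"
  Hom :: "'o \<Rightarrow> 'o \<Rightarrow> (complex, 'm) module"
  Ident :: "'o \<Rightarrow> 'm"
  Comp :: "'m \<Rightarrow> 'm \<Rightarrow> 'm" (infixl \<open>\<cdot>\<index>\<close> 70)

abbreviation Mor :: "('o, 'm, 'z) lin_cat_scheme \<Rightarrow> 'o \<Rightarrow> 'o \<Rightarrow> 'm set" where
  "Mor D X Y \<equiv> carrier (Hom D X Y)"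

abbreviation Zero :: "('o, 'm, 'z) lin_cat_scheme \<Rightarrow> 'o \<Rightarrow> 'o \<Rightarrow> 'm" where
  "Zero D X Y \<equiv> \<zero>\<^bsub>Hom D X Y\<^esub>"

definition zero_object :: "('o, 'm, 'z) lin_cat_scheme \<Rightarrow> 'o \<Rightarrow> bool" where
  "zero_object D N \<longleftrightarrow> N \<in> Obj D \<and>
     (\<forall>X\<in>Obj D. (\<exists>!f. f \<in> Mor D X N) \<and> (\<exists>!f. f \<in> Mor D N X))"

definition direct_sum :: "('o, 'm, 'z) lin_cat_scheme \<Rightarrow> 'o \<Rightarrow> 'o \<Rightarrow> 'o \<Rightarrow> bool" where
  "direct_sum D A B S \<longleftrightarrow> S \<in> Obj D \<and>
     (\<exists>i\<in>Mor D A S. \<exists>j\<in>Mor D B S. \<exists>p\<in>Mor D S A. \<exists>q\<in>Mor D S B.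
        p \<cdot>\<^bsub>D\<^esub> i = Ident D A \<and> q \<cdot>\<^bsub>D\<^esub> j = Ident D B \<and>
        p \<cdot>\<^bsub>D\<^esub> j = Zero D B A \<and> q \<cdot>\<^bsub>D\<^esub> i = Zero D A B \<and>
        (i \<cdot>\<^bsub>D\<^esub> p) \<oplus>\<^bsub>Hom D S S\<^esub> (j \<cdot>\<^bsub>D\<^esub> q) = Ident D S)"

definition is_iso :: "('o, 'm, 'z) lin_cat_scheme \<Rightarrow> 'o \<Rightarrow> 'o \<Rightarrow> 'm \<Rightarrow> bool" where
  "is_iso D X Y f \<longleftrightarrow> f \<in> Mor D X Y \<and>
     (\<exists>g\<in>Mor D Y X. g \<cdot>\<^bsub>D\<^esub> f = Ident D X \<and> f \<cdot>\<^bsub>D\<^esub> g = Ident D Y)"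

definition isomorphic :: "('o, 'm, 'z) lin_cat_scheme \<Rightarrow> 'o \<Rightarrow> 'o \<Rightarrow> bool" where
  "isomorphic D X Y \<longleftrightarrow> (\<exists>f. is_iso D X Y f)"

text \<open>Distinct Hom-spaces are disjoint, so that composition and the action of functors on
  morphisms need no source and target annotations.\<close>

locale linear_category =
  fixes D :: "('o, 'm, 'z) lin_cat_scheme" (structure)
  assumes hom_vectorspace:
      "\<lbrakk>X \<in> Obj D; Y \<in> Obj D\<rbrakk> \<Longrightarrow> vectorspace class_ring (Hom D X Y)"
    and hom_disjoint:
      "\<lbrakk>X \<in> Obj D; Y \<in> Obj D; X' \<in> Obj D; Y' \<in> Obj D; f \<in> Mor D X Y; f \<in> Mor D X' Y'\<rbrakk>
        \<Longrightarrow> X = X' \<and> Y = Y'"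
    and ident_mor: "X \<in> Obj D \<Longrightarrow> Ident D X \<in> Mor D X X"
    and comp_ident_right: "\<lbrakk>X \<in> Obj D; Y \<in> Obj D; f \<in> Mor D X Y\<rbrakk> \<Longrightarrow> f \<cdot> Ident D X = f"
    and comp_ident_left: "\<lbrakk>X \<in> Obj D; Y \<in> Obj D; f \<in> Mor D X Y\<rbrakk> \<Longrightarrow> Ident D Y \<cdot> f = f"
    and comp_assoc:
      "\<lbrakk>W \<in> Obj D; X \<in> Obj D; Y \<in> Obj D; Z \<in> Obj D;
        f \<in> Mor D W X; g \<in> Mor D X Y; h \<in> Mor D Y Z\<rbrakk> \<Longrightarrow> (h \<cdot> g) \<cdot> f = h \<cdot> (g \<cdot> f)"
    and comp_linear_left:
      "\<lbrakk>X \<in> Obj D; Y \<in> Obj D; Z \<in> Obj D; f \<in> Mor D X Y\<rbrakk>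
        \<Longrightarrow> (\<lambda>g. g \<cdot> f) \<in> module_hom class_ring (Hom D Y Z) (Hom D X Z)"
    and comp_linear_right:
      "\<lbrakk>X \<in> Obj D; Y \<in> Obj D; Z \<in> Obj D; g \<in> Mor D Y Z\<rbrakk>
        \<Longrightarrow> (\<lambda>f. g \<cdot> f) \<in> module_hom class_ring (Hom D X Y) (Hom D X Z)"
    and ex_zero_object: "\<exists>N. zero_object D N"
    and ex_direct_sum: "\<lbrakk>A \<in> Obj D; B \<in> Obj D\<rbrakk> \<Longrightarrow> \<exists>S. direct_sum D A B S"


section \<open>Functors\<close>

record ('o, 'm) endofun =
  onObj :: "'o \<Rightarrow> 'o"
  onMor :: "'m \<Rightarrow> 'm"

definition id_fun :: "('o, 'm) endofun" where
  "id_fun = \<lparr>onObj = id, onMor = id\<rparr>"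

definition comp_fun :: "('o, 'm) endofun \<Rightarrow> ('o, 'm) endofun \<Rightarrow> ('o, 'm) endofun" where
  "comp_fun G F = \<lparr>onObj = onObj G \<circ> onObj F, onMor = onMor G \<circ> onMor F\<rparr>"

definition linear_functor :: "('o, 'm, 'z) lin_cat_scheme \<Rightarrow> ('o, 'm) endofun \<Rightarrow> bool" where
  "linear_functor D F \<longleftrightarrow>
     (\<forall>X\<in>Obj D. onObj F X \<in> Obj D) \<and>
     (\<forall>X\<in>Obj D. \<forall>Y\<in>Obj D.
        onMor F \<in> module_hom class_ring (Hom D X Y) (Hom D (onObj F X) (onObj F Y))) \<and>
     (\<forall>X\<in>Obj D. onMor F (Ident D X) = Ident D (onObj F X)) \<and>
     (\<forall>X\<in>Obj D. \<forall>Y\<in>Obj D. \<forall>Z\<in>Obj D. \<forall>f\<in>Mor D X Y. \<forall>g\<in>Mor D Y Z.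
        onMor F (g \<cdot>\<^bsub>D\<^esub> f) = onMor F g \<cdot>\<^bsub>D\<^esub> onMor F f)"

definition nat_iso ::
  "('o, 'm, 'z) lin_cat_scheme \<Rightarrow> ('o, 'm) endofun \<Rightarrow> ('o, 'm) endofun \<Rightarrow> ('o \<Rightarrow> 'm) \<Rightarrow> bool" where
  "nat_iso D F G \<eta> \<longleftrightarrow>
     (\<forall>X\<in>Obj D. is_iso D (onObj F X) (onObj G X) (\<eta> X)) \<and>
     (\<forall>X\<in>Obj D. \<forall>Y\<in>Obj D. \<forall>f\<in>Mor D X Y. \<eta> Y \<cdot>\<^bsub>D\<^esub> onMor F f = onMor G f \<cdot>\<^bsub>D\<^esub> \<eta> X)"

definition quasi_inverse ::
  "('o, 'm, 'z) lin_cat_scheme \<Rightarrow> ('o, 'm) endofun \<Rightarrow> ('o, 'm) endofun \<Rightarrow> bool" where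
  "quasi_inverse D F G \<longleftrightarrow> linear_functor D G \<and>
     (\<exists>\<eta>. nat_iso D (comp_fun G F) id_fun \<eta>) \<and> (\<exists>\<epsilon>. nat_iso D (comp_fun F G) id_fun \<epsilon>)"

definition linear_autoequivalence ::
  "('o, 'm, 'z) lin_cat_scheme \<Rightarrow> ('o, 'm) endofun \<Rightarrow> bool" where
  "linear_autoequivalence D F \<longleftrightarrow> linear_functor D F \<and> (\<exists>G. quasi_inverse D F G)"


section \<open>Triangulated categories\<close>

text \<open>A sextuple \<open>(X, Y, Z, u, v, w)\<close> in \<open>Tri\<close> is a distinguished triangle
  \<open>X \<rightarrow> Y \<rightarrow> Z \<rightarrow> X[1]\<close> with morphisms \<open>u\<close>, \<open>v\<close>, \<open>w\<close>.\<close>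

record ('o, 'm) tri_cat = "('o, 'm) lin_cat" +
  Shift :: "('o, 'm) endofun"
  Tri :: "('o \<times> 'o \<times> 'o \<times> 'm \<times> 'm \<times> 'm) set"

abbreviation shO :: "('o, 'm, 'z) tri_cat_scheme \<Rightarrow> 'o \<Rightarrow> 'o" where
  "shO D \<equiv> onObj (Shift D)"

abbreviation shM :: "('o, 'm, 'z) tri_cat_scheme \<Rightarrow> 'm \<Rightarrow> 'm" where
  "shM D \<equiv> onMor (Shift D)"

text \<open>The shift is an autoequivalence, not necessarily an automorphism. All Hom-spaces are
  finite-dimensional. The last axiom is the octahedral axiom.\<close>

locale triangulated_category = linear_category D
  for D :: "('o, 'm, 'z) tri_cat_scheme" (structure) +
  assumes hom_fin_dim:
      "\<lbrakk>X \<in> Obj D; Y \<in> Obj D\<rbrakk> \<Longrightarrow> vectorspace.fin_dim class_ring (Hom D X Y)"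
    and shift_autoequivalence: "linear_autoequivalence D (Shift D)"
    and tri_mor:
      "(X, Y, Z, u, v, w) \<in> Tri D \<Longrightarrow> X \<in> Obj D \<and> Y \<in> Obj D \<and> Z \<in> Obj D \<and>
         u \<in> Mor D X Y \<and> v \<in> Mor D Y Z \<and> w \<in> Mor D Z (shO D X)"
    and tri_ident:
      "\<lbrakk>X \<in> Obj D; zero_object D N\<rbrakk>
        \<Longrightarrow> (X, X, N, Ident D X, Zero D X N, Zero D N (shO D X)) \<in> Tri D"
    and tri_iso_closed:
      "\<lbrakk>(X, Y, Z, u, v, w) \<in> Tri D; X' \<in> Obj D; Y' \<in> Obj D; Z' \<in> Obj D;
        u' \<in> Mor D X' Y'; v' \<in> Mor D Y' Z'; w' \<in> Mor D Z' (shO D X');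
        is_iso D X X' a; is_iso D Y Y' b; is_iso D Z Z' c;
        b \<cdot> u = u' \<cdot> a; c \<cdot> v = v' \<cdot> b; shM D a \<cdot> w = w' \<cdot> c\<rbrakk>
        \<Longrightarrow> (X', Y', Z', u', v', w') \<in> Tri D"
    and tri_complete:
      "\<lbrakk>X \<in> Obj D; Y \<in> Obj D; u \<in> Mor D X Y\<rbrakk> \<Longrightarrow> \<exists>Z v w. (X, Y, Z, u, v, w) \<in> Tri D"
    and tri_rotate:
      "\<lbrakk>X \<in> Obj D; Y \<in> Obj D; Z \<in> Obj D;
        u \<in> Mor D X Y; v \<in> Mor D Y Z; w \<in> Mor D Z (shO D X)\<rbrakk>
        \<Longrightarrow> (X, Y, Z, u, v, w) \<in> Tri D \<longleftrightarrow>
            (Y, Z, shO D X, v, w, \<ominus>\<^bsub>Hom D (shO D X) (shO D Y)\<^esub> shM D u) \<in> Tri D"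
    and tri_morphism:
      "\<lbrakk>(X, Y, Z, u, v, w) \<in> Tri D; (X', Y', Z', u', v', w') \<in> Tri D;
        a \<in> Mor D X X'; b \<in> Mor D Y Y'; b \<cdot> u = u' \<cdot> a\<rbrakk>
        \<Longrightarrow> \<exists>c\<in>Mor D Z Z'. c \<cdot> v = v' \<cdot> b \<and> shM D a \<cdot> w = w' \<cdot> c"
    and octahedral:
      "\<lbrakk>(X, Y, Z', u, j, k) \<in> Tri D; (Y, Z, X', v, l, i) \<in> Tri D;
        (X, Z, Y', v \<cdot> u, m, n) \<in> Tri D\<rbrakk>
        \<Longrightarrow> \<exists>f g. (Z', Y', X', f, g, shM D j \<cdot> i) \<in> Tri D \<and>
              f \<cdot> j = m \<cdot> v \<and> n \<cdot> f = k \<and> g \<cdot> m = l \<and> i \<cdot> g = shM D u \<cdot> n"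

definition unshift :: "('o, 'm, 'z) tri_cat_scheme \<Rightarrow> ('o, 'm) endofun" where
  "unshift D = (SOME G. quasi_inverse D (Shift D) G)"

text \<open>The object \<open>E[i]\<close>.\<close>

definition shift_obj :: "('o, 'm, 'z) tri_cat_scheme \<Rightarrow> int \<Rightarrow> 'o \<Rightarrow> 'o" where
  "shift_obj D i E =
     (if 0 \<le> i then (onObj (Shift D) ^^ nat i) E else (onObj (unshift D) ^^ nat (- i)) E)"

definition exact_functor :: "('o, 'm, 'z) tri_cat_scheme \<Rightarrow> ('o, 'm) endofun \<Rightarrow> bool" where
  "exact_functor D F \<longleftrightarrow> linear_functor D F \<and>
     (\<exists>\<eta>. nat_iso D (comp_fun F (Shift D)) (comp_fun (Shift D) F) \<eta> \<and>
        (\<forall>(X, Y, Z, u, v, w)\<in>Tri D.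
           (onObj F X, onObj F Y, onObj F Z, onMor F u, onMor F v, \<eta> X \<cdot>\<^bsub>D\<^esub> onMor F w) \<in> Tri D))"

text \<open>Representatives of the elements of the group of autoequivalences, which are
  natural-isomorphism classes of such functors.\<close>

definition Aut :: "('o, 'm, 'z) tri_cat_scheme \<Rightarrow> ('o, 'm) endofun set" where
  "Aut D = {F. exact_functor D F \<and> linear_autoequivalence D F}"


section \<open>Serre functors, K3 categories, spherical and rigid objects\<close>

definition ground_module :: "(complex, complex) module" where
  "ground_module =
     \<lparr>carrier = UNIV, mult = (*), one = 1, zero = 0, add = (+), smult = (*)\<rparr>"

text \<open>Functionals are extensional, so that equality in the dual space is equality on the
  carrier of \<open>V\<close>.\<close>

definition dual_space :: "(complex, 'm) module \<Rightarrow> (complex, 'm \<Rightarrow> complex) module" where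
  "dual_space V =
     \<lparr>carrier = module_hom class_ring V ground_module \<inter> extensional (carrier V),
      mult = undefined, one = undefined,
      zero = (\<lambda>x\<in>carrier V. 0),
      add = (\<lambda>\<phi> \<psi>. \<lambda>x\<in>carrier V. \<phi> x + \<psi> x),
      smult = (\<lambda>c \<phi>. \<lambda>x\<in>carrier V. c * \<phi> x)\<rparr>"

text \<open>The maps \<open>\<eta> A B : Hom(A, B) \<rightarrow> Hom(B, S A)\<^sup>*\<close> are linear isomorphisms, natural in \<open>A\<close>
  and \<open>B\<close>.\<close>

definition serre_functor :: "('o, 'm, 'z) lin_cat_scheme \<Rightarrow> ('o, 'm) endofun \<Rightarrow> bool" where
  "serre_functor D S \<longleftrightarrow> linear_autoequivalence D S \<and>
     (\<exists>\<eta> :: 'o \<Rightarrow> 'o \<Rightarrow> 'm \<Rightarrow> 'm \<Rightarrow> complex.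
        (\<forall>A\<in>Obj D. \<forall>B\<in>Obj D.
           \<eta> A B \<in> module_hom class_ring (Hom D A B) (dual_space (Hom D B (onObj S A))) \<and>
           bij_betw (\<eta> A B) (Mor D A B) (carrier (dual_space (Hom D B (onObj S A))))) \<and>
        (\<forall>A\<in>Obj D. \<forall>A'\<in>Obj D. \<forall>B\<in>Obj D. \<forall>B'\<in>Obj D.
           \<forall>a\<in>Mor D A' A. \<forall>b\<in>Mor D B B'. \<forall>f\<in>Mor D A B. \<forall>g\<in>Mor D B' (onObj S A').
             \<eta> A' B' (b \<cdot>\<^bsub>D\<^esub> f \<cdot>\<^bsub>D\<^esub> a) g = \<eta> A B f (onMor S a \<cdot>\<^bsub>D\<^esub> g \<cdot>\<^bsub>D\<^esub> b)))"

locale K3_category = triangulated_category D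
  for D :: "('o, 'm, 'z) tri_cat_scheme" (structure) +
  assumes double_shift_serre: "serre_functor D (comp_fun (Shift D) (Shift D))"

definition spherical :: "('o, 'm, 'z) tri_cat_scheme \<Rightarrow> 'o \<Rightarrow> bool" where
  "spherical D E \<longleftrightarrow> E \<in> Obj D \<and>
     (\<forall>i\<in>{0, 2}. vectorspace.dim class_ring (Hom D E (shift_obj D i E)) = 1) \<and>
     (\<forall>i. i \<notin> {0, 2} \<longrightarrow> Mor D E (shift_obj D i E) = {Zero D E (shift_obj D i E)})"

definition rigid :: "('o, 'm, 'z) tri_cat_scheme \<Rightarrow> 'o \<Rightarrow> bool" where
  "rigid D E \<longleftrightarrow> E \<in> Obj D \<and> Mor D E (shift_obj D 1 E) = {Zero D E (shift_obj D 1 E)}"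


section \<open>Full subcategories\<close>

text \<open>A full subcategory is given by its set \<open>S\<close> of objects. The notions below refer to the
  full subcategory, not to \<open>D\<close>.\<close>

definition mono_in ::
  "('o, 'm, 'z) lin_cat_scheme \<Rightarrow> 'o set \<Rightarrow> 'o \<Rightarrow> 'o \<Rightarrow> 'm \<Rightarrow> bool" where
  "mono_in D S X Y f \<longleftrightarrow> X \<in> S \<and> Y \<in> S \<and> f \<in> Mor D X Y \<and>
     (\<forall>W\<in>S. \<forall>g\<in>Mor D W X. \<forall>h\<in>Mor D W X. f \<cdot>\<^bsub>D\<^esub> g = f \<cdot>\<^bsub>D\<^esub> h \<longrightarrow> g = h)"

definition kernel_in ::
  "('o, 'm, 'z) lin_cat_scheme \<Rightarrow> 'o set \<Rightarrow> 'o \<Rightarrow> 'o \<Rightarrow> 'm \<Rightarrow> 'o \<Rightarrow> 'm \<Rightarrow> bool" where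
  "kernel_in D S X Y f K k \<longleftrightarrow> K \<in> S \<and> k \<in> Mor D K X \<and> f \<cdot>\<^bsub>D\<^esub> k = Zero D K Y \<and>
     (\<forall>W\<in>S. \<forall>g\<in>Mor D W X. f \<cdot>\<^bsub>D\<^esub> g = Zero D W Y \<longrightarrow> (\<exists>!h. h \<in> Mor D W K \<and> k \<cdot>\<^bsub>D\<^esub> h = g))"

definition cokernel_in ::
  "('o, 'm, 'z) lin_cat_scheme \<Rightarrow> 'o set \<Rightarrow> 'o \<Rightarrow> 'o \<Rightarrow> 'm \<Rightarrow> 'o \<Rightarrow> 'm \<Rightarrow> bool" where
  "cokernel_in D S X Y f C c \<longleftrightarrow> C \<in> S \<and> c \<in> Mor D Y C \<and> c \<cdot>\<^bsub>D\<^esub> f = Zero D X C \<and>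
     (\<forall>W\<in>S. \<forall>g\<in>Mor D Y W. g \<cdot>\<^bsub>D\<^esub> f = Zero D X W \<longrightarrow> (\<exists>!h. h \<in> Mor D C W \<and> h \<cdot>\<^bsub>D\<^esub> c = g))"

text \<open>A morphism is strict if the canonical map \<open>t\<close> from its coimage \<open>I\<close> (the cokernel of the
  kernel) to its image \<open>J\<close> (the kernel of the cokernel) is an isomorphism.\<close>

definition strict_in ::
  "('o, 'm, 'z) lin_cat_scheme \<Rightarrow> 'o set \<Rightarrow> 'o \<Rightarrow> 'o \<Rightarrow> 'm \<Rightarrow> bool" where
  "strict_in D S X Y f \<longleftrightarrow> X \<in> S \<and> Y \<in> S \<and> f \<in> Mor D X Y \<and>
     (\<exists>K k C c I q J m t. kernel_in D S X Y f K k \<and> cokernel_in D S X Y f C c \<and>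
        cokernel_in D S K X k I q \<and> kernel_in D S Y C c J m \<and>
        is_iso D I J t \<and> f = m \<cdot>\<^bsub>D\<^esub> t \<cdot>\<^bsub>D\<^esub> q)"

definition strict_subobject_in ::
  "('o, 'm, 'z) lin_cat_scheme \<Rightarrow> 'o set \<Rightarrow> 'o \<Rightarrow> 'o \<Rightarrow> 'm \<Rightarrow> bool" where
  "strict_subobject_in D S E M m \<longleftrightarrow> mono_in D S M E m \<and> strict_in D S M E m"

text \<open>The order on subobjects \<open>m : M \<rightarrow> E\<close> and \<open>n : N \<rightarrow> E\<close>.\<close>

definition sub_le :: "('o, 'm, 'z) lin_cat_scheme \<Rightarrow> 'o \<Rightarrow> 'm \<Rightarrow> 'o \<Rightarrow> 'm \<Rightarrow> bool" where
  "sub_le D M m N n \<longleftrightarrow> (\<exists>h\<in>Mor D M N. m = n \<cdot>\<^bsub>D\<^esub> h)"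

text \<open>Finite length of a quasi-abelian category: chains of strict subobjects of a given object
  become stationary.\<close>

definition noetherian_in :: "('o, 'm, 'z) lin_cat_scheme \<Rightarrow> 'o set \<Rightarrow> bool" where
  "noetherian_in D S \<longleftrightarrow>
     (\<forall>E\<in>S. \<forall>M m. (\<forall>n::nat. strict_subobject_in D S E (M n) (m n)) \<and>
        (\<forall>n. sub_le D (M n) (m n) (M (Suc n)) (m (Suc n))) \<longrightarrow>
        (\<exists>N. \<forall>n\<ge>N. sub_le D (M (Suc n)) (m (Suc n)) (M n) (m n)))"

definition artinian_in :: "('o, 'm, 'z) lin_cat_scheme \<Rightarrow> 'o set \<Rightarrow> bool" where
  "artinian_in D S \<longleftrightarrow>
     (\<forall>E\<in>S. \<forall>M m. (\<forall>n::nat. strict_subobject_in D S E (M n) (m n)) \<and>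
        (\<forall>n. sub_le D (M (Suc n)) (m (Suc n)) (M n) (m n)) \<longrightarrow>
        (\<exists>N. \<forall>n\<ge>N. sub_le D (M n) (m n) (M (Suc n)) (m (Suc n))))"

definition finite_length_in :: "('o, 'm, 'z) lin_cat_scheme \<Rightarrow> 'o set \<Rightarrow> bool" where
  "finite_length_in D S \<longleftrightarrow> noetherian_in D S \<and> artinian_in D S"

definition simple_in :: "('o, 'm, 'z) lin_cat_scheme \<Rightarrow> 'o set \<Rightarrow> 'o \<Rightarrow> bool" where
  "simple_in D S E \<longleftrightarrow> E \<in> S \<and> \<not> zero_object D E \<and>
     (\<forall>M m. mono_in D S M E m \<longrightarrow> zero_object D M \<or> is_iso D M E m)"

inductive_set extension_closure :: "('o, 'm, 'z) tri_cat_scheme \<Rightarrow> 'o set \<Rightarrow> 'o set"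
  for D :: "('o, 'm, 'z) tri_cat_scheme" and S :: "'o set" where
  base: "X \<in> S \<Longrightarrow> X \<in> extension_closure D S"
| ext: "\<lbrakk>X \<in> extension_closure D S; Z \<in> extension_closure D S; (X, Y, Z, u, v, w) \<in> Tri D\<rbrakk>
    \<Longrightarrow> Y \<in> extension_closure D S"


section \<open>Bridgeland stability conditions\<close>

definition K0_relations :: "('o, 'm, 'z) tri_cat_scheme \<Rightarrow> ('o \<Rightarrow>\<^sub>0 int) set" where
  "K0_relations D =
     {frag_of Y - frag_of X - frag_of Z | X Y Z. \<exists>u v w. (X, Y, Z, u, v, w) \<in> Tri D}"

definition K0 :: "('o, 'm, 'z) tri_cat_scheme \<Rightarrow> ('o \<Rightarrow>\<^sub>0 int) set monoid" where
  "K0 D = free_Abelian_group (Obj D) Mod generate (free_Abelian_group (Obj D)) (K0_relations D)"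

definition K0_class :: "('o, 'm, 'z) tri_cat_scheme \<Rightarrow> 'o \<Rightarrow> ('o \<Rightarrow>\<^sub>0 int) set" where
  "K0_class D E =
     generate (free_Abelian_group (Obj D)) (K0_relations D) #>\<^bsub>free_Abelian_group (Obj D)\<^esub> frag_of E"

text \<open>\<open>P(I)\<close>: the extension-closed full subcategory generated by the \<open>P \<phi>\<close> with \<open>\<phi> \<in> I\<close>.\<close>

definition slice_interval ::
  "('o, 'm, 'z) tri_cat_scheme \<Rightarrow> (real \<Rightarrow> 'o set) \<Rightarrow> real set \<Rightarrow> 'o set" where
  "slice_interval D P I = extension_closure D (\<Union>\<phi>\<in>I. P \<phi>)"

text \<open>The categories \<open>P \<phi>\<close> are full additive subcategories closed under isomorphism, and
  \<open>P (\<phi> + 1) = P \<phi>[1]\<close> is read up to isomorphism. In \<open>harder_narasimhan\<close> the objects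
  \<open>E 0, \<dots>, E n\<close> form the filtration and the \<open>A j\<close> are its factors. The bound \<open>\<eta> < 1/2\<close> in
  \<open>locally_finite\<close> is the condition under which the categories \<open>P((t - \<eta>, t + \<eta>))\<close> are known
  to be quasi-abelian; since \<open>\<eta>\<close> may be decreased, it is no restriction.\<close>

locale stability_condition = triangulated_category D
  for D :: "('o, 'm, 'z) tri_cat_scheme" (structure) +
  fixes Z :: "('o \<Rightarrow>\<^sub>0 int) set \<Rightarrow> complex"
    and P :: "real \<Rightarrow> 'o set"
  assumes central_charge: "Z \<in> hom (K0 D) (add_monoid (class_ring :: complex ring))"
    and slice_obj: "P \<phi> \<subseteq> Obj D"
    and slice_iso_closed: "\<lbrakk>X \<in> P \<phi>; Y \<in> Obj D; isomorphic D X Y\<rbrakk> \<Longrightarrow> Y \<in> P \<phi>"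
    and slice_zero: "zero_object D N \<Longrightarrow> N \<in> P \<phi>"
    and slice_direct_sum: "\<lbrakk>A \<in> P \<phi>; B \<in> P \<phi>; direct_sum D A B S\<rbrakk> \<Longrightarrow> S \<in> P \<phi>"
    and slice_phase:
      "\<lbrakk>E \<in> P \<phi>; \<not> zero_object D E\<rbrakk>
        \<Longrightarrow> \<exists>r>0. Z (K0_class D E) = of_real r * exp (\<i> * of_real pi * of_real \<phi>)"
    and slice_shift: "P (\<phi> + 1) = {X \<in> Obj D. \<exists>Y\<in>P \<phi>. isomorphic D X (shO D Y)}"
    and slice_hom_zero:
      "\<lbrakk>\<phi>\<^sub>1 > \<phi>\<^sub>2; A\<^sub>1 \<in> P \<phi>\<^sub>1; A\<^sub>2 \<in> P \<phi>\<^sub>2\<rbrakk> \<Longrightarrow> Mor D A\<^sub>1 A\<^sub>2 = {Zero D A\<^sub>1 A\<^sub>2}"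
    and harder_narasimhan:
      "\<lbrakk>X \<in> Obj D; \<not> zero_object D X\<rbrakk> \<Longrightarrow>
        \<exists>(n::nat) (\<phi> :: nat \<Rightarrow> real) (E :: nat \<Rightarrow> 'o) (A :: nat \<Rightarrow> 'o).
          zero_object D (E 0) \<and> E n = X \<and>
          (\<forall>i\<in>{1..n}. \<forall>j\<in>{1..n}. i < j \<longrightarrow> \<phi> i > \<phi> j) \<and>
          (\<forall>j\<in>{1..n}. A j \<in> P (\<phi> j) \<and> (\<exists>u v w. (E (j - 1), E j, A j, u, v, w) \<in> Tri D))"
    and locally_finite:
      "\<exists>\<eta>>0. \<eta> < 1 / 2 \<and> (\<forall>t. finite_length_in D (slice_interval D P {t - \<eta><..<t + \<eta>}))"

definition Stab ::
  "('o, 'm, 'z) tri_cat_scheme \<Rightarrow> ((('o \<Rightarrow>\<^sub>0 int) set \<Rightarrow> complex) \<times> (real \<Rightarrow> 'o set)) set" where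
  "Stab D = {(Z, P). stability_condition D Z P}"

definition stable_of_phase ::
  "('o, 'm, 'z) tri_cat_scheme \<Rightarrow> (('o \<Rightarrow>\<^sub>0 int) set \<Rightarrow> complex) \<times> (real \<Rightarrow> 'o set) \<Rightarrow>
    real \<Rightarrow> 'o \<Rightarrow> bool" where
  "stable_of_phase D \<sigma> \<phi> E \<longleftrightarrow> simple_in D (snd \<sigma> \<phi>) E"

definition stable_object ::
  "('o, 'm, 'z) tri_cat_scheme \<Rightarrow> (('o \<Rightarrow>\<^sub>0 int) set \<Rightarrow> complex) \<times> (real \<Rightarrow> 'o set) \<Rightarrow>
    'o \<Rightarrow> bool" where
  "stable_object D \<sigma> E \<longleftrightarrow> (\<exists>\<phi>. stable_of_phase D \<sigma> \<phi> E)"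

end

theory Submission
  imports
    Defs
    "Jordan_Normal_Form.Char_Poly"
    "HOL-Computational_Algebra.Fundamental_Theorem_Algebra"
begin

text \<open>Let \<open>f\<close> fix the \<open>\<sigma>\<close>-stable spherical objects up to isomorphism. A rigid object \<open>E\<close> is assembled from stable
  spherical ones by extensions that are each determined by their outer terms, and so \<open>f(E) \<cong> E\<close>.

  Why extensions are determined. Let \<open>A \<rightarrow> E \<rightarrow> B \<rightarrow> A[1]\<close> be a triangle with \<open>E\<close> rigid and \<open>Hom(A, B) = 0\<close>. By
  Serre duality \<open>Hom(B, A[2]) = 0\<close>, and a diagram chase shows that \<open>A\<close> and \<open>B\<close> are rigid again (\<open>mukai\<close>). Rigidity
  of \<open>E\<close> and \<open>Hom(A, B) = 0\<close> also show that the class \<open>w\<close> of the extension satisfies \<open>Hom(B, A[1]) = End(A[1]) w + w End(B)\<close>,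
  that is, the orbit of \<open>w\<close> under \<open>Aut A \<times> Aut B\<close> is open (\<open>rigid_extension_open_orbit\<close>). Any two open
  orbits coincide. This is usually seen from the irreducibility of the vector space; here it follows from
  linear algebra on the line through the two points. The equation \<open>a w = (w + t d) b\<close> is linear in \<open>(a, b)\<close>
  and has the solution \<open>(id, id)\<close> at \<open>t = 0\<close>, which Cramer's rule extends to a solution polynomial in \<open>t\<close>. Its
  components are invertible for all but finitely many \<open>t\<close>, so each of the two orbits contains all but
  finitely many points of the line (\<open>line_in_orbit\<close>, \<open>open_orbit_unique\<close>). If \<open>f(A) \<cong> A\<close> and \<open>f(B) \<cong> B\<close>, then
  \<open>f(E)\<close> is also a rigid extension of \<open>B\<close> by \<open>A\<close>, hence \<open>f(E) \<cong> E\<close> (\<open>rigid_extension_fixed\<close>).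

  How \<open>E\<close> is assembled. The last step of a Harder--Narasimhan filtration is a triangle of the above kind, so
  \<open>E\<close> may be taken semistable of phase \<open>\<phi>\<close>. In \<open>P \<phi>\<close>, let \<open>S\<close> be a simple subobject of \<open>E\<close> and \<open>A\<close> the largest
  subobject that is an iterated self-extension of \<open>S\<close>. Then \<open>Hom(S, E/A) = 0\<close>, hence \<open>Hom(A, E/A) = 0\<close>, both
  \<open>A\<close> and \<open>E/A\<close> are rigid, and noetherian induction takes care of \<open>E/A\<close>. That the needed part of the theory
  of abelian categories holds in \<open>P \<phi>\<close> comes from \<open>cone_decomposition\<close>: the central charge forces the cone of
  a morphism of \<open>P \<phi>\<close> to have no phases other than \<open>\<phi>\<close> and \<open>\<phi> + 1\<close>.

  Why \<open>S\<close> is spherical. Schur's lemma gives \<open>End S = \<complex>\<close>, so by Serre duality only \<open>Hom(S, S[1]) = 0\<close> is in question.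
  If its dimension were at least \<open>2\<close>, then \<open>\<chi>(S, S) \<le> 0\<close>, and additivity would give \<open>\<chi>(A, A) \<le> 0\<close>, although
  \<open>\<chi>(A, A) = 2 dim End A\<close> for a nonzero rigid \<open>A\<close> (\<open>simple_rigid\<close>). Dimension \<open>1\<close> is impossible because Serre
  duality is skew-symmetric on \<open>Hom(S, S[1])\<close>. As it is only assumed that \<open>[2]\<close> is a Serre functor, without
  compatibility of the duality with the shift, the sign has to be found in a triangle:
  \<open>self_extension_dim_neq_1\<close> compares a rotated triangle with a shifted one. Once \<open>Hom(S, S[1]) = 0\<close>, all
  self-extensions of \<open>S\<close> split, and \<open>f(S) \<cong> S\<close> implies \<open>f(A) \<cong> A\<close>.\<close>

hide_const (open) Modules.module_hom

section \<open>Coordinates and polynomial families of linear maps\<close>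

locale complex_space = vectorspace class_ring V
  for V :: "(complex, 'm) module" (structure)
begin

lemma smult_in [simp, intro]: "x \<in> carrier V \<Longrightarrow> a \<odot> x \<in> carrier V"
  using smult_closed by simp

lemma smult_add_left: "x \<in> carrier V \<Longrightarrow> (a + b) \<odot> x = a \<odot> x \<oplus> b \<odot> x"
  using smult_l_distr[of a b x] by simp

lemma smult_add_right:
  "x \<in> carrier V \<Longrightarrow> y \<in> carrier V \<Longrightarrow> a \<odot> (x \<oplus> y) = a \<odot> x \<oplus> a \<odot> y"
  using smult_r_distr[of a x y] by simp

lemma smult_smult: "x \<in> carrier V \<Longrightarrow> a \<odot> (b \<odot> x) = (a * b) \<odot> x"
  using smult_assoc1[of a b x] by simp

lemma smult_1 [simp]: "x \<in> carrier V \<Longrightarrow> 1 \<odot> x = x"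
  using smult_one by simp

lemma smult_0 [simp]: "x \<in> carrier V \<Longrightarrow> 0 \<odot> x = \<zero>"
  using smult_l_null by simp

lemma smult_zero [simp]: "a \<odot> \<zero> = \<zero>"
  using smult_r_null by simp

lemma smult_minus_one: "x \<in> carrier V \<Longrightarrow> (-1) \<odot> x = \<ominus> x"
  using smult_l_minus[of 1 x] class_ring.ring_simprules by (simp add: class_ring_simps)

lemma smult_eq_0D: "a \<odot> x = \<zero> \<Longrightarrow> x \<in> carrier V \<Longrightarrow> a \<noteq> 0 \<Longrightarrow> x = \<zero>"
  by (metis left_inverse smult_1 smult_smult smult_zero)

primrec lsum :: "nat \<Rightarrow> (nat \<Rightarrow> complex) \<Rightarrow> (nat \<Rightarrow> 'm) \<Rightarrow> 'm" where
  "lsum 0 c b = \<zero>"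
| "lsum (Suc n) c b = lsum n c b \<oplus> c n \<odot> b n"

lemma lsum_closed [simp, intro]: "(\<And>i. i < n \<Longrightarrow> b i \<in> carrier V) \<Longrightarrow> lsum n c b \<in> carrier V"
  by (induction n) auto

lemma lsum_cong:
  "(\<And>i. i < n \<Longrightarrow> c i = c' i) \<Longrightarrow> (\<And>i. i < n \<Longrightarrow> b i = b' i) \<Longrightarrow> lsum n c b = lsum n c' b'"
  by (induction n) auto

lemma lsum_add:
  assumes "\<And>i. i < n \<Longrightarrow> b i \<in> carrier V"
  shows "lsum n (\<lambda>i. c i + d i) b = lsum n c b \<oplus> lsum n d b"
  using assms
proof (induction n)
  case (Suc n)
  then have "lsum n c b \<in> carrier V" "lsum n d b \<in> carrier V" by auto
  then show ?case using Suc by (simp add: smult_add_left a_ac)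
qed simp

lemma lsum_add_vectors:
  assumes "\<And>i. i < n \<Longrightarrow> b i \<in> carrier V" "\<And>i. i < n \<Longrightarrow> d i \<in> carrier V"
  shows "lsum n c (\<lambda>i. b i \<oplus> d i) = lsum n c b \<oplus> lsum n c d"
  using assms
proof (induction n)
  case (Suc n)
  then have "lsum n c b \<in> carrier V" "lsum n c d \<in> carrier V" by auto
  then show ?case using Suc by (simp add: smult_add_right a_ac)
qed simp

lemma lsum_smult:
  assumes "\<And>i. i < n \<Longrightarrow> b i \<in> carrier V"
  shows "lsum n (\<lambda>i. a * c i) b = a \<odot> lsum n c b"
  using assms by (induction n) (simp_all add: smult_add_right smult_smult)

lemma lsum_delta:
  assumes "j < n" "\<And>i. i < n \<Longrightarrow> b i \<in> carrier V"
  shows "lsum n (\<lambda>i. if i = j then 1 else 0) b = b j"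
  using assms
proof (induction n)
  case (Suc n)
  have z: "lsum n (\<lambda>i. if i = n then 1 else 0) b = \<zero>" if "\<And>i. i < n \<Longrightarrow> b i \<in> carrier V" 
  proof -
    have "lsum k (\<lambda>i. if i = n then 1 else 0) b = \<zero>" if "k \<le> n" for k
      using that \<open>\<And>i. i < n \<Longrightarrow> b i \<in> carrier V\<close> by (induction k) auto
    then show ?thesis by simp
  qed
  show ?case
  proof (cases "j = n")
    case True
    then show ?thesis using z Suc.prems by simp
  next
    case False
    then show ?thesis using Suc by (simp add: less_Suc_eq)
  qed
qed simp

text \<open>A basis \<open>b\<close> of \<open>V\<close> together with its dual basis \<open>c\<close>.\<close>

definition coords :: "nat \<Rightarrow> (nat \<Rightarrow> 'm) \<Rightarrow> (nat \<Rightarrow> 'm \<Rightarrow> complex) \<Rightarrow> bool" where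
  "coords n b c \<longleftrightarrow> (\<forall>i<n. b i \<in> carrier V) \<and> (\<forall>i<n. c i \<in> module_hom class_ring V ground_module) \<and>
     (\<forall>v\<in>carrier V. lsum n (\<lambda>i. c i v) b = v) \<and>
     (\<forall>i<n. \<forall>j<n. c i (b j) = (if i = j then 1 else 0))"

lemma functionalD:
  assumes "c \<in> module_hom class_ring V ground_module" "x \<in> carrier V"
  shows "y \<in> carrier V \<Longrightarrow> c (x \<oplus> y) = c x + c y" "c (a \<odot> x) = a * c x"
  using assms by (auto simp: LinearCombinations.module_hom_def ground_module_def)

lemma functional_zero: "c \<in> module_hom class_ring V ground_module \<Longrightarrow> c \<zero> = 0"
  using functionalD(2)[of c "\<zero>" 0] by simp

lemma functional_lsum:
  assumes "c \<in> module_hom class_ring V ground_module" "\<And>i. i < n \<Longrightarrow> b i \<in> carrier V"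
  shows "c (lsum n x b) = (\<Sum>i<n. x i * c (b i))"
  using assms(2)
proof (induction n)
  case (Suc n)
  then show ?case using functionalD[OF assms(1)] by simp
qed (simp add: functional_zero[OF assms(1)])

lemma coords_lsum:
  assumes "coords n b c" "i < n"
  shows "c i (lsum n x b) = x i"
proof -
  have "c i (lsum n x b) = (\<Sum>j<n. x j * c i (b j))"
    using assms by (intro functional_lsum) (auto simp: coords_def)
  also have "\<dots> = (\<Sum>j<n. if i = j then x j else 0)"
    using assms by (intro sum.cong) (auto simp: coords_def)
  finally show ?thesis using assms(2) by simp
qed

lemma coords_eqI:
  assumes "coords n b c" "x \<in> carrier V" "y \<in> carrier V" "\<And>i. i < n \<Longrightarrow> c i x = c i y"
  shows "x = y"
proof -
  have "lsum n (\<lambda>i. c i x) b = lsum n (\<lambda>i. c i y) b" using assms(4) by (intro lsum_cong) auto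
  then show ?thesis using assms by (simp add: coords_def)
qed

text \<open>Links sums over index ranges, which suit induction, to the linear combinations over sets of vectors
  in which bases are expressed.\<close>

lemma lincomb_enum:
  assumes "inj_on b {..<n}" "b ` {..<n} \<subseteq> carrier V"
  shows "lincomb a (b ` {..<n}) = lsum n (\<lambda>i. a (b i)) b"
  using assms
proof (induction n)
  case 0
  then show ?case by (simp add: lincomb_def)
next
  case (Suc n)
  have ins: "b ` {..<Suc n} = b ` {..<n} \<union> {b n}" by (auto simp: lessThan_Suc)
  have "b n \<notin> b ` {..<n}"
  proof
    assume "b n \<in> b ` {..<n}"
    then obtain i where "i < n" "b n = b i" by auto
    then show False using inj_onD[OF Suc.prems(1), of n i] by simp
  qed
  then have "lincomb a (b ` {..<n} \<union> {b n}) = a (b n) \<odot> b n \<oplus> lincomb a (b ` {..<n})"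
    using Suc.prems by (intro lincomb_insert) auto
  also have "lincomb a (b ` {..<n}) = lsum n (\<lambda>i. a (b i)) b"
  proof (rule Suc.IH)
    show "b ` {..<n} \<subseteq> carrier V" using Suc.prems(2) by (simp add: image_subset_iff)
    show "inj_on b {..<n}" by (rule inj_on_subset[OF Suc.prems(1)]) auto
  qed
  finally show ?case unfolding ins using Suc.prems
    by (simp add: a_comm image_subset_iff)
qed

text \<open>The coordinate functions are linear because the coefficients with respect to a basis are unique.\<close>

lemma coords_exist:
  assumes fin_dim
  shows "\<exists>b c. coords dim b c"
proof -
  obtain A where A: "finite A" "basis A" using finite_basis_exists[OF assms] by blast
  then have dim: "dim = card A" and sub: "A \<subseteq> carrier V" using dim_basis by (auto simp: basis_def)
  obtain b where b: "bij_betw b {0..<card A} A" using ex_bij_betw_nat_finite[OF A(1)] by blast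
  define n where "n = card A"
  have im: "b ` {..<n} = A" and inj: "inj_on b {..<n}"
    using b by (auto simp: bij_betw_def n_def lessThan_atLeast0)
  have bV: "\<And>i. i < n \<Longrightarrow> b i \<in> carrier V" using im sub by auto
  have crit: "\<exists>!a. a \<in> A \<rightarrow>\<^sub>E UNIV \<and> lincomb a A = v" if "v \<in> carrier V" for v
    using basis_criterion[OF A(1) sub] A(2) that by simp
  have lin: "lincomb a A = lsum n (\<lambda>i. a (b i)) b" for a
    using lincomb_enum[OF inj] im sub by simp
  have ex: "\<exists>x. lsum n x b = v" if "v \<in> carrier V" for v
    using crit[OF that] lin by metis
  have uniq: "x i = y i" if eq: "lsum n x b = lsum n y b" and i: "i < n" for x y i
  proof -
    define ext where "ext = (\<lambda>x :: nat \<Rightarrow> complex. restrict (\<lambda>v. x (inv_into {..<n} b v)) A)"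
    have e: "ext x (b j) = x j" if "j < n" for x j
      using that im inj by (auto simp: ext_def)
    have e1: "lincomb (ext x) A = lsum n x b" for x
      unfolding lin using e by (intro lsum_cong) auto
    have e2: "ext x \<in> A \<rightarrow>\<^sub>E UNIV" for x by (auto simp: ext_def)
    have "lsum n x b \<in> carrier V" using bV by auto
    from crit[OF this] have "ext x = ext y" using e1 e2 eq by metis
    then show ?thesis using e[OF i] by metis
  qed
  define c where "c i v = (SOME x. lsum n x b = v) i" for i v
  have c: "lsum n (\<lambda>i. c i v) b = v" if "v \<in> carrier V" for v
    using someI_ex[OF ex[OF that]] by (simp add: c_def)
  have "coords n b c" unfolding coords_def
  proof (intro conjI allI impI ballI)
    fix i assume i: "i < n"
    show "c i \<in> module_hom class_ring V ground_module"
    proof -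
      have "c i (x \<oplus> y) = c i x + c i y" if "x \<in> carrier V" "y \<in> carrier V" for x y
      proof (rule uniq[OF _ i, of "\<lambda>i. c i (x \<oplus> y)" "\<lambda>i. c i x + c i y"])
        show "lsum n (\<lambda>i. c i (x \<oplus> y)) b = lsum n (\<lambda>i. c i x + c i y) b"
          using that bV by (simp add: lsum_add c)
      qed
      moreover have "c i (a \<odot> x) = a * c i x" if "x \<in> carrier V" for x a
      proof (rule uniq[OF _ i, of "\<lambda>i. c i (a \<odot> x)" "\<lambda>i. a * c i x"])
        show "lsum n (\<lambda>i. c i (a \<odot> x)) b = lsum n (\<lambda>i. a * c i x) b"
          using that bV by (simp add: lsum_smult c)
      qed
      ultimately show ?thesis by (auto simp: LinearCombinations.module_hom_def ground_module_def)
    qed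
    fix j assume j: "j < n"
    show "c i (b j) = (if i = j then 1 else 0)"
    proof (rule uniq[OF _ i, of "\<lambda>i. c i (b j)" "\<lambda>i. if i = j then 1 else 0"])
      show "lsum n (\<lambda>i. c i (b j)) b = lsum n (\<lambda>i. if i = j then 1 else 0) b"
        using c[OF bV[OF j]] lsum_delta[OF j bV] by simp
    qed
  qed (use bV c in auto)
  then show ?thesis using dim n_def by auto
qed

lemma coords_basis:
  assumes "coords n b c"
  shows "inj_on b {..<n}" "basis (b ` {..<n})"
proof -
  have bV: "\<And>i. i < n \<Longrightarrow> b i \<in> carrier V" using assms by (auto simp: coords_def)
  show inj: "inj_on b {..<n}"
  proof (rule inj_onI)
    fix i j assume i: "i \<in> {..<n}" and j: "j \<in> {..<n}" and eq: "b i = b j"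
    have h: "\<forall>i<n. \<forall>j<n. c i (b j) = (if i = j then 1 else 0)"
      using assms unfolding coords_def by blast
    have "c i (b i) = 1" using h i by simp
    moreover have "c i (b j) = (if i = j then 1 else 0)" using h i j by simp
    ultimately show "i = j" using eq by (metis zero_neq_one)
  qed
  have sub: "b ` {..<n} \<subseteq> carrier V" using bV by auto
  show "basis (b ` {..<n})"
  proof (subst basis_criterion[OF _ sub], simp, intro allI impI)
    fix v assume v: "v \<in> carrier V"
    define a where "a = restrict (\<lambda>w. c (inv_into {..<n} b w) v) (b ` {..<n})"
    have "lincomb a (b ` {..<n}) = lsum n (\<lambda>i. a (b i)) b" using lincomb_enum[OF inj sub] .
    also have "\<dots> = lsum n (\<lambda>i. c i v) b"
      using inj by (intro lsum_cong) (auto simp: a_def)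
    finally have 1: "lincomb a (b ` {..<n}) = v" using assms v by (simp add: coords_def)
    show "\<exists>!a. a \<in> b ` {..<n} \<rightarrow>\<^sub>E carrier class_ring \<and> lincomb a (b ` {..<n}) = v"
    proof (rule ex1I[of _ a])
      show "a \<in> b ` {..<n} \<rightarrow>\<^sub>E carrier class_ring \<and> lincomb a (b ` {..<n}) = v"
        using 1 by (auto simp: a_def)
      fix a' assume a': "a' \<in> b ` {..<n} \<rightarrow>\<^sub>E carrier class_ring \<and> lincomb a' (b ` {..<n}) = v"
      show "a' = a"
      proof (rule extensionalityI[of _ "b ` {..<n}"])
        fix w assume "w \<in> b ` {..<n}"
        then obtain i where i: "i < n" "w = b i" by auto
        have "a' (b i) = c i (lsum n (\<lambda>i. a' (b i)) b)" using coords_lsum[OF assms i(1)] by simp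
        also have "\<dots> = c i v" using a' lincomb_enum[OF inj sub] by simp
        also have "\<dots> = a (b i)" using inj i by (auto simp: a_def)
        finally show "a' w = a w" using i by simp
      qed (use a' in \<open>auto simp: a_def PiE_def\<close>)
    qed
  qed
qed

lemma coords_dim:
  assumes "coords n b c"
  shows "dim = n" "fin_dim"
proof -
  show "dim = n"
    using dim_basis[OF _ coords_basis(2)[OF assms]] card_image[OF coords_basis(1)[OF assms]] by simp
  show fin_dim using coords_basis(2)[OF assms] by (auto simp: fin_dim_def basis_def)
qed

lemma ex_nonzero_functional:
  assumes fin_dim "x \<in> carrier V" "x \<noteq> \<zero>"
  shows "\<exists>c\<in>module_hom class_ring V ground_module. c x \<noteq> 0"
proof (rule ccontr)
  assume no: "\<not> ?thesis"
  obtain b c where bc: "coords dim b c" using coords_exist[OF assms(1)] by blast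
  have "x = \<zero>"
  proof (rule coords_eqI[OF bc])
    fix i assume "i < dim"
    then have "c i \<in> module_hom class_ring V ground_module" using bc by (auto simp: coords_def)
    then show "c i x = c i \<zero>" using no functional_zero by auto
  qed (use assms in auto)
  with assms show False by simp
qed

lemma dim_eq_0_iff:
  assumes fin_dim
  shows "dim = 0 \<longleftrightarrow> carrier V = {\<zero>}"
proof
  assume "dim = 0"
  then obtain b c where bc: "coords 0 b c" using coords_exist[OF assms] by auto
  show "carrier V = {\<zero>}"
  proof (rule Set.set_eqI)
    fix x
    have "x = \<zero>" if "x \<in> carrier V" using coords_eqI[OF bc that] by simp
    then show "x \<in> carrier V \<longleftrightarrow> x \<in> {\<zero>}" by (metis singleton_iff zero_closed)
  qed
next
  assume z: "carrier V = {\<zero>}"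
  have "coords 0 (\<lambda>_. \<zero>) (\<lambda>_ _. 0)" unfolding coords_def z by simp
  then show "dim = 0" by (rule coords_dim)
qed

lemma spanning_vector_dim:
  assumes e: "e \<in> carrier V" "e \<noteq> \<zero>" "\<And>v. v \<in> carrier V \<Longrightarrow> \<exists>a. v = a \<odot> e"
  shows "dim = 1"
proof (rule dim1I[OF _ e(2,1)])
  have "a \<odot> e \<in> span {e}" for a
  proof -
    have "lincomb (\<lambda>_. a) {e} = a \<odot> e" using e(1) by (simp add: lincomb_def)
    then show ?thesis unfolding span_def
      by (intro CollectI exI[of _ "\<lambda>_. a"] exI[of _ "{e}"]) simp
  qed
  then have "carrier V \<subseteq> span {e}" using e(3) by blast
  then show "span {e} = carrier V" using span_is_subset2[of "{e}"] e(1) by blast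
qed

lemma dim_1_span:
  assumes fin_dim "dim = 1" "x \<in> carrier V" "x \<noteq> \<zero>" "v \<in> carrier V"
  shows "\<exists>a. v = a \<odot> x"
proof -
  obtain b c where bc: "coords (Suc 0) b c" using coords_exist[OF assms(1)] assms(2) by auto
  then have b: "b 0 \<in> carrier V" and c: "\<And>v. v \<in> carrier V \<Longrightarrow> v = c 0 v \<odot> b 0"
    by (auto simp: coords_def)
  have "c 0 x \<noteq> 0" using c[OF assms(3)] assms(4) smult_0[OF b] by metis
  then have "v = (c 0 v / c 0 x) \<odot> (c 0 x \<odot> b 0)"
    using c[OF assms(5)] b by (simp add: smult_smult)
  then show ?thesis using c[OF assms(3)] by metis
qed

end

lemma linear_mapD:
  assumes "T \<in> module_hom class_ring U V" "x \<in> carrier U"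
  shows "T x \<in> carrier V" "y \<in> carrier U \<Longrightarrow> T (x \<oplus>\<^bsub>U\<^esub> y) = T x \<oplus>\<^bsub>V\<^esub> T y"
    "T (a \<odot>\<^bsub>U\<^esub> x) = a \<odot>\<^bsub>V\<^esub> T x"
  using assms by (auto simp: LinearCombinations.module_hom_def)

lemma linear_map_zero:
  assumes "complex_space U" "complex_space V" "T \<in> module_hom class_ring U V"
  shows "T \<zero>\<^bsub>U\<^esub> = \<zero>\<^bsub>V\<^esub>"
proof -
  interpret U: complex_space U by fact
  interpret V: complex_space V by fact
  have "T (0 \<odot>\<^bsub>U\<^esub> \<zero>\<^bsub>U\<^esub>) = 0 \<odot>\<^bsub>V\<^esub> T \<zero>\<^bsub>U\<^esub>" by (rule linear_mapD[OF assms(3)]) simp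
  then show ?thesis using linear_mapD(1)[OF assms(3)] by simp
qed

lemma linear_map_lsum:
  assumes "complex_space U" "complex_space V" "T \<in> module_hom class_ring U V"
    and "\<And>i. i < n \<Longrightarrow> b i \<in> carrier U"
  shows "T (complex_space.lsum U n c b) = complex_space.lsum V n c (\<lambda>i. T (b i))"
proof -
  interpret U: complex_space U by fact
  interpret V: complex_space V by fact
  show ?thesis using assms(4)
    by (induction n)
      (auto simp: linear_map_zero[OF assms(1-3)] linear_mapD[OF assms(3)])
qed

definition rank :: "(complex, 'm) module \<Rightarrow> (complex, 'm) module \<Rightarrow> ('m \<Rightarrow> 'm) \<Rightarrow> nat" where
  "rank U V T = vectorspace.dim class_ring (V\<lparr>carrier := T ` carrier U\<rparr>)"

text \<open>Exactness makes the kernel of \<open>g\<close> the image of \<open>f\<close>, so this is the rank-nullity theorem for \<open>g\<close>.\<close>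

lemma dim_of_exact:
  assumes "complex_space V" "complex_space W" "vectorspace.fin_dim class_ring V"
    and g: "g \<in> module_hom class_ring V W"
    and ex: "f ` carrier U = {v \<in> carrier V. g v = \<zero>\<^bsub>W\<^esub>}"
  shows "vectorspace.dim class_ring V = rank U V f + rank V W g"
proof -
  interpret V: complex_space V by fact
  interpret W: complex_space W by fact
  interpret g: linear_map class_ring V W g by unfold_locales (rule g)
  show ?thesis
    using g.rank_nullity[OF assms(3)] by (simp add: rank_def g.ker_def g.im_def ex)
qed

lemma rank_le_dim:
  assumes "complex_space V" "complex_space W" "vectorspace.fin_dim class_ring V"
    and g: "g \<in> module_hom class_ring V W"
  shows "rank V W g \<le> vectorspace.dim class_ring V"
proof -
  interpret V: complex_space V by fact
  interpret W: complex_space W by fact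
  interpret g: linear_map class_ring V W g by unfold_locales (rule g)
  show ?thesis
    using g.rank_nullity[OF assms(3)] by (simp add: rank_def g.ker_def g.im_def)
qed

text \<open>Cramer's rule for a polynomial family \<open>T(t)\<close> of endomorphisms with \<open>T(0) = id\<close>. In coordinates \<open>T\<close> is a
  matrix over the polynomial ring; applying its adjugate to \<open>v0\<close> solves \<open>T(t) x(t) = p(t) v0\<close> with \<open>p = det T\<close>,
  and \<open>p(0) = det id = 1\<close>.\<close>

lemma polynomial_cramer:
  fixes V :: "(complex, 'm) module"
  assumes V: "complex_space V" "vectorspace.fin_dim class_ring V"
    and T: "\<And>j. j < k \<Longrightarrow> T j \<in> module_hom class_ring V V"
    and id: "\<And>v. v \<in> carrier V \<Longrightarrow> complex_space.lsum V k (\<lambda>j. poly (q j) 0) (\<lambda>j. T j v) = v"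
    and v0: "v0 \<in> carrier V"
  shows "\<exists>p n y b. poly p 0 = 1 \<and> (\<forall>i<n. b i \<in> carrier V) \<and>
    (\<forall>t. complex_space.lsum V k (\<lambda>j. poly (q j) t)
            (\<lambda>j. T j (complex_space.lsum V n (\<lambda>i. poly (y i) t) b)) = poly p t \<odot>\<^bsub>V\<^esub> v0)"
proof -
  interpret V: complex_space V by fact
  obtain n b c where bc: "V.coords n b c" using V.coords_exist[OF V(2)] by blast
  have bV: "\<And>i. i < n \<Longrightarrow> b i \<in> carrier V" using bc by (auto simp: V.coords_def)
  have cV: "\<And>i. i < n \<Longrightarrow> c i \<in> module_hom class_ring V ground_module"
    using bc by (auto simp: V.coords_def)
  have TV: "\<And>j v. j < k \<Longrightarrow> v \<in> carrier V \<Longrightarrow> T j v \<in> carrier V" using linear_mapD(1)[OF T] .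
  define M where "M = mat n n (\<lambda>(i,l). \<Sum>j<k. q j * [: c i (T j (b l)) :])"
  have M: "M \<in> carrier_mat n n" by (simp add: M_def)
  have pM: "poly (M $$ (i,l)) t = (\<Sum>j<k. poly (q j) t * c i (T j (b l)))"
    if "i < n" "l < n" for i l t using that by (simp add: M_def poly_sum mult.commute)
  define w where "w = adj_mat M *\<^sub>v vec n (\<lambda>i. [: c i v0 :])"
  have "map_mat (\<lambda>p. poly p 0) M = 1\<^sub>m n"
  proof (rule eq_matI)
    fix i l assume "i < dim_row (1\<^sub>m n :: complex mat)" "l < dim_col (1\<^sub>m n :: complex mat)"
    then have il: "i < n" "l < n" by auto
    have "map_mat (\<lambda>p. poly p 0) M $$ (i,l) = (\<Sum>j<k. poly (q j) 0 * c i (T j (b l)))"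
      using il M pM by simp
    also have "\<dots> = c i (V.lsum k (\<lambda>j. poly (q j) 0) (\<lambda>j. T j (b l)))"
      by (rule V.functional_lsum[symmetric, OF cV[OF il(1)]]) (use TV bV il in auto)
    also have "\<dots> = c i (b l)" using id bV il by simp
    also have "\<dots> = (1\<^sub>m n :: complex mat) $$ (i,l)" using il bc by (simp add: V.coords_def)
    finally show "map_mat (\<lambda>p. poly p 0) M $$ (i,l) = (1\<^sub>m n :: complex mat) $$ (i,l)" .
  qed (use M in auto)
  moreover have "det (map_mat (\<lambda>p. poly p 0) M) = poly (det M) 0"
    by (rule comm_ring_hom.hom_det[OF poly_hom.comm_ring_hom_axioms])
  ultimately have p0: "poly (det M) 0 = 1" by simp
  have Mw: "M *\<^sub>v w = det M \<cdot>\<^sub>v vec n (\<lambda>i. [: c i v0 :])"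
  proof -
    have "M *\<^sub>v w = (M * adj_mat M) *\<^sub>v vec n (\<lambda>i. [: c i v0 :])"
      unfolding w_def using adj_mat(1)[OF M] M by (intro assoc_mult_mat_vec[symmetric]) auto
    also have "\<dots> = (det M \<cdot>\<^sub>m 1\<^sub>m n) *\<^sub>v vec n (\<lambda>i. [: c i v0 :])" by (simp add: adj_mat(2)[OF M])
    also have "\<dots> = det M \<cdot>\<^sub>v (1\<^sub>m n *\<^sub>v vec n (\<lambda>i. [: c i v0 :]))"
      by (intro eq_vecI) auto
    finally show ?thesis by simp
  qed
  have wd: "dim_vec w = n" using adj_mat(1)[OF M] by (simp add: w_def)
  show ?thesis
  proof (intro exI[of _ "det M"] exI[of _ n] exI[of _ "\<lambda>i. w $ i"] exI[of _ b] conjI allI impI)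
    fix t
    define x where "x = V.lsum n (\<lambda>i. poly (w $ i) t) b"
    have xV: "x \<in> carrier V" using bV by (auto simp: x_def)
    show "V.lsum k (\<lambda>j. poly (q j) t) (\<lambda>j. T j x) = poly (det M) t \<odot>\<^bsub>V\<^esub> v0"
    proof (rule V.coords_eqI[OF bc])
      fix i assume i: "i < n"
      have cT: "c i (T j x) = (\<Sum>l<n. poly (w $ l) t * c i (T j (b l)))" if j: "j < k" for j
      proof -
        have "T j x = V.lsum n (\<lambda>i. poly (w $ i) t) (\<lambda>l. T j (b l))"
          unfolding x_def by (rule linear_map_lsum[OF V(1) V(1) T[OF j] bV])
        then show ?thesis using V.functional_lsum[OF cV[OF i], of n "\<lambda>l. T j (b l)"] TV[OF j] bV by simp
      qed
      have "c i (V.lsum k (\<lambda>j. poly (q j) t) (\<lambda>j. T j x)) = (\<Sum>j<k. poly (q j) t * c i (T j x))"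
        by (rule V.functional_lsum[OF cV[OF i]]) (use TV xV in auto)
      also have "\<dots> = (\<Sum>j<k. \<Sum>l<n. poly (q j) t * c i (T j (b l)) * poly (w $ l) t)"
        by (intro sum.cong) (auto simp: cT sum_distrib_left mult_ac)
      also have "\<dots> = (\<Sum>l<n. poly (M $$ (i,l)) t * poly (w $ l) t)"
        by (subst sum.swap) (auto simp: pM[OF i] sum_distrib_right intro!: sum.cong)
      also have "\<dots> = poly ((M *\<^sub>v w) $ i) t"
        using M i wd by (simp add: mult_mat_vec_def scalar_prod_def poly_sum lessThan_atLeast0)
      also have "\<dots> = poly (det M) t * c i v0" using i by (simp add: Mw)
      also have "\<dots> = c i (poly (det M) t \<odot>\<^bsub>V\<^esub> v0)" using V.functionalD(2)[OF cV[OF i] v0] by simp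
      finally show "c i (V.lsum k (\<lambda>j. poly (q j) t) (\<lambda>j. T j x)) = c i (poly (det M) t \<odot>\<^bsub>V\<^esub> v0)" .
    qed (use TV xV v0 in auto)
  qed (use p0 bV in auto)
qed

text \<open>Where the determinant of the family does not vanish, the solution given by Cramer's rule may be divided by it.\<close>

lemma cofinitely_many_solvable:
  fixes V :: "(complex, 'm) module"
  assumes V: "complex_space V" "vectorspace.fin_dim class_ring V"
    and T: "\<And>j. j < k \<Longrightarrow> T j \<in> module_hom class_ring V V"
    and id: "\<And>v. v \<in> carrier V \<Longrightarrow> complex_space.lsum V k (\<lambda>j. poly (q j) 0) (\<lambda>j. T j v) = v"
    and v0: "v0 \<in> carrier V"
  shows "finite {t. \<not> (\<exists>x\<in>carrier V. complex_space.lsum V k (\<lambda>j. poly (q j) t) (\<lambda>j. T j x) = v0)}"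
proof -
  interpret V: complex_space V by fact
  obtain p n y b where p: "poly p 0 = 1" "\<forall>i<n. b i \<in> carrier V"
    "\<forall>t. V.lsum k (\<lambda>j. poly (q j) t) (\<lambda>j. T j (V.lsum n (\<lambda>i. poly (y i) t) b)) = poly p t \<odot>\<^bsub>V\<^esub> v0"
    using polynomial_cramer[of V k T q, OF V T id v0] by blast
  have "\<exists>x\<in>carrier V. V.lsum k (\<lambda>j. poly (q j) t) (\<lambda>j. T j x) = v0" if t: "poly p t \<noteq> 0" for t
  proof
    define x where "x = V.lsum n (\<lambda>i. poly (y i) t) b"
    have x: "x \<in> carrier V" unfolding x_def using p(2) by (intro V.lsum_closed) blast
    let ?c = "inverse (poly p t)"
    show "?c \<odot>\<^bsub>V\<^esub> x \<in> carrier V" using x by simp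
    have "V.lsum k (\<lambda>j. poly (q j) t) (\<lambda>j. T j (?c \<odot>\<^bsub>V\<^esub> x))
        = V.lsum k (\<lambda>j. ?c * poly (q j) t) (\<lambda>j. T j x)"
      using T x
    proof (induction k)
      case (Suc k)
      then show ?case using linear_mapD(1,3)[OF Suc.prems(1) x, of k] by (simp add: V.smult_smult mult.commute)
    qed simp
    also have "\<dots> = ?c \<odot>\<^bsub>V\<^esub> V.lsum k (\<lambda>j. poly (q j) t) (\<lambda>j. T j x)"
      by (rule V.lsum_smult) (rule linear_mapD(1)[OF T x])
    also have "\<dots> = v0" using p(3) t v0 by (simp add: x_def V.smult_smult)
    finally show "V.lsum k (\<lambda>j. poly (q j) t) (\<lambda>j. T j (?c \<odot>\<^bsub>V\<^esub> x)) = v0" .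
  qed
  then have "{t. \<not> (\<exists>x\<in>carrier V. V.lsum k (\<lambda>j. poly (q j) t) (\<lambda>j. T j x) = v0)} \<subseteq> {t. poly p t = 0}"
    by blast
  moreover have "p \<noteq> 0" using p(1) by auto
  ultimately show ?thesis using poly_roots_finite finite_subset by blast
qed

lemma coordinate_combination_linear:
  assumes V: "complex_space V" and W: "complex_space W"
    and c: "\<And>i. i < n \<Longrightarrow> c i \<in> module_hom class_ring V ground_module"
    and b: "\<And>i. i < n \<Longrightarrow> b i \<in> carrier W"
  shows "(\<lambda>v. complex_space.lsum W n (\<lambda>i. c i v) b) \<in> module_hom class_ring V W"
proof -
  interpret V: complex_space V by fact
  interpret W: complex_space W by fact
  have "W.lsum n (\<lambda>i. c i (x \<oplus>\<^bsub>V\<^esub> y)) b = W.lsum n (\<lambda>i. c i x) b \<oplus>\<^bsub>W\<^esub> W.lsum n (\<lambda>i. c i y) b"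
    if "x \<in> carrier V" "y \<in> carrier V" for x y
  proof -
    have "W.lsum n (\<lambda>i. c i (x \<oplus>\<^bsub>V\<^esub> y)) b = W.lsum n (\<lambda>i. c i x + c i y) b"
      by (rule W.lsum_cong) (use V.functionalD(1)[OF c] that in auto)
    also have "\<dots> = W.lsum n (\<lambda>i. c i x) b \<oplus>\<^bsub>W\<^esub> W.lsum n (\<lambda>i. c i y) b"
      by (rule W.lsum_add) (rule b)
    finally show ?thesis .
  qed
  moreover have "W.lsum n (\<lambda>i. c i (a \<odot>\<^bsub>V\<^esub> x)) b = a \<odot>\<^bsub>W\<^esub> W.lsum n (\<lambda>i. c i x) b"
    if "x \<in> carrier V" for a x
  proof -
    have "W.lsum n (\<lambda>i. c i (a \<odot>\<^bsub>V\<^esub> x)) b = W.lsum n (\<lambda>i. a * c i x) b"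
      by (rule W.lsum_cong) (use V.functionalD(2)[OF c] that in auto)
    also have "\<dots> = a \<odot>\<^bsub>W\<^esub> W.lsum n (\<lambda>i. c i x) b"
      by (rule W.lsum_smult) (rule b)
    finally show ?thesis .
  qed
  ultimately show ?thesis using b by (auto simp: LinearCombinations.module_hom_def)
qed

lemma linear_map_comp:
  "f \<in> module_hom class_ring U V \<Longrightarrow> g \<in> module_hom class_ring V W \<Longrightarrow>
    (\<lambda>x. g (f x)) \<in> module_hom class_ring U W"
  by (auto simp: LinearCombinations.module_hom_def Pi_iff)

lemma linear_map_ident: "(\<lambda>x. x) \<in> module_hom class_ring U U"
  by (auto simp: LinearCombinations.module_hom_def)

section \<open>Linear categories and their equivalences\<close>

context linear_category
begin

text \<open>Source and target are required to be objects, so that this one hypothesis discharges the side conditions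
  of all category axioms.\<close>

definition arr :: "'o \<Rightarrow> 'o \<Rightarrow> 'm \<Rightarrow> bool" where
  "arr X Y f \<longleftrightarrow> X \<in> Obj D \<and> Y \<in> Obj D \<and> f \<in> Mor D X Y"

lemma arrI: "X \<in> Obj D \<Longrightarrow> Y \<in> Obj D \<Longrightarrow> f \<in> Mor D X Y \<Longrightarrow> arr X Y f"
  by (simp add: arr_def)

lemma arrD: "arr X Y f \<Longrightarrow> X \<in> Obj D" "arr X Y f \<Longrightarrow> Y \<in> Obj D" "arr X Y f \<Longrightarrow> f \<in> Mor D X Y"
  by (simp_all add: arr_def)

lemma hom_space: "X \<in> Obj D \<Longrightarrow> Y \<in> Obj D \<Longrightarrow> complex_space (Hom D X Y)"
  using hom_vectorspace by (simp add: complex_space_def)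

lemma arr_ident [simp, intro]: "X \<in> Obj D \<Longrightarrow> arr X X (Ident D X)"
  by (simp add: arr_def ident_mor)

lemma comp_left_hom:
  "arr X Y f \<Longrightarrow> Z \<in> Obj D \<Longrightarrow> (\<lambda>g. g \<cdot> f) \<in> module_hom class_ring (Hom D Y Z) (Hom D X Z)"
  using comp_linear_left by (auto simp: arr_def)

lemma comp_right_hom:
  "arr Y Z g \<Longrightarrow> X \<in> Obj D \<Longrightarrow> (\<lambda>f. g \<cdot> f) \<in> module_hom class_ring (Hom D X Y) (Hom D X Z)"
  using comp_linear_right by (auto simp: arr_def)

lemma arr_comp [intro]: "arr X Y f \<Longrightarrow> arr Y Z g \<Longrightarrow> arr X Z (g \<cdot> f)"
  using linear_mapD(1)[OF comp_left_hom, of X Y f Z g] by (auto simp: arr_def)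

lemma assoc: "arr W X f \<Longrightarrow> arr X Y g \<Longrightarrow> arr Y Z h \<Longrightarrow> h \<cdot> g \<cdot> f = h \<cdot> (g \<cdot> f)"
  using comp_assoc by (auto simp: arr_def)

lemma ident_right [simp]: "arr X Y f \<Longrightarrow> f \<cdot> Ident D X = f"
  using comp_ident_right by (auto simp: arr_def)

lemma ident_left [simp]: "arr X Y f \<Longrightarrow> Ident D Y \<cdot> f = f"
  using comp_ident_left by (auto simp: arr_def)

lemma arr_zero [simp, intro]: "X \<in> Obj D \<Longrightarrow> Y \<in> Obj D \<Longrightarrow> arr X Y (Zero D X Y)"
  using abelian_monoid.zero_closed[OF abelian_group.axioms(1)[OF module.axioms(2)[OF vectorspace.axioms(1)[OF hom_vectorspace]]]]
  by (simp add: arr_def)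

lemma arr_arith [intro]:
  assumes f: "arr X Y f"
  shows arr_add: "arr X Y g \<Longrightarrow> arr X Y (f \<oplus>\<^bsub>Hom D X Y\<^esub> g)"
    and arr_smult: "arr X Y (a \<odot>\<^bsub>Hom D X Y\<^esub> f)"
    and arr_neg: "arr X Y (\<ominus>\<^bsub>Hom D X Y\<^esub> f)"
proof -
  interpret complex_space "Hom D X Y" using f by (intro hom_space arrD)
  show "arr X Y (a \<odot>\<^bsub>Hom D X Y\<^esub> f)" "arr X Y (\<ominus>\<^bsub>Hom D X Y\<^esub> f)" using f by (simp_all add: arr_def)
  show "arr X Y (f \<oplus>\<^bsub>Hom D X Y\<^esub> g)" if "arr X Y g" using f that by (simp add: arr_def)
qed

lemma arr_diff [intro]: "arr X Y f \<Longrightarrow> arr X Y g \<Longrightarrow> arr X Y (f \<ominus>\<^bsub>Hom D X Y\<^esub> g)"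
  unfolding a_minus_def by blast

lemma zero_comp [simp]: "arr X Y f \<Longrightarrow> Z \<in> Obj D \<Longrightarrow> Zero D Y Z \<cdot> f = Zero D X Z"
  using linear_map_zero[OF hom_space hom_space comp_left_hom] by (auto simp: arr_def)

lemma comp_zero [simp]: "arr Y Z g \<Longrightarrow> X \<in> Obj D \<Longrightarrow> g \<cdot> Zero D X Y = Zero D X Z"
  using linear_map_zero[OF hom_space hom_space comp_right_hom] by (auto simp: arr_def)

lemma zero_zero [simp]:
  "X \<in> Obj D \<Longrightarrow> Y \<in> Obj D \<Longrightarrow> Z \<in> Obj D \<Longrightarrow> Zero D Y Z \<cdot> Zero D X Y = Zero D X Z"
  by (rule zero_comp) simp_all

lemma comp_add_left:
  "arr X Y f \<Longrightarrow> arr Y Z g \<Longrightarrow> arr Y Z h \<Longrightarrow>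
    (g \<oplus>\<^bsub>Hom D Y Z\<^esub> h) \<cdot> f = g \<cdot> f \<oplus>\<^bsub>Hom D X Z\<^esub> h \<cdot> f"
  using linear_mapD(2)[OF comp_left_hom] by (auto simp: arr_def)

lemma comp_add_right:
  "arr Y Z g \<Longrightarrow> arr X Y f \<Longrightarrow> arr X Y h \<Longrightarrow>
    g \<cdot> (f \<oplus>\<^bsub>Hom D X Y\<^esub> h) = g \<cdot> f \<oplus>\<^bsub>Hom D X Z\<^esub> g \<cdot> h"
  using linear_mapD(2)[OF comp_right_hom] by (auto simp: arr_def)

lemma comp_smult_left:
  "arr X Y f \<Longrightarrow> arr Y Z g \<Longrightarrow> (a \<odot>\<^bsub>Hom D Y Z\<^esub> g) \<cdot> f = a \<odot>\<^bsub>Hom D X Z\<^esub> (g \<cdot> f)"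
  using linear_mapD(3)[OF comp_left_hom] by (auto simp: arr_def)

lemma comp_smult_right:
  "arr X Y f \<Longrightarrow> arr Y Z g \<Longrightarrow> g \<cdot> (a \<odot>\<^bsub>Hom D X Y\<^esub> f) = a \<odot>\<^bsub>Hom D X Z\<^esub> (g \<cdot> f)"
  using linear_mapD(3)[OF comp_right_hom] by (auto simp: arr_def)

lemma neg_smult: "arr X Y f \<Longrightarrow> \<ominus>\<^bsub>Hom D X Y\<^esub> f = (-1) \<odot>\<^bsub>Hom D X Y\<^esub> f"
proof -
  assume a: "arr X Y f"
  then interpret complex_space "Hom D X Y" by (intro hom_space arrD)
  show ?thesis using a by (simp add: arr_def smult_minus_one)
qed

lemma neg_comp:
  "arr X Y f \<Longrightarrow> arr Y Z g \<Longrightarrow> (\<ominus>\<^bsub>Hom D Y Z\<^esub> g) \<cdot> f = \<ominus>\<^bsub>Hom D X Z\<^esub> (g \<cdot> f)"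
  by (simp add: neg_smult comp_smult_left arr_comp neg_smult[OF arr_comp])

lemma comp_neg:
  "arr X Y f \<Longrightarrow> arr Y Z g \<Longrightarrow> g \<cdot> (\<ominus>\<^bsub>Hom D X Y\<^esub> f) = \<ominus>\<^bsub>Hom D X Z\<^esub> (g \<cdot> f)"
  by (simp add: neg_smult comp_smult_right arr_comp neg_smult[OF arr_comp])

lemma diff_comp:
  "arr X Y f \<Longrightarrow> arr Y Z g \<Longrightarrow> arr Y Z h \<Longrightarrow>
    (g \<ominus>\<^bsub>Hom D Y Z\<^esub> h) \<cdot> f = g \<cdot> f \<ominus>\<^bsub>Hom D X Z\<^esub> h \<cdot> f"
  by (simp add: a_minus_def comp_add_left arr_neg neg_comp)

lemma comp_diff:
  "arr Y Z g \<Longrightarrow> arr X Y f \<Longrightarrow> arr X Y h \<Longrightarrow>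
    g \<cdot> (f \<ominus>\<^bsub>Hom D X Y\<^esub> h) = g \<cdot> f \<ominus>\<^bsub>Hom D X Z\<^esub> g \<cdot> h"
  by (simp add: a_minus_def comp_add_right arr_neg comp_neg)

lemma hom_arith:
  assumes f: "arr X Y f"
  shows neg_eq_zero_iff: "\<ominus>\<^bsub>Hom D X Y\<^esub> f = Zero D X Y \<longleftrightarrow> f = Zero D X Y"
    and neg_neg: "\<ominus>\<^bsub>Hom D X Y\<^esub> (\<ominus>\<^bsub>Hom D X Y\<^esub> f) = f"
    and add_diff_cancel: "arr X Y g \<Longrightarrow> h = f \<ominus>\<^bsub>Hom D X Y\<^esub> g \<Longrightarrow> f = h \<oplus>\<^bsub>Hom D X Y\<^esub> g"
    and diff_eq_zero_iff: "arr X Y g \<Longrightarrow> f \<ominus>\<^bsub>Hom D X Y\<^esub> g = Zero D X Y \<longleftrightarrow> f = g"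
proof -
  interpret complex_space "Hom D X Y" using f by (intro hom_space arrD)
  have fm: "f \<in> Mor D X Y" using f by (simp add: arr_def)
  show "\<ominus>\<^bsub>Hom D X Y\<^esub> f = Zero D X Y \<longleftrightarrow> f = Zero D X Y" using fm by (metis M.add.inv_eq_1_iff)
  show "\<ominus>\<^bsub>Hom D X Y\<^esub> (\<ominus>\<^bsub>Hom D X Y\<^esub> f) = f" using fm by simp
  assume "arr X Y g"
  then have g: "g \<in> Mor D X Y" by (simp add: arr_def)
  show c: "h = f \<ominus>\<^bsub>Hom D X Y\<^esub> g \<Longrightarrow> f = h \<oplus>\<^bsub>Hom D X Y\<^esub> g" for h
    using fm g by (simp add: a_minus_def a_assoc M.l_neg)
  show "f \<ominus>\<^bsub>Hom D X Y\<^esub> g = Zero D X Y \<longleftrightarrow> f = g"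
    using c[OF refl] fm g by (auto simp: a_minus_def M.r_neg)
qed

subsection \<open>Isomorphisms and zero objects\<close>

definition iso :: "'o \<Rightarrow> 'o \<Rightarrow> 'm \<Rightarrow> bool" where
  "iso X Y f \<longleftrightarrow> arr X Y f \<and> (\<exists>g. arr Y X g \<and> g \<cdot> f = Ident D X \<and> f \<cdot> g = Ident D Y)"

lemma iso_is_iso: "X \<in> Obj D \<Longrightarrow> Y \<in> Obj D \<Longrightarrow> is_iso D X Y f \<longleftrightarrow> iso X Y f"
  by (auto simp: is_iso_def iso_def arr_def)

lemma iso_arr: "iso X Y f \<Longrightarrow> arr X Y f"
  by (simp add: iso_def)

lemma isoE:
  assumes "iso X Y f"
  obtains g where "arr X Y f" "arr Y X g" "iso Y X g" "g \<cdot> f = Ident D X" "f \<cdot> g = Ident D Y"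
  using assms by (auto simp: iso_def)

lemma iso_ident [simp, intro]: "X \<in> Obj D \<Longrightarrow> iso X X (Ident D X)"
  unfolding iso_def using ident_left arr_ident by blast

lemma iso_comp:
  assumes "iso X Y f" "iso Y Z g"
  shows "iso X Z (g \<cdot> f)"
proof -
  obtain f' where f: "arr X Y f" "arr Y X f'" "f' \<cdot> f = Ident D X" "f \<cdot> f' = Ident D Y"
    using assms(1) by (rule isoE)
  obtain g' where g: "arr Y Z g" "arr Z Y g'" "g' \<cdot> g = Ident D Y" "g \<cdot> g' = Ident D Z"
    using assms(2) by (rule isoE)
  have "(f' \<cdot> g') \<cdot> (g \<cdot> f) = f' \<cdot> (g' \<cdot> (g \<cdot> f))"
    using assoc[OF arr_comp[OF f(1) g(1)] g(2) f(2)] .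
  also have "g' \<cdot> (g \<cdot> f) = f" using assoc[OF f(1) g(1,2)] f(1) g(3) by simp
  finally have 1: "(f' \<cdot> g') \<cdot> (g \<cdot> f) = Ident D X" using f by simp
  have "(g \<cdot> f) \<cdot> (f' \<cdot> g') = g \<cdot> (f \<cdot> (f' \<cdot> g'))"
    using assoc[OF arr_comp[OF g(2) f(2)] f(1) g(1)] .
  also have "f \<cdot> (f' \<cdot> g') = g'" using assoc[OF g(2) f(2,1)] f(4) g(2) by simp
  also have "g \<cdot> g' = Ident D Z" by (rule g(4))
  finally show ?thesis using 1 f g arr_comp unfolding iso_def by blast
qed

lemma left_right_inverse_iso:
  assumes "arr X Y f" "arr Y X g" "arr Y X h" "g \<cdot> f = Ident D X" "f \<cdot> h = Ident D Y"
  shows "iso X Y f"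
proof -
  have "g = g \<cdot> (f \<cdot> h)" using assms by simp
  also have "\<dots> = h" using assms assoc[OF assms(3,1,2)] by simp
  finally show ?thesis using assms by (auto simp: iso_def)
qed

definition isom :: "'o \<Rightarrow> 'o \<Rightarrow> bool" where
  "isom X Y \<longleftrightarrow> (\<exists>f. iso X Y f)"

lemma isom_obj: "isom X Y \<Longrightarrow> X \<in> Obj D" "isom X Y \<Longrightarrow> Y \<in> Obj D"
  by (auto simp: isom_def iso_def arr_def)

lemma isom_iff: "X \<in> Obj D \<Longrightarrow> Y \<in> Obj D \<Longrightarrow> isomorphic D X Y \<longleftrightarrow> isom X Y"
  by (simp add: isomorphic_def isom_def iso_is_iso)

lemma isom_refl: "X \<in> Obj D \<Longrightarrow> isom X X"
  by (auto simp: isom_def)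

lemma isom_sym: "isom X Y \<Longrightarrow> isom Y X"
  by (auto simp: isom_def elim: isoE)

lemma isom_trans [trans]: "isom X Y \<Longrightarrow> isom Y Z \<Longrightarrow> isom X Z"
  by (auto simp: isom_def intro: iso_comp)

lemma zero_object_obj: "zero_object D N \<Longrightarrow> N \<in> Obj D"
  by (simp add: zero_object_def)

lemma to_zero_object: "zero_object D N \<Longrightarrow> arr X N f \<Longrightarrow> f = Zero D X N"
  unfolding zero_object_def by (metis arrD arr_zero)

lemma from_zero_object: "zero_object D N \<Longrightarrow> arr N X f \<Longrightarrow> f = Zero D N X"
  unfolding zero_object_def by (metis arrD arr_zero)

lemma zero_object_iff: "zero_object D N \<longleftrightarrow> N \<in> Obj D \<and> Ident D N = Zero D N N"
proof
  assume "zero_object D N"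
  then show "N \<in> Obj D \<and> Ident D N = Zero D N N"
    using to_zero_object zero_object_obj by blast
next
  assume N: "N \<in> Obj D \<and> Ident D N = Zero D N N"
  have "f = Zero D X N" if "arr X N f" for X f
    using that N ident_left[OF that] zero_comp[OF that, of N] by metis
  moreover have "f = Zero D N X" if "arr N X f" for X f
    using that N ident_right[OF that] comp_zero[OF that, of N] by metis
  ultimately show "zero_object D N"
    unfolding zero_object_def using N arrI arrD arr_zero by metis
qed

lemma zero_isom: "zero_object D M \<Longrightarrow> zero_object D N \<Longrightarrow> isom M N"
proof -
  assume MN: "zero_object D M" "zero_object D N"
  then have o: "M \<in> Obj D" "N \<in> Obj D" by (auto dest: zero_object_obj)
  have "iso M N (Zero D M N)" unfolding iso_def
    using MN o by (intro conjI exI[of _ "Zero D N M"]) (auto simp: zero_object_iff)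
  then show ?thesis by (auto simp: isom_def)
qed

lemma isom_zero: "isom M N \<Longrightarrow> zero_object D M \<Longrightarrow> zero_object D N"
proof -
  assume "isom M N" and M: "zero_object D M"
  then obtain f g where fg: "arr M N f" "arr N M g" "f \<cdot> g = Ident D N"
    by (auto simp: isom_def elim: isoE)
  then have "Ident D N = Zero D N N"
    using from_zero_object[OF M fg(1)] by (metis arrD(2) zero_comp)
  then show ?thesis using fg by (auto simp: zero_object_iff arr_def)
qed

definition orth :: "'o \<Rightarrow> 'o \<Rightarrow> bool" where
  "orth X Y \<longleftrightarrow> X \<in> Obj D \<and> Y \<in> Obj D \<and> (\<forall>f. arr X Y f \<longrightarrow> f = Zero D X Y)"

lemma orthD: "orth X Y \<Longrightarrow> arr X Y f \<Longrightarrow> f = Zero D X Y"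
  by (simp add: orth_def)

lemma orth_iff: "X \<in> Obj D \<Longrightarrow> Y \<in> Obj D \<Longrightarrow> orth X Y \<longleftrightarrow> Mor D X Y = {Zero D X Y}"
  using arr_zero by (auto simp: orth_def arr_def)

lemma orth_isom:
  assumes "orth X Y" "isom X X'" "isom Y Y'"
  shows "orth X' Y'"
proof -
  obtain a a' where a: "arr X X' a" "arr X' X a'" "a \<cdot> a' = Ident D X'"
    using assms(2) by (auto simp: isom_def elim: isoE)
  obtain b b' where b: "arr Y Y' b" "arr Y' Y b'" "b \<cdot> b' = Ident D Y'"
    using assms(3) by (auto simp: isom_def elim: isoE)
  have "f = Zero D X' Y'" if f: "arr X' Y' f" for f
  proof -
    have "b' \<cdot> f \<cdot> a = Zero D X Y" using assms(1) a b f by (blast intro: orthD)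
    then have "b \<cdot> (b' \<cdot> f \<cdot> a) \<cdot> a' = Zero D X' Y'" using a b
      by (metis arrD comp_zero zero_comp)
    moreover have "b \<cdot> (b' \<cdot> f \<cdot> a) \<cdot> a' = f"
    proof -
      have "b \<cdot> (b' \<cdot> f \<cdot> a) = b \<cdot> (b' \<cdot> (f \<cdot> a))" using assoc[OF a(1) f b(2)] by simp
      also have "\<dots> = f \<cdot> a"
        using assoc[OF arr_comp[OF a(1) f] b(2,1)] b(3) ident_left[OF arr_comp[OF a(1) f]] by simp
      finally show ?thesis using assoc[OF a(2,1) f] a(3) f by simp
    qed
    ultimately show ?thesis by simp
  qed
  then show ?thesis using a b by (auto simp: orth_def arr_def)
qed

lemma zero_orth: "zero_object D N \<Longrightarrow> X \<in> Obj D \<Longrightarrow> orth N X" "zero_object D N \<Longrightarrow> X \<in> Obj D \<Longrightarrow> orth X N"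
  by (auto simp: orth_def zero_object_obj to_zero_object from_zero_object)

lemma orth_self: "orth X X \<Longrightarrow> zero_object D X"
  by (auto simp: orth_def zero_object_iff)

subsection \<open>Functors\<close>

lemma functor_obj: "linear_functor D F \<Longrightarrow> X \<in> Obj D \<Longrightarrow> onObj F X \<in> Obj D"
  by (simp add: linear_functor_def)

lemma functor_hom:
  "linear_functor D F \<Longrightarrow> X \<in> Obj D \<Longrightarrow> Y \<in> Obj D \<Longrightarrow>
    onMor F \<in> module_hom class_ring (Hom D X Y) (Hom D (onObj F X) (onObj F Y))"
  by (simp add: linear_functor_def)

lemma functor_arr: "linear_functor D F \<Longrightarrow> arr X Y f \<Longrightarrow> arr (onObj F X) (onObj F Y) (onMor F f)"
  using linear_mapD(1)[OF functor_hom] by (auto simp: arr_def functor_obj)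

lemma functor_ident: "linear_functor D F \<Longrightarrow> X \<in> Obj D \<Longrightarrow> onMor F (Ident D X) = Ident D (onObj F X)"
  by (simp add: linear_functor_def)

lemma functor_comp:
  "linear_functor D F \<Longrightarrow> arr X Y f \<Longrightarrow> arr Y Z g \<Longrightarrow> onMor F (g \<cdot> f) = onMor F g \<cdot> onMor F f"
  by (auto simp: linear_functor_def arr_def)

lemma functor_zero:
  "linear_functor D F \<Longrightarrow> X \<in> Obj D \<Longrightarrow> Y \<in> Obj D \<Longrightarrow> onMor F (Zero D X Y) = Zero D (onObj F X) (onObj F Y)"
  by (rule linear_map_zero[OF hom_space hom_space functor_hom]) (auto simp: functor_obj)

lemma functor_smult:
  "linear_functor D F \<Longrightarrow> arr X Y f \<Longrightarrow>
    onMor F (a \<odot>\<^bsub>Hom D X Y\<^esub> f) = a \<odot>\<^bsub>Hom D (onObj F X) (onObj F Y)\<^esub> onMor F f"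
  using linear_mapD(3)[OF functor_hom] by (auto simp: arr_def)

lemma functor_iso: "linear_functor D F \<Longrightarrow> iso X Y f \<Longrightarrow> iso (onObj F X) (onObj F Y) (onMor F f)"
  unfolding iso_def by (metis arrD(1) functor_arr functor_comp functor_ident)

lemma functor_zero_object: "linear_functor D F \<Longrightarrow> zero_object D N \<Longrightarrow> zero_object D (onObj F N)"
  by (simp add: zero_object_iff functor_obj) (metis functor_ident functor_zero)

lemma quasi_inverse_isos:
  assumes "linear_functor D F" "quasi_inverse D F G"
  shows "\<exists>\<eta> \<epsilon>. (\<forall>X. X \<in> Obj D \<longrightarrow> iso (onObj G (onObj F X)) X (\<eta> X)) \<and>
    (\<forall>X Y f. arr X Y f \<longrightarrow> \<eta> Y \<cdot> onMor G (onMor F f) = f \<cdot> \<eta> X) \<and>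
    (\<forall>X. X \<in> Obj D \<longrightarrow> iso (onObj F (onObj G X)) X (\<epsilon> X)) \<and>
    (\<forall>X Y f. arr X Y f \<longrightarrow> \<epsilon> Y \<cdot> onMor F (onMor G f) = f \<cdot> \<epsilon> X)"
proof -
  obtain \<eta> \<epsilon> where \<eta>: "nat_iso D (comp_fun G F) id_fun \<eta>" and \<epsilon>: "nat_iso D (comp_fun F G) id_fun \<epsilon>"
    using assms by (auto simp: quasi_inverse_def)
  have G: "linear_functor D G" using assms(2) by (simp add: quasi_inverse_def)
  have o: "onObj G (onObj F X) \<in> Obj D \<and> onObj F (onObj G X) \<in> Obj D" if "X \<in> Obj D" for X
    using functor_obj[OF assms(1)] functor_obj[OF G] that by auto
  have "is_iso D (onObj G (onObj F X)) X (\<eta> X) \<and> is_iso D (onObj F (onObj G X)) X (\<epsilon> X)"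
    if "X \<in> Obj D" for X
    using \<eta> \<epsilon> that by (auto simp: nat_iso_def comp_fun_def id_fun_def)
  then have i: "iso (onObj G (onObj F X)) X (\<eta> X) \<and> iso (onObj F (onObj G X)) X (\<epsilon> X)"
    if "X \<in> Obj D" for X using o that by (simp add: iso_is_iso)
  have "\<eta> Y \<cdot> onMor G (onMor F f) = f \<cdot> \<eta> X \<and> \<epsilon> Y \<cdot> onMor F (onMor G f) = f \<cdot> \<epsilon> X"
    if "arr X Y f" for X Y f
    using \<eta> \<epsilon> that by (auto simp: nat_iso_def comp_fun_def id_fun_def arr_def)
  then show ?thesis using i by (intro exI[of _ \<eta>] exI[of _ \<epsilon>]) simp
qed

lemma iso_cancel_left:
  assumes "iso Y Z g" "arr X Y f" "arr X Y f'" "g \<cdot> f = g \<cdot> f'"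
  shows "f = f'"
proof -
  obtain h where h: "arr Y Z g" "arr Z Y h" "h \<cdot> g = Ident D Y" using assms(1) by (rule isoE)
  have "h \<cdot> g \<cdot> f = h \<cdot> g \<cdot> f'"
    using assoc[OF assms(2) h(1,2)] assoc[OF assms(3) h(1,2)] assms(4) by simp
  then show ?thesis using h(3) assms(2,3) by simp
qed

lemma iso_cancel_right:
  assumes "iso X Y g" "arr Y Z f" "arr Y Z f'" "f \<cdot> g = f' \<cdot> g"
  shows "f = f'"
proof -
  obtain h where h: "arr X Y g" "arr Y X h" "g \<cdot> h = Ident D Y" using assms(1) by (rule isoE)
  have "f \<cdot> (g \<cdot> h) = f' \<cdot> (g \<cdot> h)"
    using assoc[OF h(2,1) assms(2)] assoc[OF h(2,1) assms(3)] assms(4) by simp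
  then show ?thesis using h(3) assms(2,3) by simp
qed

lemma equivalence_faithful:
  assumes "linear_autoequivalence D F" "arr X Y f" "arr X Y g" "onMor F f = onMor F g"
  shows "f = g"
proof -
  obtain G where F: "linear_functor D F" and G: "quasi_inverse D F G"
    using assms(1) by (auto simp: linear_autoequivalence_def)
  obtain \<eta> \<epsilon> where \<eta>: "\<And>X. X \<in> Obj D \<Longrightarrow> iso (onObj G (onObj F X)) X (\<eta> X)"
      "\<And>X Y f. arr X Y f \<Longrightarrow> \<eta> Y \<cdot> onMor G (onMor F f) = f \<cdot> \<eta> X"
     and \<epsilon>: "\<And>X. X \<in> Obj D \<Longrightarrow> iso (onObj F (onObj G X)) X (\<epsilon> X)"
      "\<And>X Y f. arr X Y f \<Longrightarrow> \<epsilon> Y \<cdot> onMor F (onMor G f) = f \<cdot> \<epsilon> X"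
    by atomize_elim (rule quasi_inverse_isos[OF F G])
  have "f \<cdot> \<eta> X = g \<cdot> \<eta> X" using \<eta>(2)[OF assms(2)] \<eta>(2)[OF assms(3)] assms(4) by simp
  then show ?thesis using iso_cancel_right[OF \<eta>(1)[OF arrD(1)[OF assms(2)]] assms(2,3)] by blast
qed

text \<open>With \<open>G\<close> a quasi-inverse of \<open>F\<close>, the preimage of \<open>h\<close> is the conjugate of \<open>G h\<close> by the unit; applying the
  faithful functor \<open>G\<close> shows that it is mapped to \<open>h\<close>.\<close>

lemma equivalence_full:
  assumes "linear_autoequivalence D F" "X \<in> Obj D" "Y \<in> Obj D" "arr (onObj F X) (onObj F Y) h"
  shows "\<exists>f. arr X Y f \<and> onMor F f = h"
proof -
  obtain G where F: "linear_functor D F" and G: "quasi_inverse D F G"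
    using assms(1) by (auto simp: linear_autoequivalence_def)
  then have lG: "linear_functor D G" by (simp add: quasi_inverse_def)
  obtain \<eta> \<epsilon> where \<eta>: "\<And>X. X \<in> Obj D \<Longrightarrow> iso (onObj G (onObj F X)) X (\<eta> X)"
      "\<And>X Y f. arr X Y f \<Longrightarrow> \<eta> Y \<cdot> onMor G (onMor F f) = f \<cdot> \<eta> X"
     and \<epsilon>: "\<And>X. X \<in> Obj D \<Longrightarrow> iso (onObj F (onObj G X)) X (\<epsilon> X)"
      "\<And>X Y f. arr X Y f \<Longrightarrow> \<epsilon> Y \<cdot> onMor F (onMor G f) = f \<cdot> \<epsilon> X"
    by atomize_elim (rule quasi_inverse_isos[OF F G])
  obtain \<eta>' where \<eta>': "arr X (onObj G (onObj F X)) \<eta>'" "arr (onObj G (onObj F X)) X (\<eta> X)"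
      "\<eta>' \<cdot> \<eta> X = Ident D (onObj G (onObj F X))"
    by (rule isoE[OF \<eta>(1)[OF assms(2)]]) (rule that)
  have Gh: "arr (onObj G (onObj F X)) (onObj G (onObj F Y)) (onMor G h)"
    using functor_arr[OF lG assms(4)] .
  have \<eta>Y: "arr (onObj G (onObj F Y)) Y (\<eta> Y)" using \<eta>(1)[OF assms(3)] by (rule iso_arr)
  define f where "f = \<eta> Y \<cdot> onMor G h \<cdot> \<eta>'"
  have f: "arr X Y f" unfolding f_def using \<eta>Y Gh \<eta>'(1) by blast
  have "f \<cdot> \<eta> X = \<eta> Y \<cdot> onMor G h \<cdot> (\<eta>' \<cdot> \<eta> X)"
    unfolding f_def using assoc[OF \<eta>'(2,1) arr_comp[OF Gh \<eta>Y]] .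
  also have "\<dots> = \<eta> Y \<cdot> onMor G h" using \<eta>'(3) ident_right[OF arr_comp[OF Gh \<eta>Y]] by simp
  finally have "\<eta> Y \<cdot> onMor G (onMor F f) = \<eta> Y \<cdot> onMor G h" using \<eta>(2)[OF f] by simp
  then have GFf: "onMor G (onMor F f) = onMor G h"
    using iso_cancel_left[OF \<eta>(1)[OF assms(3)]] functor_arr[OF lG functor_arr[OF F f]] Gh by blast
  have "h \<cdot> \<epsilon> (onObj F X) = onMor F f \<cdot> \<epsilon> (onObj F X)"
    using \<epsilon>(2)[OF functor_arr[OF F f]] \<epsilon>(2)[OF assms(4)] GFf by simp
  then have "onMor F f = h"
    using iso_cancel_right[OF \<epsilon>(1)[OF functor_obj[OF F assms(2)]] functor_arr[OF F f] assms(4)] by simp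
  then show ?thesis using f by blast
qed

lemma equivalence_orth:
  assumes "linear_autoequivalence D F" "X \<in> Obj D" "Y \<in> Obj D"
  shows "orth (onObj F X) (onObj F Y) \<longleftrightarrow> orth X Y"
proof -
  have F: "linear_functor D F" using assms(1) by (simp add: linear_autoequivalence_def)
  note o = functor_obj[OF F assms(2)] functor_obj[OF F assms(3)]
  have "f = Zero D X Y" if "orth (onObj F X) (onObj F Y)" "arr X Y f" for f
  proof (rule equivalence_faithful[OF assms(1) that(2)])
    show "onMor F f = onMor F (Zero D X Y)"
      using orthD[OF that(1) functor_arr[OF F that(2)]] functor_zero[OF F assms(2,3)] by simp
  qed (use assms in auto)
  moreover have "h = Zero D (onObj F X) (onObj F Y)" if "orth X Y" "arr (onObj F X) (onObj F Y) h" for h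
    using equivalence_full[OF assms that(2)] orthD[OF that(1)] functor_zero[OF F assms(2,3)] by metis
  ultimately show ?thesis using assms o unfolding orth_def by blast
qed

lemma equivalence_zero_object:
  assumes "linear_autoequivalence D F" "X \<in> Obj D" "zero_object D (onObj F X)"
  shows "zero_object D X"
proof -
  have "orth (onObj F X) (onObj F X)" using zero_orth assms(3) zero_object_obj by blast
  then show ?thesis using equivalence_orth[OF assms(1,2,2)] orth_self by blast
qed

lemma equivalence_reflects_iso:
  assumes "linear_autoequivalence D F" "arr X Y f" "iso (onObj F X) (onObj F Y) (onMor F f)"
  shows "iso X Y f"
proof -
  have F: "linear_functor D F" using assms(1) by (simp add: linear_autoequivalence_def)
  note o = arrD(1,2)[OF assms(2)]
  obtain h where h: "arr (onObj F Y) (onObj F X) h" "h \<cdot> onMor F f = Ident D (onObj F X)"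
      "onMor F f \<cdot> h = Ident D (onObj F Y)"
    using assms(3) by (rule isoE)
  obtain g where g: "arr Y X g" "onMor F g = h" using equivalence_full[OF assms(1) o(2,1) h(1)] by blast
  have "g \<cdot> f = Ident D X"
    by (rule equivalence_faithful[OF assms(1)])
       (use g assms h o in \<open>auto simp: functor_comp[OF F] functor_ident[OF F]\<close>)
  moreover have "f \<cdot> g = Ident D Y"
    by (rule equivalence_faithful[OF assms(1)])
       (use g assms h o in \<open>auto simp: functor_comp[OF F] functor_ident[OF F]\<close>)
  ultimately show ?thesis using g assms by (auto simp: iso_def)
qed

lemma equivalence_ess_surj:
  assumes "linear_autoequivalence D F" "X \<in> Obj D"
  shows "\<exists>Y\<in>Obj D. isom (onObj F Y) X"
proof -
  obtain G where F: "linear_functor D F" and G: "quasi_inverse D F G"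
    using assms(1) by (auto simp: linear_autoequivalence_def)
  then have lG: "linear_functor D G" by (simp add: quasi_inverse_def)
  obtain \<eta> \<epsilon> where \<eta>: "\<And>X. X \<in> Obj D \<Longrightarrow> iso (onObj G (onObj F X)) X (\<eta> X)"
      "\<And>X Y f. arr X Y f \<Longrightarrow> \<eta> Y \<cdot> onMor G (onMor F f) = f \<cdot> \<eta> X"
     and \<epsilon>: "\<And>X. X \<in> Obj D \<Longrightarrow> iso (onObj F (onObj G X)) X (\<epsilon> X)"
      "\<And>X Y f. arr X Y f \<Longrightarrow> \<epsilon> Y \<cdot> onMor F (onMor G f) = f \<cdot> \<epsilon> X"
    by atomize_elim (rule quasi_inverse_isos[OF F G])
  then show ?thesis using functor_obj[OF lG] assms(2) unfolding isom_def by blast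
qed

end

section \<open>Triangulated categories\<close>

context triangulated_category
begin

abbreviation sh :: "'o \<Rightarrow> 'o" where "sh \<equiv> shO D"
abbreviation shm :: "'m \<Rightarrow> 'm" where "shm \<equiv> shM D"

definition tri :: "'o \<Rightarrow> 'o \<Rightarrow> 'o \<Rightarrow> 'm \<Rightarrow> 'm \<Rightarrow> 'm \<Rightarrow> bool" where
  "tri X Y Z u v w \<longleftrightarrow> (X, Y, Z, u, v, w) \<in> Tri D"

lemma triD:
  assumes "tri X Y Z u v w"
  shows "X \<in> Obj D" "Y \<in> Obj D" "Z \<in> Obj D" "arr X Y u" "arr Y Z v" "arr Z (sh X) w"
proof -
  have "linear_functor D (Shift D)"
    using shift_autoequivalence by (simp add: linear_autoequivalence_def)
  then have "X \<in> Obj D \<Longrightarrow> sh X \<in> Obj D" by (rule functor_obj)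
  then show "X \<in> Obj D" "Y \<in> Obj D" "Z \<in> Obj D" "arr X Y u" "arr Y Z v" "arr Z (sh X) w"
    using tri_mor assms unfolding tri_def arr_def by blast+
qed

lemma sh_functor: "linear_functor D (Shift D)"
  using shift_autoequivalence by (simp add: linear_autoequivalence_def)

lemma sh_obj [simp, intro]: "X \<in> Obj D \<Longrightarrow> sh X \<in> Obj D"
  using functor_obj[OF sh_functor] .

lemma sh_arr [intro]: "arr X Y f \<Longrightarrow> arr (sh X) (sh Y) (shm f)"
  using functor_arr[OF sh_functor] .

lemma sh_comp: "arr X Y f \<Longrightarrow> arr Y Z g \<Longrightarrow> shm (g \<cdot> f) = shm g \<cdot> shm f"
  using functor_comp[OF sh_functor] .

lemma sh_ident [simp]: "X \<in> Obj D \<Longrightarrow> shm (Ident D X) = Ident D (sh X)"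
  using functor_ident[OF sh_functor] .

lemma sh_zero [simp]: "X \<in> Obj D \<Longrightarrow> Y \<in> Obj D \<Longrightarrow> shm (Zero D X Y) = Zero D (sh X) (sh Y)"
  using functor_zero[OF sh_functor] .

lemma sh_smult: "arr X Y f \<Longrightarrow> shm (a \<odot>\<^bsub>Hom D X Y\<^esub> f) = a \<odot>\<^bsub>Hom D (sh X) (sh Y)\<^esub> shm f"
  using functor_smult[OF sh_functor] .

lemma sh_neg: "arr X Y f \<Longrightarrow> shm (\<ominus>\<^bsub>Hom D X Y\<^esub> f) = \<ominus>\<^bsub>Hom D (sh X) (sh Y)\<^esub> shm f"
  by (simp add: neg_smult sh_smult neg_smult[OF sh_arr])

lemma sh_faithful: "arr X Y f \<Longrightarrow> arr X Y g \<Longrightarrow> shm f = shm g \<Longrightarrow> f = g"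
  using equivalence_faithful[OF shift_autoequivalence] .

lemma sh_full: "X \<in> Obj D \<Longrightarrow> Y \<in> Obj D \<Longrightarrow> arr (sh X) (sh Y) h \<Longrightarrow> \<exists>f. arr X Y f \<and> shm f = h"
  using equivalence_full[OF shift_autoequivalence] .

lemma sh_zero_iff: "arr X Y f \<Longrightarrow> shm f = Zero D (sh X) (sh Y) \<longleftrightarrow> f = Zero D X Y"
  using sh_faithful[of X Y f "Zero D X Y"] by (auto simp: arrD)

lemma sh_orth: "X \<in> Obj D \<Longrightarrow> Y \<in> Obj D \<Longrightarrow> orth (sh X) (sh Y) \<longleftrightarrow> orth X Y"
  using equivalence_orth[OF shift_autoequivalence] .

lemma sh_iso: "iso X Y f \<Longrightarrow> iso (sh X) (sh Y) (shm f)"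
  using functor_iso[OF sh_functor] .

lemma sh_zero_object: "zero_object D N \<Longrightarrow> zero_object D (sh N)"
  using functor_zero_object[OF sh_functor] .

lemma tri_rot: "tri X Y Z u v w \<Longrightarrow> tri Y Z (sh X) v w (\<ominus>\<^bsub>Hom D (sh X) (sh Y)\<^esub> shm u)"
  using tri_rotate triD unfolding tri_def arr_def by metis

lemma tri_rot2:
  "tri X Y Z u v w \<Longrightarrow>
    tri Z (sh X) (sh Y) w (\<ominus>\<^bsub>Hom D (sh X) (sh Y)\<^esub> shm u) (\<ominus>\<^bsub>Hom D (sh Y) (sh Z)\<^esub> shm v)"
  using tri_rot[OF tri_rot] .

lemma tri_unrot:
  "arr X Y u \<Longrightarrow> tri Y Z (sh X) v w (\<ominus>\<^bsub>Hom D (sh X) (sh Y)\<^esub> shm u) \<Longrightarrow> tri X Y Z u v w"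
  using tri_rotate triD unfolding tri_def arr_def by metis

lemma tri_complete_arr: "arr X Y u \<Longrightarrow> \<exists>Z v w. tri X Y Z u v w"
  using tri_complete unfolding tri_def arr_def by blast

lemma tri_map:
  "tri X Y Z u v w \<Longrightarrow> tri X' Y' Z' u' v' w' \<Longrightarrow> arr X X' a \<Longrightarrow> arr Y Y' b \<Longrightarrow> b \<cdot> u = u' \<cdot> a \<Longrightarrow>
    \<exists>c. arr Z Z' c \<and> c \<cdot> v = v' \<cdot> b \<and> shm a \<cdot> w = w' \<cdot> c"
proof -
  assume a: "tri X Y Z u v w" "tri X' Y' Z' u' v' w'" "arr X X' a" "arr Y Y' b" "b \<cdot> u = u' \<cdot> a"
  then obtain c where "c \<in> Mor D Z Z'" "c \<cdot> v = v' \<cdot> b" "shm a \<cdot> w = w' \<cdot> c"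
    using tri_morphism[of X Y Z u v w X' Y' Z' u' v' w' a b] unfolding tri_def arr_def by blast
  then show ?thesis using triD(3)[OF a(1)] triD(3)[OF a(2)] by (auto simp: arr_def)
qed

lemma tri_identity:
  "X \<in> Obj D \<Longrightarrow> zero_object D N \<Longrightarrow> tri X X N (Ident D X) (Zero D X N) (Zero D N (sh X))"
  using tri_ident by (simp add: tri_def)

text \<open>The trivial triangle \<open>X \<rightarrow> X \<rightarrow> N[1]\<close> rotated backwards, which is possible because \<open>N[1]\<close> is a zero object.\<close>

lemma tri_from_zero:
  assumes "X \<in> Obj D" "zero_object D N"
  shows "tri N X X (Zero D N X) (Ident D X) (Zero D X (sh N))"
proof (rule tri_unrot)
  have N: "N \<in> Obj D" using assms(2) by (rule zero_object_obj)
  show "arr N X (Zero D N X)" using N assms by simp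
  have "\<ominus>\<^bsub>Hom D (sh N) (sh X)\<^esub> shm (Zero D N X) = Zero D (sh N) (sh X)"
    using N assms neg_eq_zero_iff by simp
  then show "tri X X (sh N) (Ident D X) (Zero D X (sh N)) (\<ominus>\<^bsub>Hom D (sh N) (sh X)\<^esub> shm (Zero D N X))"
    using tri_identity[OF assms(1) sh_zero_object[OF assms(2)]] by simp
qed

subsection \<open>Long exact sequences\<close>

lemma tri_comp_zero:
  assumes "tri X Y Z u v w"
  shows "v \<cdot> u = Zero D X Z"
proof -
  note t = triD[OF assms]
  obtain N where N: "zero_object D N" using ex_zero_object by blast
  obtain c where c: "arr N Z c" "c \<cdot> Zero D X N = v \<cdot> u"
    using tri_map[OF tri_identity[OF t(1) N] assms, of "Ident D X" u] t by auto
  then show ?thesis using t(1) by simp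
qed

lemma tri_comp_zero': "tri X Y Z u v w \<Longrightarrow> w \<cdot> v = Zero D Y (sh X)"
  using tri_comp_zero[OF tri_rot] .

lemma tri_comp_zero'':
  assumes "tri X Y Z u v w"
  shows "shm u \<cdot> w = Zero D Z (sh Y)"
proof -
  note t = triD[OF assms]
  have "\<ominus>\<^bsub>Hom D Z (sh Y)\<^esub> (shm u \<cdot> w) = Zero D Z (sh Y)"
    using tri_comp_zero[OF tri_rot2[OF assms]] neg_comp[OF t(6) sh_arr[OF t(4)]] by simp
  then show ?thesis using neg_eq_zero_iff[OF arr_comp[OF t(6) sh_arr[OF t(4)]]] by simp
qed

text \<open>A morphism \<open>g\<close> killed by \<open>v\<close> is a morphism from the rotated trivial triangle on \<open>W\<close> to the rotation of the given
  one. Its third component is the shift of the required factor.\<close>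

lemma hom_exact_mid:
  assumes "tri X Y Z u v w" "arr W Y g" "v \<cdot> g = Zero D W Z"
  shows "\<exists>h. arr W X h \<and> g = u \<cdot> h"
proof -
  note t = triD[OF assms(1)]
  obtain N where N: "zero_object D N" using ex_zero_object by blast
  have W: "W \<in> Obj D" and No: "N \<in> Obj D" using assms(2) N zero_object_obj by (auto simp: arr_def)
  obtain c where c: "arr (sh W) (sh X) c"
    "shm g \<cdot> (\<ominus>\<^bsub>Hom D (sh W) (sh W)\<^esub> shm (Ident D W)) = (\<ominus>\<^bsub>Hom D (sh X) (sh Y)\<^esub> shm u) \<cdot> c"
    using tri_map[OF tri_rot[OF tri_identity[OF W N]] tri_rot[OF assms(1)] assms(2), of "Zero D N Z"]
      No W t assms(3) by auto
  obtain h where h: "arr W X h" "shm h = c" using sh_full[OF W t(1) c(1)] by blast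
  have g: "arr (sh W) (sh Y) (shm g)" using assms(2) by blast
  have "\<ominus>\<^bsub>Hom D (sh W) (sh Y)\<^esub> shm g = \<ominus>\<^bsub>Hom D (sh W) (sh Y)\<^esub> (shm u \<cdot> c)"
    using c(2) comp_neg[OF arr_ident[OF sh_obj[OF W]] g] neg_comp[OF c(1) sh_arr[OF t(4)]] W g by simp
  then have "shm g = shm u \<cdot> c" using neg_neg[OF g] neg_neg[OF arr_comp[OF c(1) sh_arr[OF t(4)]]] by metis
  then have "shm g = shm (u \<cdot> h)" using h sh_comp[OF h(1) t(4)] by simp
  then have "g = u \<cdot> h" using sh_faithful[OF assms(2) arr_comp[OF h(1) t(4)]] by simp
  then show ?thesis using h by blast
qed

lemma hom_exact_right:
  "tri X Y Z u v w \<Longrightarrow> arr W Z g \<Longrightarrow> w \<cdot> g = Zero D W (sh X) \<Longrightarrow> \<exists>h. arr W Y h \<and> g = v \<cdot> h"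
  using hom_exact_mid[OF tri_rot] .

lemma hom_exact_shift:
  assumes "tri X Y Z u v w" "arr W (sh X) g" "shm u \<cdot> g = Zero D W (sh Y)"
  shows "\<exists>h. arr W Z h \<and> g = w \<cdot> h"
proof (rule hom_exact_mid[OF tri_rot2[OF assms(1)] assms(2)])
  note t = triD[OF assms(1)]
  show "(\<ominus>\<^bsub>Hom D (sh X) (sh Y)\<^esub> shm u) \<cdot> g = Zero D W (sh Y)"
    using neg_comp[OF assms(2) sh_arr[OF t(4)]] assms(3)
      neg_eq_zero_iff[OF arr_zero[OF arrD(1)[OF assms(2)] sh_obj[OF t(2)]]] by simp
qed

lemma cohom_exact_mid:
  assumes "tri X Y Z u v w" "arr Y W g" "g \<cdot> u = Zero D X W"
  shows "\<exists>h. arr Z W h \<and> g = h \<cdot> v"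
proof -
  note t = triD[OF assms(1)]
  obtain N where N: "zero_object D N" using ex_zero_object by blast
  have W: "W \<in> Obj D" and No: "N \<in> Obj D" using assms(2) N zero_object_obj by (auto simp: arr_def)
  obtain c where "arr Z W c" "c \<cdot> v = Ident D W \<cdot> g"
    using tri_map[OF assms(1) tri_from_zero[OF W N], of "Zero D X N" g] t W No assms by auto
  then show ?thesis using assms(2) by auto
qed

lemma cohom_exact_right:
  "tri X Y Z u v w \<Longrightarrow> arr Z W g \<Longrightarrow> g \<cdot> v = Zero D Y W \<Longrightarrow> \<exists>h. arr (sh X) W h \<and> g = h \<cdot> w"
  using cohom_exact_mid[OF tri_rot] .

lemma cohom_exact_shift:
  assumes "tri X Y Z u v w" "arr (sh X) W g" "g \<cdot> w = Zero D Z W"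
  shows "\<exists>h. arr (sh Y) W h \<and> g = h \<cdot> shm u"
proof -
  note t = triD[OF assms(1)]
  obtain h where h: "arr (sh Y) W h" "g = h \<cdot> (\<ominus>\<^bsub>Hom D (sh X) (sh Y)\<^esub> shm u)"
    using cohom_exact_mid[OF tri_rot2[OF assms(1)] assms(2,3)] by blast
  then have "g = (\<ominus>\<^bsub>Hom D (sh Y) W\<^esub> h) \<cdot> shm u"
    using comp_neg[OF sh_arr[OF t(4)] h(1)] neg_comp[OF sh_arr[OF t(4)] h(1)] by simp
  then show ?thesis using h(1) by blast
qed

text \<open>The functor \<open>Hom(W, -)\<close> is exact at the middle term.\<close>

lemma orth_mid_right: "tri X Y Z u v w \<Longrightarrow> orth W X \<Longrightarrow> orth W Z \<Longrightarrow> orth W Y"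
proof -
  assume t: "tri X Y Z u v w" and o: "orth W X" "orth W Z"
  have "f = Zero D W Y" if f: "arr W Y f" for f
  proof -
    have "v \<cdot> f = Zero D W Z" by (rule orthD[OF o(2)]) (use f triD[OF t] in blast)
    then obtain h where h: "arr W X h" "f = u \<cdot> h" using hom_exact_mid[OF t f] by blast
    then show ?thesis using orthD[OF o(1) h(1)] comp_zero[OF triD(4)[OF t]] by (simp add: arr_def)
  qed
  then show ?thesis using o triD[OF t] unfolding orth_def by blast
qed

lemma orth_mid_left: "tri X Y Z u v w \<Longrightarrow> orth X W \<Longrightarrow> orth Z W \<Longrightarrow> orth Y W"
proof -
  assume t: "tri X Y Z u v w" and o: "orth X W" "orth Z W"
  have "f = Zero D Y W" if f: "arr Y W f" for f
  proof -
    have "f \<cdot> u = Zero D X W" by (rule orthD[OF o(1)]) (use f triD[OF t] in blast)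
    then obtain h where h: "arr Z W h" "f = h \<cdot> v" using cohom_exact_mid[OF t f] by blast
    then show ?thesis using orthD[OF o(2) h(1)] zero_comp[OF triD(5)[OF t]] by (simp add: arr_def)
  qed
  then show ?thesis using o triD[OF t] unfolding orth_def by blast
qed

subsection \<open>Isomorphisms of triangles\<close>

lemma tri_iso_of_zero_left:
  assumes "tri X Y Z u v w" "zero_object D X"
  shows "iso Y Z v"
proof -
  note t = triD[OF assms(1)]
  have "w = Zero D Z (sh X)" using to_zero_object[OF sh_zero_object[OF assms(2)] t(6)] .
  then have "w \<cdot> Ident D Z = Zero D Z (sh X)" using ident_right[OF t(6)] by simp
  then obtain h where h: "arr Z Y h" "Ident D Z = v \<cdot> h"
    using hom_exact_right[OF assms(1) arr_ident[OF t(3)]] by blast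
  have "Ident D Y \<cdot> u = Zero D X Y" using from_zero_object[OF assms(2) t(4)] t by simp
  then obtain h' where h': "arr Z Y h'" "Ident D Y = h' \<cdot> v"
    using cohom_exact_mid[OF assms(1) arr_ident[OF t(2)]] by blast
  show ?thesis by (rule left_right_inverse_iso[OF t(5) h'(1) h(1)]) (use h h' in simp_all)
qed

lemma tri_iso_of_zero_right:
  assumes "tri X Y Z u v w" "zero_object D Z"
  shows "iso X Y u"
proof -
  note t = triD[OF assms(1)]
  have "v \<cdot> Ident D Y = Zero D Y Z" using to_zero_object[OF assms(2) t(5)] t by simp
  then obtain h where h: "arr Y X h" "Ident D Y = u \<cdot> h"
    using hom_exact_mid[OF assms(1) arr_ident[OF t(2)]] by blast
  have "Ident D (sh X) \<cdot> w = Zero D Z (sh X)" using from_zero_object[OF assms(2) t(6)] t by simp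
  then obtain k where k: "arr (sh Y) (sh X) k" "Ident D (sh X) = k \<cdot> shm u"
    using cohom_exact_shift[OF assms(1) arr_ident[OF sh_obj[OF t(1)]]] by blast
  obtain h' where h': "arr Y X h'" "shm h' = k" using sh_full[OF t(2,1) k(1)] by blast
  have "shm (h' \<cdot> u) = shm (Ident D X)" using k h' sh_comp[OF t(4) h'(1)] t by simp
  then have "h' \<cdot> u = Ident D X" using sh_faithful[OF arr_comp[OF t(4) h'(1)] arr_ident[OF t(1)]] by simp
  then show ?thesis by (intro left_right_inverse_iso[OF t(4) h'(1) h(1)]) (use h in simp_all)
qed

text \<open>The difference \<open>n\<close> of \<open>\<phi>\<close> and the identity factors through \<open>w\<close> and is killed by \<open>w\<close>, so \<open>n\<^sup>2 = 0\<close> and \<open>\<phi>\<close> is unipotent.\<close>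

lemma tri_endo_iso:
  assumes "tri X Y Z u v w" "arr Z Z \<phi>" "\<phi> \<cdot> v = v" "w \<cdot> \<phi> = w"
  shows "iso Z Z \<phi>"
proof -
  note t = triD[OF assms(1)]
  let ?i = "Ident D Z" and ?m = "\<lambda>f g. f \<ominus>\<^bsub>Hom D Z Z\<^esub> g"
  have i: "arr Z Z ?i" using t by simp
  define n where "n = ?m \<phi> ?i"
  have n: "arr Z Z n" using assms(2) i arr_diff unfolding n_def by blast
  have "n \<cdot> v = v \<ominus>\<^bsub>Hom D Y Z\<^esub> v" unfolding n_def using diff_comp[OF t(5) assms(2) i] assms(3) t(5) by simp
  then have "n \<cdot> v = Zero D Y Z" using diff_eq_zero_iff[OF t(5,5)] by simp
  then obtain h where h: "arr (sh X) Z h" "n = h \<cdot> w" using cohom_exact_right[OF assms(1) n] by blast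
  have "w \<cdot> n = w \<ominus>\<^bsub>Hom D Z (sh X)\<^esub> w" unfolding n_def using comp_diff[OF t(6) assms(2) i] assms(4) t(6) by simp
  then have wn: "w \<cdot> n = Zero D Z (sh X)" using diff_eq_zero_iff[OF t(6,6)] by simp
  have nn: "n \<cdot> n = Zero D Z Z" using assoc[OF n t(6) h(1)] h wn t(3) by simp
  interpret complex_space "Hom D Z Z" using t(3) by (intro hom_space)
  have c: "\<phi> \<in> Mor D Z Z" "?i \<in> Mor D Z Z" "n \<in> Mor D Z Z" using assms(2) i n by (auto simp: arr_def)
  have \<phi>: "\<phi> = n \<oplus>\<^bsub>Hom D Z Z\<^esub> ?i" using add_diff_cancel[OF assms(2) i n_def] .
  have e: "arr Z Z (?m ?i n)" using i n by blast
  have nn': "\<ominus>\<^bsub>Hom D Z Z\<^esub> n \<in> Mor D Z Z" using arr_neg[OF n] by (simp add: arr_def)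
  have key: "n \<oplus>\<^bsub>Hom D Z Z\<^esub> ?m ?i n = ?i"
  proof -
    have "n \<oplus>\<^bsub>Hom D Z Z\<^esub> ?m ?i n = ?i \<oplus>\<^bsub>Hom D Z Z\<^esub> (n \<oplus>\<^bsub>Hom D Z Z\<^esub> \<ominus>\<^bsub>Hom D Z Z\<^esub> n)"
      unfolding a_minus_def by (rule M.a_lcomm[OF c(3,2) nn'])
    also have "n \<oplus>\<^bsub>Hom D Z Z\<^esub> \<ominus>\<^bsub>Hom D Z Z\<^esub> n = Zero D Z Z" by (rule M.r_neg[OF c(3)])
    also have "?i \<oplus>\<^bsub>Hom D Z Z\<^esub> Zero D Z Z = ?i" by (rule M.r_zero[OF c(2)])
    finally show ?thesis .
  qed
  have "?m ?i n \<cdot> \<phi> = ?m ?i n \<cdot> n \<oplus>\<^bsub>Hom D Z Z\<^esub> ?m ?i n"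
    using comp_add_right[OF e n i] \<phi> e by simp
  also have "?m ?i n \<cdot> n = n"
    using diff_comp[OF n i n] nn n c by (simp add: a_minus_def)
  also note key
  finally have 1: "?m ?i n \<cdot> \<phi> = ?i" .
  have "\<phi> \<cdot> ?m ?i n = n \<cdot> ?m ?i n \<oplus>\<^bsub>Hom D Z Z\<^esub> ?m ?i n"
    using comp_add_left[OF e n i] \<phi> e by simp
  also have "n \<cdot> ?m ?i n = n"
    using comp_diff[OF n i n] nn n c by (simp add: a_minus_def)
  also note key
  finally show ?thesis using 1 e assms(2) unfolding iso_def by blast
qed

text \<open>The completions of \<open>(a, b)\<close> and of its inverse compose to endomorphisms as in \<open>tri_endo_iso\<close>, so the
  completion has a left and a right inverse.\<close>

lemma tri_iso_third:
  assumes T: "tri X Y Z u v w" and T': "tri X' Y' Z' u' v' w'"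
    and a: "iso X X' a" and b: "iso Y Y' b" and eq: "b \<cdot> u = u' \<cdot> a"
  shows "\<exists>c. iso Z Z' c \<and> c \<cdot> v = v' \<cdot> b \<and> shm a \<cdot> w = w' \<cdot> c"
proof -
  note t = triD[OF T] and t' = triD[OF T']
  obtain a' where a': "arr X X' a" "arr X' X a'" "a' \<cdot> a = Ident D X" "a \<cdot> a' = Ident D X'"
    using a by (rule isoE)
  obtain b' where b': "arr Y Y' b" "arr Y' Y b'" "b' \<cdot> b = Ident D Y" "b \<cdot> b' = Ident D Y'"
    using b by (rule isoE)
  have eq': "b' \<cdot> u' = u \<cdot> a'"
  proof -
    have "b' \<cdot> u' = b' \<cdot> (u' \<cdot> a \<cdot> a')" using assoc[OF a'(2,1) t'(4)] a'(4) t' by simp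
    also have "\<dots> = b' \<cdot> (b \<cdot> (u \<cdot> a'))" using assoc[OF a'(2) t(4) b'(1)] eq by simp
    also have "\<dots> = u \<cdot> a'"
      using assoc[OF arr_comp[OF a'(2) t(4)] b'(1,2)] b'(3) ident_left[OF arr_comp[OF a'(2) t(4)]] by simp
    finally show ?thesis .
  qed
  obtain c where c: "arr Z Z' c" "c \<cdot> v = v' \<cdot> b" "shm a \<cdot> w = w' \<cdot> c"
    using tri_map[OF T T' a'(1) b'(1) eq] by blast
  obtain c' where c': "arr Z' Z c'" "c' \<cdot> v' = v \<cdot> b'" "shm a' \<cdot> w' = w \<cdot> c'"
    using tri_map[OF T' T a'(2) b'(2) eq'] by blast
  have "iso Z Z (c' \<cdot> c)"
  proof (rule tri_endo_iso[OF T])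
    show "arr Z Z (c' \<cdot> c)" using c c' by blast
    have "c' \<cdot> c \<cdot> v = c' \<cdot> v' \<cdot> b" using assoc[OF t(5) c(1) c'(1)] assoc[OF b'(1) t'(5) c'(1)] c(2) by simp
    also have "\<dots> = v" using assoc[OF b'(1,2) t(5)] c'(2) b'(3) t by simp
    finally show "c' \<cdot> c \<cdot> v = v" .
    have "w \<cdot> (c' \<cdot> c) = shm a' \<cdot> (w' \<cdot> c)"
      using assoc[OF c(1) c'(1) t(6)] assoc[OF c(1) t'(6) sh_arr[OF a'(2)]] c'(3) by simp
    also have "\<dots> = shm (a' \<cdot> a) \<cdot> w"
      using c(3) assoc[OF t(6) sh_arr[OF a'(1)] sh_arr[OF a'(2)]] sh_comp[OF a'(1,2)] by simp
    finally show "w \<cdot> (c' \<cdot> c) = w" using a'(3) t by simp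
  qed
  then obtain p where p: "arr Z Z p" "p \<cdot> (c' \<cdot> c) = Ident D Z" by (auto simp: iso_def)
  have "iso Z' Z' (c \<cdot> c')"
  proof (rule tri_endo_iso[OF T'])
    show "arr Z' Z' (c \<cdot> c')" using c c' by blast
    have "c \<cdot> c' \<cdot> v' = c \<cdot> v \<cdot> b'" using assoc[OF t'(5) c'(1) c(1)] assoc[OF b'(2) t(5) c(1)] c'(2) by simp
    also have "\<dots> = v'" using assoc[OF b'(2,1) t'(5)] c(2) b'(4) t' by simp
    finally show "c \<cdot> c' \<cdot> v' = v'" .
    have "w' \<cdot> (c \<cdot> c') = shm a \<cdot> (w \<cdot> c')"
      using assoc[OF c'(1) c(1) t'(6)] assoc[OF c'(1) t(6) sh_arr[OF a'(1)]] c(3) by simp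
    also have "\<dots> = shm (a \<cdot> a') \<cdot> w'"
      using c'(3) assoc[OF t'(6) sh_arr[OF a'(2)] sh_arr[OF a'(1)]] sh_comp[OF a'(2,1)] by simp
    finally show "w' \<cdot> (c \<cdot> c') = w'" using a'(4) t' by simp
  qed
  then obtain q where q: "arr Z' Z' q" "(c \<cdot> c') \<cdot> q = Ident D Z'" by (auto simp: iso_def)
  have "iso Z Z' c"
    by (rule left_right_inverse_iso[OF c(1), of "p \<cdot> c'" "c' \<cdot> q"])
       (use p q c c' assoc[OF c(1) c'(1) p(1)] assoc[OF q(1) c'(1) c(1)] in auto)
  then show ?thesis using c by blast
qed

lemma tri_iso_second:
  assumes T: "tri X Y Z u v w" and T': "tri X' Y' Z' u' v' w'"
    and a: "iso X X' a" and c: "iso Z Z' c" and eq: "shm a \<cdot> w = w' \<cdot> c"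
  shows "isom Y Y'"
proof -
  obtain b where b: "iso (sh Y) (sh Y') b"
    using tri_iso_third[OF tri_rot2[OF T] tri_rot2[OF T'] c sh_iso[OF a] eq] by blast
  obtain b' where b': "arr Y Y' b'" "shm b' = b"
    using sh_full[OF triD(2)[OF T] triD(2)[OF T'] iso_arr[OF b]] by blast
  then have "iso Y Y' b'" using equivalence_reflects_iso[OF shift_autoequivalence b'(1)] b by simp
  then show ?thesis by (auto simp: isom_def)
qed

lemma tri_transport:
  assumes T: "tri X Y Z u v w" and a: "iso X X' a" and b: "iso Y Y' b" and c: "iso Z Z' c"
  shows "\<exists>u' v' w'. tri X' Y' Z' u' v' w' \<and> b \<cdot> u = u' \<cdot> a \<and> c \<cdot> v = v' \<cdot> b \<and> shm a \<cdot> w = w' \<cdot> c"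
proof -
  note t = triD[OF T]
  obtain a' where a': "arr X X' a" "arr X' X a'" "a' \<cdot> a = Ident D X" using a by (rule isoE)
  obtain b' where b': "arr Y Y' b" "arr Y' Y b'" "b' \<cdot> b = Ident D Y" using b by (rule isoE)
  obtain c' where c': "arr Z Z' c" "arr Z' Z c'" "c' \<cdot> c = Ident D Z" using c by (rule isoE)
  define u' v' w' where "u' = b \<cdot> u \<cdot> a'" and "v' = c \<cdot> v \<cdot> b'" and "w' = shm a \<cdot> w \<cdot> c'"
  have arrs: "arr X' Y' u'" "arr Y' Z' v'" "arr Z' (sh X') w'"
    unfolding u'_def v'_def w'_def using t a' b' c' by blast+
  have eqs: "b \<cdot> u = u' \<cdot> a" "c \<cdot> v = v' \<cdot> b" "shm a \<cdot> w = w' \<cdot> c"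
    unfolding u'_def v'_def w'_def
    using assoc[OF a'(1,2) arr_comp[OF t(4) b'(1)]] assoc[OF b'(1,2) arr_comp[OF t(5) c'(1)]]
      assoc[OF c'(1,2) arr_comp[OF t(6) sh_arr[OF a'(1)]]]
      a'(3) b'(3) c'(3) ident_right[OF arr_comp[OF t(4) b'(1)]] ident_right[OF arr_comp[OF t(5) c'(1)]]
      ident_right[OF arr_comp[OF t(6) sh_arr[OF a'(1)]]] by simp_all
  have "tri X' Y' Z' u' v' w'" unfolding tri_def
    using tri_iso_closed[OF T[unfolded tri_def], of X' Y' Z' u' v' w' a b c] arrs eqs a b c
      iso_is_iso[of X X'] iso_is_iso[of Y Y'] iso_is_iso[of Z Z'] a' b' c' by (simp add: arr_def)
  then show ?thesis using eqs by blast
qed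

text \<open>The cone of \<open>v\<close> is isomorphic to some \<open>X[1]\<close>, since the shift is essentially surjective, and rotates back.\<close>

lemma fiber_exists:
  assumes "arr Y Z v"
  shows "\<exists>X u w. tri X Y Z u v w"
proof -
  obtain C j k where T: "tri Y Z C v j k" using tri_complete_arr[OF assms] by blast
  note t = triD[OF T]
  obtain X e where X: "X \<in> Obj D" "iso C (sh X) e"
    using equivalence_ess_surj[OF shift_autoequivalence t(3)] isom_sym unfolding isom_def by blast
  obtain v' j' k' where T': "tri Y Z (sh X) v' j' k'" "Ident D Z \<cdot> v = v' \<cdot> Ident D Y"
    using tri_transport[OF T iso_ident[OF t(1)] iso_ident[OF t(2)] X(2)] by blast
  note t' = triD[OF T'(1)]
  have v: "v' = v" using T'(2) t(4) t'(4) by simp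
  obtain u where u: "arr X Y u" "shm u = \<ominus>\<^bsub>Hom D (sh X) (sh Y)\<^esub> k'"
    using sh_full[OF X(1) t(1) arr_neg[OF t'(6)]] by blast
  have "tri X Y Z u v j'" using tri_unrot[OF u(1)] u(2) T'(1) neg_neg[OF t'(6)] v by simp
  then show ?thesis by blast
qed

text \<open>Three rotations change the sign of all three morphisms. Conjugating with \<open>-id\<close> on the middle vertex removes
  two of the signs.\<close>

lemma tri_shift:
  assumes "tri X Y Z u v w"
  shows "tri (sh X) (sh Y) (sh Z) (shm u) (shm v) (\<ominus>\<^bsub>Hom D (sh Z) (sh (sh X))\<^esub> shm w)"
proof -
  note t = triD[OF assms]
  have T: "tri (sh X) (sh Y) (sh Z) (\<ominus>\<^bsub>Hom D (sh X) (sh Y)\<^esub> shm u) (\<ominus>\<^bsub>Hom D (sh Y) (sh Z)\<^esub> shm v)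
      (\<ominus>\<^bsub>Hom D (sh Z) (sh (sh X))\<^esub> shm w)"
    using tri_rot[OF tri_rot2[OF assms]] .
  have i: "iso (sh Y) (sh Y) (\<ominus>\<^bsub>Hom D (sh Y) (sh Y)\<^esub> Ident D (sh Y))" (is "iso _ _ ?n")
  proof -
    have I: "arr (sh Y) (sh Y) (Ident D (sh Y))" using t by simp
    have "?n \<cdot> ?n = Ident D (sh Y)"
      using neg_comp[OF arr_neg[OF I] I] neg_neg[OF I] ident_left[OF arr_neg[OF I]] by simp
    then show ?thesis using arr_neg[OF I] unfolding iso_def by blast
  qed
  obtain u' v' w' where T': "tri (sh X) (sh Y) (sh Z) u' v' w'"
    "?n \<cdot> (\<ominus>\<^bsub>Hom D (sh X) (sh Y)\<^esub> shm u) = u' \<cdot> Ident D (sh X)"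
    "Ident D (sh Z) \<cdot> (\<ominus>\<^bsub>Hom D (sh Y) (sh Z)\<^esub> shm v) = v' \<cdot> ?n"
    "shm (Ident D (sh X)) \<cdot> (\<ominus>\<^bsub>Hom D (sh Z) (sh (sh X))\<^esub> shm w) = w' \<cdot> Ident D (sh Z)"
    using tri_transport[OF T iso_ident[OF sh_obj[OF t(1)]] i iso_ident[OF sh_obj[OF t(3)]]] by blast
  note t' = triD[OF T'(1)]
  have I: "arr (sh Y) (sh Y) (Ident D (sh Y))" using t by simp
  have "u' = shm u"
    using T'(2) neg_comp[OF arr_neg[OF sh_arr[OF t(4)]] I] ident_left[OF arr_neg[OF sh_arr[OF t(4)]]]
      neg_neg[OF sh_arr[OF t(4)]] ident_right[OF t'(4)] by simp
  moreover have "v' = shm v"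
    using T'(3) comp_neg[OF I t'(5)] ident_left[OF arr_neg[OF sh_arr[OF t(5)]]]
      neg_neg[OF sh_arr[OF t(5)]] neg_neg[OF t'(5)] ident_right[OF t'(5)] by metis
  moreover have "w' = \<ominus>\<^bsub>Hom D (sh Z) (sh (sh X))\<^esub> shm w"
    using T'(4) t ident_left[OF arr_neg[OF sh_arr[OF t(6)]]] ident_right[OF t'(6)] by simp
  ultimately show ?thesis using T'(1) by simp
qed

lemma tri_shift2:
  assumes "tri X Y Z u v w"
  shows "tri (sh (sh X)) (sh (sh Y)) (sh (sh Z)) (shm (shm u)) (shm (shm v)) (shm (shm w))"
  using tri_shift[OF tri_shift[OF assms]] sh_neg[OF sh_arr[OF triD(6)[OF assms]]]
    neg_neg[OF sh_arr[OF sh_arr[OF triD(6)[OF assms]]]] by simp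

end

section \<open>Harder--Narasimhan filtrations and cones\<close>

context triangulated_category
begin

text \<open>Injectivity of \<open>Hom(W, X) \<rightarrow> Hom(W, Y)\<close>. The condition \<open>Hom(W, Z[-1]) = 0\<close> is expressed by shifting \<open>W\<close>.\<close>

lemma hom_inj:
  assumes "tri X Y Z u v w" "orth (sh W) Z" "arr W X f" "u \<cdot> f = Zero D W Y"
  shows "f = Zero D W X"
proof -
  note t = triD[OF assms(1)]
  have W: "W \<in> Obj D" using assms(3) by (simp add: arr_def)
  have "shm u \<cdot> shm f = Zero D (sh W) (sh Y)" using sh_comp[OF assms(3) t(4)] assms(4) W t by simp
  then obtain h where h: "arr (sh W) Z h" "shm f = w \<cdot> h"
    using hom_exact_shift[OF assms(1) sh_arr[OF assms(3)]] by blast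
  then have "shm f = Zero D (sh W) (sh X)" using orthD[OF assms(2) h(1)] comp_zero[OF t(6)] W by simp
  then show ?thesis using sh_zero_iff[OF assms(3)] by simp
qed

lemma orth_left:
  assumes "tri X Y Z u v w" "orth W Y" "orth (sh W) Z"
  shows "orth W X"
proof -
  note t = triD[OF assms(1)]
  have "f = Zero D W X" if f: "arr W X f" for f
    using hom_inj[OF assms(1,3) f] orthD[OF assms(2) arr_comp[OF f t(4)]] by simp
  then show ?thesis using assms(2) t unfolding orth_def by blast
qed

lemma tri_unshift:
  assumes "tri (sh X) (sh Y) (sh Z) (shm u) v w" "arr X Y u" "Z \<in> Obj D"
  shows "\<exists>v' w'. tri X Y Z u v' w'"
proof -
  obtain C a b where T: "tri X Y C u a b" using tri_complete_arr[OF assms(2)] by blast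
  note t = triD[OF T]
  obtain c where c: "iso (sh C) (sh Z) c"
    using tri_iso_third[OF tri_shift[OF T] assms(1) iso_ident[OF sh_obj[OF t(1)]] iso_ident[OF sh_obj[OF t(2)]]]
      ident_left[OF sh_arr[OF t(4)]] ident_right[OF sh_arr[OF t(4)]] by auto
  obtain c' where c': "arr C Z c'" "shm c' = c" using sh_full[OF t(3) assms(3) iso_arr[OF c]] by blast
  then have i: "iso C Z c'" using equivalence_reflects_iso[OF shift_autoequivalence c'(1)] c by simp
  obtain u' v' w' where T': "tri X Y Z u' v' w'" "Ident D Y \<cdot> u = u' \<cdot> Ident D X"
    using tri_transport[OF T iso_ident[OF t(1)] iso_ident[OF t(2)] i] by blast
  then have "u' = u" using t(4) triD(4)[OF T'(1)] by simp
  then show ?thesis using T' by blast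
qed

text \<open>For quotients \<open>E \<rightarrow> B \<rightarrow> B'\<close> with kernels \<open>A\<close> and \<open>K\<close>, the octahedral axiom makes the kernel of the composite an
  extension of \<open>K\<close> by \<open>A\<close>.\<close>

lemma kernel_of_composite:
  assumes T1: "tri A E B m q r" and T2: "tri K B B' s p x"
  shows "\<exists>A' m' h c a b. tri A' E B' m' (p \<cdot> q) c \<and> tri A A' K h a b \<and> m = m' \<cdot> h"
proof -
  note t1 = triD[OF T1] and t2 = triD[OF T2]
  obtain A' m' c where T3: "tri A' E B' m' (p \<cdot> q) c" using fiber_exists[OF arr_comp[OF t1(5) t2(5)]] by blast
  note t3 = triD[OF T3]
  obtain f g where fg: "tri (sh A) (sh A') (sh K) f g (shm r \<cdot> (\<ominus>\<^bsub>Hom D (sh K) (sh B)\<^esub> shm s))"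
    "(\<ominus>\<^bsub>Hom D (sh A') (sh E)\<^esub> shm m') \<cdot> f = \<ominus>\<^bsub>Hom D (sh A) (sh E)\<^esub> shm m"
    using octahedral[OF tri_rot[OF T1, unfolded tri_def] tri_rot[OF T2, unfolded tri_def]
        tri_rot[OF T3, unfolded tri_def]] unfolding tri_def by blast
  have f: "arr (sh A) (sh A') f" using triD(4)[OF fg(1)] .
  obtain h where h: "arr A A' h" "shm h = f" using sh_full[OF t1(1) t3(1) f] by blast
  have "shm m' \<cdot> f = shm m"
    using fg(2) neg_comp[OF f sh_arr[OF t3(4)]] neg_neg[OF arr_comp[OF f sh_arr[OF t3(4)]]]
      neg_neg[OF sh_arr[OF t1(4)]] by metis
  then have "shm (m' \<cdot> h) = shm m" using h sh_comp[OF h(1) t3(4)] by simp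
  then have "m = m' \<cdot> h" using sh_faithful[OF arr_comp[OF h(1) t3(4)] t1(4)] by simp
  moreover obtain a b where "tri A A' K h a b"
    using tri_unshift[OF _ h(1) t2(1)] fg(1) h(2) by blast
  ultimately show ?thesis using T3 by blast
qed

lemma orth_self_iff: "X \<in> Obj D \<Longrightarrow> orth X X \<longleftrightarrow> zero_object D X"
  using orth_self zero_orth by blast

lemma extension_closure_obj: "X \<in> extension_closure D S \<Longrightarrow> S \<subseteq> Obj D \<Longrightarrow> X \<in> Obj D"
  by (induction rule: extension_closure.induct) (use tri_mor in blast)+

lemma extension_closure_orth_right:
  assumes "X \<in> extension_closure D S" "\<And>A. A \<in> S \<Longrightarrow> orth Y A"
  shows "orth Y X"
  using assms(1)
proof (induction rule: extension_closure.induct)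
  case (ext X C M u v w)
  then show ?case using orth_mid_right[of X M C u v w] by (simp add: tri_def)
qed (use assms in blast)

lemma extension_closure_orth_shift_left:
  assumes "X \<in> extension_closure D S" "\<And>A. A \<in> S \<Longrightarrow> orth (sh A) Y"
  shows "orth (sh X) Y"
  using assms(1)
proof (induction rule: extension_closure.induct)
  case (ext X C M u v w)
  then show ?case using orth_mid_left[OF tri_shift, of X M C u v w] by (simp add: tri_def)
qed (use assms in blast)

lemma K0_class_additive:
  assumes "tri X Y C u v w"
  shows "K0_class D X \<in> carrier (K0 D)" "K0_class D C \<in> carrier (K0 D)"
    "K0_class D Y = K0_class D X \<otimes>\<^bsub>K0 D\<^esub> K0_class D C"
proof -
  note t = triD[OF assms]
  let ?G = "free_Abelian_group (Obj D)"
  let ?N = "generate ?G (K0_relations D)"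
  interpret G: comm_group ?G by (rule abelian_free_Abelian_group)
  have inG: "frag_of A \<in> carrier ?G" if "A \<in> Obj D" for A
    using that by (simp add: free_Abelian_group_def)
  have sub: "K0_relations D \<subseteq> carrier ?G"
  proof
    fix z assume "z \<in> K0_relations D"
    then obtain A B E a b c where z: "z = frag_of B - frag_of A - frag_of E" and T: "tri A B E a b c"
      by (auto simp: K0_relations_def tri_def)
    have "Poly_Mapping.keys z \<subseteq> Obj D"
      unfolding z using triD[OF T] keys_diff[of "frag_of B - frag_of A" "frag_of E"] keys_diff[of "frag_of B" "frag_of A"]
      by auto
    then show "z \<in> carrier ?G" by (simp add: free_Abelian_group_def)
  qed
  have N: "subgroup ?N ?G" by (rule G.generate_is_subgroup[OF sub])
  then have nN: "?N \<lhd> ?G" by (rule G.subgroup_imp_normal)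
  interpret N: normal ?N ?G by (rule nN)
  show "K0_class D X \<in> carrier (K0 D)" "K0_class D C \<in> carrier (K0 D)"
    using inG t by (auto simp: K0_class_def K0_def FactGroup_def RCOSETS_def)
  have "frag_of Y - frag_of X - frag_of C \<in> ?N"
    using assms unfolding K0_relations_def tri_def by (intro generate.incl) blast
  then have "(frag_of Y - frag_of X - frag_of C) \<otimes>\<^bsub>?G\<^esub> (frag_of X \<otimes>\<^bsub>?G\<^esub> frag_of C)
      \<in> ?N #>\<^bsub>?G\<^esub> (frag_of X \<otimes>\<^bsub>?G\<^esub> frag_of C)"
    unfolding r_coset_def by blast
  then have "frag_of Y \<in> ?N #>\<^bsub>?G\<^esub> (frag_of X \<otimes>\<^bsub>?G\<^esub> frag_of C)"
    by (simp add: free_Abelian_group_def)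
  then have "?N #>\<^bsub>?G\<^esub> frag_of Y = ?N #>\<^bsub>?G\<^esub> (frag_of X \<otimes>\<^bsub>?G\<^esub> frag_of C)"
    using G.repr_independence[OF _ _ N] inG t by (metis G.m_closed)
  also have "\<dots> = (?N #>\<^bsub>?G\<^esub> frag_of X) <#>\<^bsub>?G\<^esub> (?N #>\<^bsub>?G\<^esub> frag_of C)"
    using N.rcos_sum[OF inG[OF t(1)] inG[OF t(3)]] by simp
  finally show "K0_class D Y = K0_class D X \<otimes>\<^bsub>K0 D\<^esub> K0_class D C"
    by (simp add: K0_class_def K0_def FactGroup_def)
qed

end

context stability_condition
begin

definition charge :: "'o \<Rightarrow> complex" where
  "charge X = Z (K0_class D X)"

lemma charge_additive: "tri X Y C u v w \<Longrightarrow> charge Y = charge X + charge C"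
  using K0_class_additive[of X Y C u v w] hom_mult[OF central_charge] by (simp add: charge_def)

lemma sliceD: "X \<in> P \<phi> \<Longrightarrow> X \<in> Obj D"
  using slice_obj by blast

lemma slice_isom: "X \<in> P \<phi> \<Longrightarrow> isom X Y \<Longrightarrow> Y \<in> P \<phi>"
  using slice_iso_closed[of X \<phi> Y] isom_obj[of X Y] isom_iff[of X Y] by blast

lemma slice_orth: "A \<in> P \<phi> \<Longrightarrow> B \<in> P \<psi> \<Longrightarrow> \<psi> < \<phi> \<Longrightarrow> orth A B"
  using slice_hom_zero[of \<psi> \<phi> A B] orth_iff sliceD by blast

lemma slice_sh:
  assumes "X \<in> P \<phi>"
  shows "sh X \<in> P (\<phi> + 1)"
proof -
  have "isomorphic D (sh X) (sh X)" using isom_iff isom_refl sh_obj[OF sliceD[OF assms]] by blast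
  then show ?thesis unfolding slice_shift using sh_obj[OF sliceD[OF assms]] assms by blast
qed

lemma slice_unsh:
  assumes "X \<in> P (\<phi> + 1)"
  shows "\<exists>Y\<in>P \<phi>. isom X (sh Y)"
proof -
  obtain Y where "X \<in> Obj D" "Y \<in> P \<phi>" "isomorphic D X (sh Y)"
    using assms unfolding slice_shift by blast
  then show ?thesis using isom_iff sh_obj[OF sliceD] by blast
qed

subsection \<open>Harder--Narasimhan filtrations\<close>

text \<open>The list contains the phases of the nonzero factors. Its head is the smallest phase, that of the factor
  attached last.\<close>

inductive hn :: "'o \<Rightarrow> real list \<Rightarrow> bool" where
  hn_zero: "zero_object D X \<Longrightarrow> hn X []"
| hn_step: "hn X L \<Longrightarrow> tri X Y A u v w \<Longrightarrow> A \<in> P \<psi> \<Longrightarrow> \<not> zero_object D A \<Longrightarrow> \<forall>\<phi>\<in>set L. \<psi> < \<phi>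
    \<Longrightarrow> hn Y (\<psi> # L)"

lemma hn_isom:
  assumes "hn X L" "isom X X'"
  shows "hn X' L"
  using assms(1)
proof cases
  case hn_zero
  then show ?thesis using isom_zero[OF assms(2)] hn.hn_zero by blast
next
  case (hn_step W L' A u v w \<psi>)
  obtain b where b: "iso X X' b" using assms(2) by (auto simp: isom_def)
  note t = triD[OF hn_step(3)]
  obtain u' v' w' where "tri W X' A u' v' w'"
    using tri_transport[OF hn_step(3) iso_ident[OF t(1)] b iso_ident[OF t(3)]] by blast
  then show ?thesis using hn_step hn.hn_step by blast
qed

text \<open>Steps of the filtration with a zero factor do not change the object and are skipped.\<close>

lemma hn_exists:
  assumes "X \<in> Obj D"
  shows "\<exists>L. hn X L"
proof (cases "zero_object D X")
  case True
  then show ?thesis using hn_zero by blast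
next
  case False
  from harder_narasimhan[OF assms False] show ?thesis
  proof (elim exE conjE)
    fix n :: nat and \<phi> E A
    assume E0: "zero_object D (E 0)" and En: "E n = X"
      and dec: "\<forall>i\<in>{1..n}. \<forall>j\<in>{1..n}. i < j \<longrightarrow> \<phi> i > \<phi> j"
      and steps: "\<forall>j\<in>{1..n}. A j \<in> P (\<phi> j) \<and> (\<exists>u v w. (E (j - 1), E j, A j, u, v, w) \<in> Tri D)"
  have "j \<le> n \<Longrightarrow> \<exists>L. hn (E j) L \<and> set L \<subseteq> \<phi> ` {1..j}" for j
  proof (induction j)
    case 0
    then show ?case using hn_zero[OF E0] by (intro exI[of _ "[]"]) simp
  next
    case (Suc j)
    then obtain L where L: "hn (E j) L" "set L \<subseteq> \<phi> ` {1..j}" by auto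
    have "Suc j \<in> {1..n}" using Suc.prems by simp
    with steps obtain u v w where A: "A (Suc j) \<in> P (\<phi> (Suc j))"
      and T: "tri (E j) (E (Suc j)) (A (Suc j)) u v w" unfolding tri_def by fastforce
    show ?case
    proof (cases "zero_object D (A (Suc j))")
      case True
      then have "isom (E j) (E (Suc j))" using tri_iso_of_zero_right[OF T] by (auto simp: isom_def)
      then show ?thesis using hn_isom[OF L(1)] L(2) by (intro exI[of _ L]) auto
    next
      case False
      have "\<phi> (Suc j) < \<psi>" if \<psi>: "\<psi> \<in> set L" for \<psi>
      proof -
        obtain i where "i \<in> {1..j}" "\<psi> = \<phi> i" using L(2) \<psi> by blast
        then show ?thesis using dec Suc.prems by simp
      qed
      then have "hn (E (Suc j)) (\<phi> (Suc j) # L)" using hn_step[OF L(1) T A False] by blast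
      then show ?thesis using L(2) by (intro exI[of _ "\<phi> (Suc j) # L"]) auto
    qed
  qed
  then show ?thesis using En by blast
  qed
qed

lemma hn_sorted: "hn X L \<Longrightarrow> sorted_wrt (<) L"
  by (induction rule: hn.induct) auto

lemma hn_orth_right: "hn X L \<Longrightarrow> A \<in> P \<psi> \<Longrightarrow> \<forall>\<phi>\<in>set L. \<psi> < \<phi> \<Longrightarrow> orth X A"
proof (induction rule: hn.induct)
  case (hn_zero X)
  then show ?case using zero_orth sliceD by blast
next
  case (hn_step X L Y B u v w \<phi>)
  then show ?case using orth_mid_left[OF hn_step(2)] slice_orth[of B \<phi> A \<psi>] by simp
qed

lemma hn_shift: "hn X L \<Longrightarrow> hn (sh X) (map (\<lambda>\<phi>. \<phi> + 1) L)"
proof (induction rule: hn.induct)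
  case (hn_zero X)
  then show ?case using hn.hn_zero sh_zero_object by simp
next
  case (hn_step X L Y A u v w \<psi>)
  have "\<not> zero_object D (sh A)"
    using equivalence_zero_object[OF shift_autoequivalence] hn_step(3,4) sliceD by blast
  then show ?case
    using hn.hn_step[OF hn_step.IH tri_shift[OF hn_step(2)] slice_sh[OF hn_step(3)]] hn_step(5) by simp
qed

text \<open>If the morphism from \<open>X\<close> to its last factor \<open>A\<close> were zero, the identity of \<open>A\<close> would factor through the shift of
  the previous step of the filtration, whose phases are all larger than \<open>\<psi>\<close>.\<close>

lemma hn_last:
  assumes "hn X (\<psi> # L)"
  shows "\<exists>A\<in>P \<psi>. \<not> orth X A"
  using assms
proof cases
  case (hn_step W A u v w)
  have "\<not> orth X A"
  proof
    assume "orth X A"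
    note t = triD[OF hn_step(2)]
    have "Ident D A \<cdot> v = Zero D X A" using orthD[OF \<open>orth X A\<close> t(5)] t(2,3) by simp
    then obtain h where h: "arr (sh W) A h" "Ident D A = h \<cdot> w"
      using cohom_exact_right[OF hn_step(2) arr_ident[OF t(3)]] by blast
    have "orth (sh W) A" using hn_orth_right[OF hn_shift[OF hn_step(1)] hn_step(3)] hn_step(5) by force
    then have "Ident D A = Zero D A A" using orthD[OF _ h(1)] h(2) zero_comp[OF t(6) t(3)] by simp
    then show False using hn_step(4) t(3) zero_object_iff by blast
  qed
  then show ?thesis using hn_step(3) by blast
qed

text \<open>The first factor has the largest phase. A nonzero morphism from it survives every later step, because there are no
  nonzero morphisms to the factors shifted by \<open>-1\<close>.\<close>

lemma hn_first:
  assumes "hn X L" "L \<noteq> []"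
  shows "\<exists>A\<in>P (last L). \<not> orth A X"
  using assms
proof (induction rule: hn.induct)
  case (hn_step X L Y A u v w \<psi>)
  note t = triD[OF hn_step(2)]
  show ?case
  proof (cases "L = []")
    case True
    then have "zero_object D X" using hn_step(1) hn.cases by blast
    then have "isom Y A" using tri_iso_of_zero_left[OF hn_step(2)] by (auto simp: isom_def)
    then have "\<not> orth A Y" using orth_isom[of A Y A A] orth_self_iff[OF t(3)] isom_refl[OF t(3)] hn_step(4) by blast
    then show ?thesis using True hn_step(3) by auto
  next
    case False
    then obtain B where B: "B \<in> P (last L)" "\<not> orth B X" using hn_step.IH by blast
    have "\<psi> < last L + 1" using hn_step(5) False last_in_set[of L] by fastforce
    then have "orth (sh B) A" using slice_orth[OF slice_sh[OF B(1)] hn_step(3)] by simp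
    then have "\<not> orth B Y" using orth_left[OF hn_step(2)] B(2) by blast
    then show ?thesis using False B(1) by auto
  qed
qed simp

text \<open>By \<open>hn_last\<close> the smallest phase of \<open>X\<close> is the phase of an object that receives a nonzero morphism from \<open>X\<close>.\<close>

lemma hn_lower:
  assumes "hn X L" "\<And>\<psi> A. \<psi> < a \<Longrightarrow> A \<in> P \<psi> \<Longrightarrow> orth X A" "\<phi> \<in> set L"
  shows "a \<le> \<phi>"
proof (cases L)
  case (Cons \<psi> L')
  then have "a \<le> \<psi>" using hn_last[of X \<psi> L'] assms(1,2) by force
  moreover have "\<psi> \<le> \<phi>" using hn_sorted[OF assms(1)] Cons assms(3) by auto
  ultimately show ?thesis by simp
qed (use assms in simp)

lemma hn_upper:
  assumes "hn X L" "\<And>\<psi> A. b < \<psi> \<Longrightarrow> A \<in> P \<psi> \<Longrightarrow> orth A X" "\<phi> \<in> set L"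
  shows "\<phi> \<le> b"
proof -
  have ne: "L \<noteq> []" using assms(3) by auto
  have "last L \<le> b" using hn_first[OF assms(1) ne] assms(2) by force
  moreover have "\<phi> \<le> last L"
  proof -
    obtain i where i: "i < length L" "\<phi> = L ! i" using assms(3) by (auto simp: in_set_conv_nth)
    have "i = length L - 1 \<or> i < length L - 1" using i by linarith
    then show ?thesis
      using sorted_wrt_nth_less[OF hn_sorted[OF assms(1)], of i "length L - 1"] i ne
      by (auto simp: last_conv_nth)
  qed
  ultimately show ?thesis by simp
qed

text \<open>The imaginary part of the central charge after rotating phase \<open>\<phi>\<close> to the positive real axis.\<close>

definition slope :: "real \<Rightarrow> 'o \<Rightarrow> real" where
  "slope \<phi> X = Im (charge X * exp (- (\<i> * of_real pi * of_real \<phi>)))"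

lemma slope_additive: "tri X Y C u v w \<Longrightarrow> slope \<phi> Y = slope \<phi> X + slope \<phi> C"
  by (simp add: slope_def charge_additive distrib_right)

lemma slope_slice:
  assumes "A \<in> P \<psi>" "\<not> zero_object D A"
  shows "\<exists>r>0. slope \<phi> A = r * sin (pi * (\<psi> - \<phi>))"
proof -
  obtain r where r: "r > 0" "charge A = of_real r * exp (\<i> * of_real pi * of_real \<psi>)"
    using slice_phase[OF assms] by (auto simp: charge_def)
  have "charge A * exp (- (\<i> * of_real pi * of_real \<phi>)) = of_real r * exp (\<i> * of_real (pi * (\<psi> - \<phi>)))"
    unfolding r(2) by (simp add: mult.assoc exp_add[symmetric] algebra_simps)
  then have "slope \<phi> A = r * sin (pi * (\<psi> - \<phi>))"
    unfolding slope_def by (simp only: cis_conv_exp[symmetric]) simp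
  then show ?thesis using r(1) by blast
qed

lemma slope_zero: "zero_object D X \<Longrightarrow> slope \<phi> X = 0"
  using slope_additive[OF tri_identity, of X X \<phi>] zero_object_obj by simp

text \<open>Each factor of phase in \<open>[\<phi>, \<phi> + 1]\<close> contributes a nonnegative amount, which vanishes only at the two ends.\<close>

lemma slope_hn:
  assumes "hn X L" "set L \<subseteq> {\<phi>..\<phi> + 1}"
  shows "0 \<le> slope \<phi> X \<and> (slope \<phi> X = 0 \<longrightarrow> set L \<subseteq> {\<phi>, \<phi> + 1})"
  using assms
proof (induction rule: hn.induct)
  case (hn_zero X)
  then show ?case using slope_zero by simp
next
  case (hn_step X L Y A u v w \<psi>)
  obtain r where r: "r > 0" "slope \<phi> A = r * sin (pi * (\<psi> - \<phi>))"
    using slope_slice[OF hn_step(3,4)] by blast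
  have \<psi>: "\<phi> \<le> \<psi>" "\<psi> \<le> \<phi> + 1" using hn_step.prems by auto
  have le: "0 \<le> pi * (\<psi> - \<phi>)" "pi * (\<psi> - \<phi>) \<le> pi" using \<psi> by (auto simp: mult_left_le)
  have A0: "0 \<le> slope \<phi> A" using r sin_ge_zero[OF le] by simp
  have A1: "\<psi> = \<phi> \<or> \<psi> = \<phi> + 1" if "slope \<phi> A = 0"
  proof (rule ccontr)
    assume "\<not> ?thesis"
    then have "0 < pi * (\<psi> - \<phi>)" "pi * (\<psi> - \<phi>) < pi * 1" using \<psi> by (simp, intro mult_strict_left_mono) auto
    then have "0 < sin (pi * (\<psi> - \<phi>))" by (intro sin_gt_zero) auto
    then show False using that r by simp
  qed
  have IH: "0 \<le> slope \<phi> X \<and> (slope \<phi> X = 0 \<longrightarrow> set L \<subseteq> {\<phi>, \<phi> + 1})"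
    using hn_step.IH hn_step.prems by simp
  have add: "slope \<phi> Y = slope \<phi> X + slope \<phi> A" using slope_additive[OF hn_step(2)] .
  have "set (\<psi> # L) \<subseteq> {\<phi>, \<phi> + 1}" if "slope \<phi> Y = 0"
  proof -
    have "slope \<phi> X = 0" "slope \<phi> A = 0" using that add A0 IH by linarith+
    then show ?thesis using A1 IH by auto
  qed
  then show ?case using A0 IH add by auto
qed

lemma hn_single:
  assumes "hn X L" "set L \<subseteq> {\<phi>}"
  shows "X \<in> P \<phi>"
  using assms(1)
proof cases
  case hn_zero
  then show ?thesis using slice_zero by blast
next
  case (hn_step W L' A u v w \<psi>)
  then have "\<psi> = \<phi>" "L' = []" using assms(2) by (auto, cases L', auto)
  then have "zero_object D W" using hn_step(2) hn.cases by blast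
  then have "isom A X" using tri_iso_of_zero_left[OF hn_step(3)] isom_sym by (auto simp: isom_def)
  then show ?thesis using slice_isom hn_step(4) \<open>\<psi> = \<phi>\<close> by blast
qed

text \<open>Such a \<open>Y\<close> has no nonzero morphisms from objects of phase larger than \<open>\<phi>\<close> or to objects of phase smaller than
  \<open>\<phi>\<close>, so all its Harder--Narasimhan phases are \<open>\<phi>\<close>.\<close>

lemma slice_extension:
  assumes "tri X Y C u v w" "X \<in> P \<phi>" "C \<in> P \<phi>"
  shows "Y \<in> P \<phi>"
proof -
  obtain L where L: "hn Y L" using hn_exists[OF triD(2)[OF assms(1)]] by blast
  have "\<phi> \<le> \<psi>" if "\<psi> \<in> set L" for \<psi>
    by (rule hn_lower[OF L _ that]) (use orth_mid_left[OF assms(1)] slice_orth assms in blast)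
  moreover have "\<psi> \<le> \<phi>" if "\<psi> \<in> set L" for \<psi>
    by (rule hn_upper[OF L _ that]) (use orth_mid_right[OF assms(1)] slice_orth assms in blast)
  ultimately have "set L \<subseteq> {\<phi>}" by force
  then show ?thesis using hn_single[OF L] by blast
qed

text \<open>The cone of a morphism of semistable objects of phase \<open>\<phi>\<close> has its Harder--Narasimhan phases in
  \<open>[\<phi>, \<phi> + 1]\<close>. Its central charge lies on the real line through \<open>exp (i \<pi> \<phi>)\<close>, so only the two end
  points occur: the cone is an extension of the cokernel \<open>F\<close> by the shifted kernel \<open>T\<close>.\<close>

lemma cone_decomposition:
  assumes T: "tri M E C m j k" and "M \<in> P \<phi>" "E \<in> P \<phi>"
  shows "\<exists>T F a b c. tri T C F a b c \<and> T \<in> P (\<phi> + 1) \<and> F \<in> P \<phi>"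
proof -
  obtain L where L: "hn C L" using hn_exists[OF triD(3)[OF T]] by blast
  have "\<phi> \<le> \<psi>" if "\<psi> \<in> set L" for \<psi>
  proof (rule hn_lower[OF L _ that])
    fix \<psi> A assume "\<psi> < \<phi>" "A \<in> P \<psi>"
    then show "orth C A"
      using orth_mid_left[OF tri_rot[OF T]] slice_orth[OF assms(3)] slice_orth[OF slice_sh[OF assms(2)]] by force
  qed
  moreover have "\<psi> \<le> \<phi> + 1" if "\<psi> \<in> set L" for \<psi>
  proof (rule hn_upper[OF L _ that])
    fix \<psi> A assume A: "\<phi> + 1 < \<psi>" "A \<in> P \<psi>"
    have "orth A E" "orth A (sh M)"
      using slice_orth[OF A(2) assms(3)] slice_orth[OF A(2) slice_sh[OF assms(2)]] A(1) by simp_all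
    then show "orth A C" using orth_mid_right[OF tri_rot[OF T]] by blast
  qed
  ultimately have "set L \<subseteq> {\<phi>..\<phi> + 1}" by auto
  moreover have "slope \<phi> C = 0"
  proof -
    have "slope \<phi> A = 0" if "A \<in> P \<phi>" for A
      using slope_slice[OF that, of \<phi>] slope_zero by (cases "zero_object D A") auto
    then show ?thesis using slope_additive[OF T, of \<phi>] assms by simp
  qed
  ultimately have sub: "set L \<subseteq> {\<phi>, \<phi> + 1}" using slope_hn[OF L] by blast
  obtain N where N: "zero_object D N" using ex_zero_object by blast
  have C: "C \<in> Obj D" using triD(3)[OF T] .
  have top: ?thesis if "C \<in> P (\<phi> + 1)"
    using tri_identity[OF C N] that slice_zero[OF N] by blast
  \<comment> \<open>If only one of the two phases occurs, the other end of the triangle is a zero object.\<close>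
  have bot: ?thesis if "C \<in> P \<phi>"
    using tri_from_zero[OF C N] that slice_zero[OF N] by blast
  from L show ?thesis
  proof cases
    case hn_zero
    then show ?thesis using bot slice_zero by blast
  next
    case (hn_step W L' A u v w \<psi>)
    show ?thesis
    proof (cases "\<psi> = \<phi>")
      case True
      then have "set L' \<subseteq> {\<phi> + 1}" using hn_step sub by auto
      then have "W \<in> P (\<phi> + 1)" using hn_single[OF hn_step(2)] by blast
      then show ?thesis using hn_step(3,4) True by blast
    next
      case False
      then have "\<psi> = \<phi> + 1" using hn_step(1) sub by auto
      moreover have "L' = []" using hn_step(1,6) sub \<open>\<psi> = \<phi> + 1\<close> by (cases L') auto
      ultimately have "set L \<subseteq> {\<phi> + 1}" using hn_step(1) by simp
      then show ?thesis using top hn_single[OF L] by blast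
    qed
  qed
qed

end

section \<open>Semistable objects of a fixed phase\<close>

context stability_condition
begin

text \<open>Cancellation is reduced to trivial kernel by taking differences.\<close>

lemma mono_slice_iff:
  "mono_in D (P \<phi>) M E m \<longleftrightarrow> M \<in> P \<phi> \<and> E \<in> P \<phi> \<and> arr M E m \<and>
    (\<forall>W\<in>P \<phi>. \<forall>g. arr W M g \<and> m \<cdot> g = Zero D W E \<longrightarrow> g = Zero D W M)"
proof (intro iffI conjI; (elim conjE)?)
  assume m: "mono_in D (P \<phi>) M E m"
  then show "M \<in> P \<phi>" "E \<in> P \<phi>" "arr M E m" by (auto simp: mono_in_def arr_def sliceD)
  then show "\<forall>W\<in>P \<phi>. \<forall>g. arr W M g \<and> m \<cdot> g = Zero D W E \<longrightarrow> g = Zero D W M"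
    using m arr_zero[OF sliceD sliceD, THEN arrD(3), of _ \<phi> M \<phi>] comp_zero[OF _ sliceD]
    unfolding mono_in_def arr_def by metis
next
  assume M: "M \<in> P \<phi>" "E \<in> P \<phi>" "arr M E m"
    and z: "\<forall>W\<in>P \<phi>. \<forall>g. arr W M g \<and> m \<cdot> g = Zero D W E \<longrightarrow> g = Zero D W M"
  have "g = h" if W: "W \<in> P \<phi>" and gh: "arr W M g" "arr W M h" "m \<cdot> g = m \<cdot> h" for W g h
  proof -
    have "m \<cdot> (g \<ominus>\<^bsub>Hom D W M\<^esub> h) = Zero D W E"
      using comp_diff[OF M(3) gh(1,2)] gh(3) diff_eq_zero_iff[OF arr_comp[OF gh(2) M(3)] arr_comp[OF gh(2) M(3)]] by simp
    then have "g \<ominus>\<^bsub>Hom D W M\<^esub> h = Zero D W M" using z W arr_diff[OF gh(1,2)] by blast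
    then show ?thesis using diff_eq_zero_iff[OF gh(1,2)] by simp
  qed
  then show "mono_in D (P \<phi>) M E m" using M sliceD unfolding mono_in_def arr_def by blast
qed

lemma monoD:
  assumes "mono_in D (P \<phi>) M E m"
  shows "M \<in> P \<phi>" "E \<in> P \<phi>" "arr M E m"
    "W \<in> P \<phi> \<Longrightarrow> arr W M g \<Longrightarrow> m \<cdot> g = Zero D W E \<Longrightarrow> g = Zero D W M"
    "arr W M g \<Longrightarrow> arr W M h \<Longrightarrow> W \<in> P \<phi> \<Longrightarrow> m \<cdot> g = m \<cdot> h \<Longrightarrow> g = h"
  using assms[unfolded mono_slice_iff] assms[unfolded mono_in_def] by (blast, blast, blast, blast, auto simp: arr_def)

lemma mono_of_cone:
  assumes T: "tri M E C m j k" and "M \<in> P \<phi>" "E \<in> P \<phi>" "C \<in> P \<phi>"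
  shows "mono_in D (P \<phi>) M E m"
  unfolding mono_slice_iff
proof (intro conjI ballI allI impI; (elim conjE)?)
  fix W g assume W: "W \<in> P \<phi>" and g: "arr W M g" "m \<cdot> g = Zero D W E"
  show "g = Zero D W M"
    by (rule hom_inj[OF T slice_orth[OF slice_sh[OF W] assms(4)] g]) simp
qed (use assms triD[OF T] in auto)

lemma slice_of_zero_top:
  assumes T: "tri T C F a b c" and "zero_object D T" "F \<in> P \<phi>"
  shows "C \<in> P \<phi>"
proof -
  have "isom F C" using tri_iso_of_zero_left[OF T assms(2)] isom_sym by (auto simp: isom_def)
  then show ?thesis using slice_isom assms(3) by blast
qed

text \<open>The kernel is \<open>K = T[-1]\<close>, with inclusion the composite of \<open>T \<rightarrow> C\<close> and the connecting morphism \<open>C \<rightarrow> M[1]\<close>.\<close>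

lemma slice_kernel:
  assumes T: "tri M E C m j k" and M: "M \<in> P \<phi>" and E: "E \<in> P \<phi>"
    and dec: "tri T C F a b c" "T \<in> P (\<phi> + 1)" "F \<in> P \<phi>"
  shows "\<exists>K i. mono_in D (P \<phi>) K M i \<and> m \<cdot> i = Zero D K E \<and> isom T (sh K)"
proof -
  note t = triD[OF T] and d = triD[OF dec(1)]
  obtain K e where K: "K \<in> P \<phi>" and e: "iso (sh K) T e"
    using slice_unsh[OF dec(2)] isom_sym unfolding isom_def by blast
  note ea = iso_arr[OF e]
  have ae: "arr (sh K) C (a \<cdot> e)" using arr_comp[OF ea d(4)] .
  obtain i where i: "arr K M i" "shm i = k \<cdot> (a \<cdot> e)"
    using sh_full[OF sliceD[OF K] t(1) arr_comp[OF ae t(6)]] by blast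
  have "shm (m \<cdot> i) = shm m \<cdot> (k \<cdot> (a \<cdot> e))" using sh_comp[OF i(1) t(4)] i(2) by simp
  also have "\<dots> = Zero D (sh K) (sh E)"
    using assoc[OF ae t(6) sh_arr[OF t(4)]] tri_comp_zero''[OF T] zero_comp[OF ae sh_obj[OF t(2)]] by simp
  finally have mi: "m \<cdot> i = Zero D K E" using sh_zero_iff[OF arr_comp[OF i(1) t(4)]] by simp
  have "mono_in D (P \<phi>) K M i" unfolding mono_slice_iff
  proof (intro conjI ballI allI impI; (elim conjE)?)
    fix W g assume W: "W \<in> P \<phi>" and g: "arr W K g" and ig: "i \<cdot> g = Zero D W M"
    have shg: "arr (sh W) (sh K) (shm g)" using g by blast
    have eg: "arr (sh W) T (e \<cdot> shm g)" using arr_comp[OF shg ea] .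
    have aeg: "arr (sh W) C (a \<cdot> (e \<cdot> shm g))" using arr_comp[OF eg d(4)] .
    have "k \<cdot> (a \<cdot> (e \<cdot> shm g)) = shm (i \<cdot> g)"
      using assoc[OF shg ea d(4)] assoc[OF shg ae t(6)] i(2) sh_comp[OF g i(1)] by simp
    also have "\<dots> = Zero D (sh W) (sh M)" using ig sliceD[OF W] t(1) by simp
    finally obtain h where h: "arr (sh W) E h" "a \<cdot> (e \<cdot> shm g) = j \<cdot> h"
      using hom_exact_right[OF T aeg] by blast
    have "orth (sh W) E" using slice_orth[OF slice_sh[OF W] E] by simp
    then have "a \<cdot> (e \<cdot> shm g) = Zero D (sh W) C"
      using orthD[OF _ h(1)] h(2) comp_zero[OF t(5) sh_obj[OF sliceD[OF W]]] by simp
    moreover have "orth (sh (sh W)) F" using slice_orth[OF slice_sh[OF slice_sh[OF W]] dec(3)] by simp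
    ultimately have "e \<cdot> shm g = Zero D (sh W) T" using hom_inj[OF dec(1) _ eg] by blast
    then have "e \<cdot> shm g = e \<cdot> Zero D (sh W) (sh K)" using comp_zero[OF ea sh_obj[OF sliceD[OF W]]] by simp
    then have "shm g = Zero D (sh W) (sh K)"
      by (rule iso_cancel_left[OF e shg arr_zero[OF sh_obj[OF sliceD[OF W]] arrD(1)[OF ea]]])
    then show "g = Zero D W K" using sh_zero_iff[OF g] by simp
  qed (use K M i in auto)
  then show ?thesis using mi e isom_sym unfolding isom_def by blast
qed

text \<open>The kernel of a monomorphism is zero, so only the cokernel is left of its cone.\<close>

lemma mono_cone:
  assumes mono: "mono_in D (P \<phi>) M E m" and T: "tri M E C m j k"
  shows "C \<in> P \<phi>"
proof -
  note m = monoD[OF mono]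
  obtain T' F a b c where dec: "tri T' C F a b c" "T' \<in> P (\<phi> + 1)" "F \<in> P \<phi>"
    using cone_decomposition[OF T m(1,2)] by blast
  obtain K i where K: "mono_in D (P \<phi>) K M i" "m \<cdot> i = Zero D K E" "isom T' (sh K)"
    using slice_kernel[OF T m(1,2) dec] by blast
  note k = monoD[OF K(1)]
  have "i = Zero D K M" using m(4)[OF k(1,3) K(2)] .
  then have "i \<cdot> Ident D K = Zero D K M" using k(3) by simp
  then have "Ident D K = Zero D K K" using k(4)[OF k(1) arr_ident[OF sliceD[OF k(1)]]] by simp
  then have "zero_object D K" using zero_object_iff sliceD[OF k(1)] by simp
  then have "zero_object D T'" using isom_zero[OF isom_sym[OF K(3)]] sh_zero_object by blast
  then show ?thesis using slice_of_zero_top[OF dec(1)] dec(3) by blast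
qed

lemma simpleD:
  assumes "simple_in D (P \<phi>) S"
  shows "S \<in> P \<phi>" "\<not> zero_object D S"
    "mono_in D (P \<phi>) M S m \<Longrightarrow> zero_object D M \<or> iso M S m"
  using assms iso_is_iso[of M S m] monoD(1,2)[of \<phi> M S m] sliceD unfolding simple_in_def by blast+

text \<open>The kernel of \<open>s\<close> is a subobject of \<open>S\<close>, and it is not all of \<open>S\<close> because \<open>s \<noteq> 0\<close>.\<close>

lemma simple_mono:
  assumes S: "simple_in D (P \<phi>) S" and B: "B \<in> P \<phi>" and s: "arr S B s" "s \<noteq> Zero D S B"
  shows "mono_in D (P \<phi>) S B s"
proof -
  obtain C j k where T: "tri S B C s j k" using tri_complete_arr[OF s(1)] by blast
  obtain T' F a b c where dec: "tri T' C F a b c" "T' \<in> P (\<phi> + 1)" "F \<in> P \<phi>"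
    using cone_decomposition[OF T simpleD(1)[OF S] B] by blast
  obtain K i where K: "mono_in D (P \<phi>) K S i" "s \<cdot> i = Zero D K B" "isom T' (sh K)"
    using slice_kernel[OF T simpleD(1)[OF S] B dec] by blast
  have "\<not> iso K S i"
  proof
    assume i: "iso K S i"
    have "s \<cdot> i = Zero D S B \<cdot> i" using K(2) zero_comp[OF iso_arr[OF i] sliceD[OF B]] by simp
    then have "s = Zero D S B"
      by (rule iso_cancel_right[OF i s(1) arr_zero[OF sliceD[OF simpleD(1)[OF S]] sliceD[OF B]]])
    then show False using s(2) by simp
  qed
  then have "zero_object D K" using simpleD(3)[OF S K(1)] by blast
  then have "zero_object D T'" using isom_zero[OF isom_sym[OF K(3)]] sh_zero_object by blast
  then have "C \<in> P \<phi>" using slice_of_zero_top[OF dec(1)] dec(3) by blast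
  then show ?thesis using mono_of_cone[OF T simpleD(1)[OF S] B] by blast
qed

lemma mono_comp:
  assumes "mono_in D (P \<phi>) L M l" "mono_in D (P \<phi>) M E m"
  shows "mono_in D (P \<phi>) L E (m \<cdot> l)"
  unfolding mono_slice_iff
proof (intro conjI ballI allI impI; (elim conjE)?)
  note l = monoD[OF assms(1)] and m = monoD[OF assms(2)]
  show "L \<in> P \<phi>" "E \<in> P \<phi>" "arr L E (m \<cdot> l)" using l m by blast+
  fix W g assume W: "W \<in> P \<phi>" and g: "arr W L g" and "m \<cdot> l \<cdot> g = Zero D W E"
  then have "m \<cdot> (l \<cdot> g) = Zero D W E" using assoc[OF g l(3) m(3)] by simp
  then have "l \<cdot> g = Zero D W M" using m(4)[OF W arr_comp[OF g l(3)]] by simp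
  then show "g = Zero D W L" using l(4)[OF W g] by simp
qed

lemma mono_ident: "E \<in> P \<phi> \<Longrightarrow> mono_in D (P \<phi>) E E (Ident D E)"
  using sliceD[of E \<phi>] by (auto simp: mono_slice_iff)

subsection \<open>Finite length\<close>

text \<open>The triangle on a monomorphism \<open>m\<close> of \<open>P \<phi>\<close> has all its vertices in \<open>P \<phi>\<close>. Since the objects of the interval
  category have phases within \<open>\<eta> < 1/2\<close> of \<open>\<phi>\<close>, there are no nonzero morphisms from their shifts to the cone
  or from \<open>M[1]\<close> to them, so \<open>m\<close> is still a kernel of its cokernel there. This makes local finiteness
  applicable to subobjects in \<open>P \<phi>\<close>.\<close>

lemma strict_of_mono:
  assumes mono: "mono_in D (P \<phi>) M E m" and \<eta>: "0 < \<eta>" "\<eta> < 1 / 2"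
  shows "strict_subobject_in D (slice_interval D P {\<phi> - \<eta><..<\<phi> + \<eta>}) E M m"
proof -
  define Q where "Q = slice_interval D P {\<phi> - \<eta><..<\<phi> + \<eta>}"
  have PQ: "P \<phi> \<subseteq> Q"
  proof
    fix X assume "X \<in> P \<phi>"
    then have "X \<in> (\<Union>\<phi>\<in>{\<phi> - \<eta><..<\<phi> + \<eta>}. P \<phi>)" using \<eta>(1) by force
    then show "X \<in> Q" unfolding Q_def slice_interval_def by (rule extension_closure.base)
  qed
  have Qobj: "W \<in> Obj D" if "W \<in> Q" for W
    using extension_closure_obj[of W] that slice_obj unfolding Q_def slice_interval_def by blast
  have Q1: "orth (sh W) B" if "W \<in> Q" "B \<in> P \<phi>" for W B
  proof (rule extension_closure_orth_shift_left)
    show "W \<in> extension_closure D (\<Union>\<phi>\<in>{\<phi> - \<eta><..<\<phi> + \<eta>}. P \<phi>)"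
      using that(1) by (simp add: Q_def slice_interval_def)
    fix A assume "A \<in> (\<Union>\<phi>\<in>{\<phi> - \<eta><..<\<phi> + \<eta>}. P \<phi>)"
    then obtain \<psi> where "\<phi> - \<eta> < \<psi>" "A \<in> P \<psi>" by auto
    then show "orth (sh A) B" using slice_orth[OF slice_sh[of A \<psi>] that(2)] \<eta> by simp
  qed
  have Q2: "orth (sh B) W" if "W \<in> Q" "B \<in> P \<phi>" for W B
  proof (rule extension_closure_orth_right)
    show "W \<in> extension_closure D (\<Union>\<phi>\<in>{\<phi> - \<eta><..<\<phi> + \<eta>}. P \<phi>)"
      using that(1) by (simp add: Q_def slice_interval_def)
    fix A assume "A \<in> (\<Union>\<phi>\<in>{\<phi> - \<eta><..<\<phi> + \<eta>}. P \<phi>)"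
    then obtain \<psi> where "\<psi> < \<phi> + \<eta>" "A \<in> P \<psi>" by auto
    then show "orth (sh B) A" using slice_orth[OF slice_sh[OF that(2)], of A \<psi>] \<eta> by simp
  qed
  note m = monoD[OF mono]
  obtain C v w where T: "tri M E C m v w" using tri_complete_arr[OF m(3)] by blast
  note t = triD[OF T]
  have C: "C \<in> P \<phi>" using mono_cone[OF mono T] .
  obtain N where N: "zero_object D N" using ex_zero_object by blast
  have No: "N \<in> Obj D" using N by (rule zero_object_obj)
  have MQ: "M \<in> Q" "E \<in> Q" "C \<in> Q" "N \<in> Q" using PQ m C slice_zero[OF N] by blast+
  have inj: "g = h" if W: "W \<in> Q" and gh: "arr W M g" "arr W M h" "m \<cdot> g = m \<cdot> h" for W g h
  proof -
    have "m \<cdot> (g \<ominus>\<^bsub>Hom D W M\<^esub> h) = Zero D W E"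
      using comp_diff[OF m(3) gh(1,2)] gh(3)
        diff_eq_zero_iff[OF arr_comp[OF gh(2) m(3)] arr_comp[OF gh(2) m(3)]] by simp
    then have "g \<ominus>\<^bsub>Hom D W M\<^esub> h = Zero D W M"
      using hom_inj[OF T Q1[OF W C] arr_diff[OF gh(1,2)]] by blast
    then show ?thesis using diff_eq_zero_iff[OF gh(1,2)] by simp
  qed
  have surj: "g = h" if W: "W \<in> Q" and gh: "arr C W g" "arr C W h" "g \<cdot> v = h \<cdot> v" for W g h
  proof -
    have "(g \<ominus>\<^bsub>Hom D C W\<^esub> h) \<cdot> v = Zero D E W"
      using diff_comp[OF t(5) gh(1,2)] gh(3)
        diff_eq_zero_iff[OF arr_comp[OF t(5) gh(2)] arr_comp[OF t(5) gh(2)]] by simp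
    then obtain x where x: "arr (sh M) W x" "g \<ominus>\<^bsub>Hom D C W\<^esub> h = x \<cdot> w"
      using cohom_exact_right[OF T arr_diff[OF gh(1,2)]] by blast
    then have "g \<ominus>\<^bsub>Hom D C W\<^esub> h = Zero D C W"
      using orthD[OF Q2[OF W m(1)] x(1)] zero_comp[OF t(6) Qobj[OF W]] by simp
    then show ?thesis using diff_eq_zero_iff[OF gh(1,2)] by simp
  qed
  \<comment> \<open>The kernel of \<open>m\<close> is zero and its cokernel is the cone, so the coimage is \<open>M\<close> with the identity and
    the image is \<open>M\<close> with \<open>m\<close>.\<close>
  have mono_Q: "mono_in D Q M E m"
    unfolding mono_in_def using MQ m(3) inj Qobj by (simp add: arr_def)
  have ker0: "kernel_in D Q M E m N (Zero D N M)" unfolding kernel_in_def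
  proof (intro conjI ballI impI)
    show "N \<in> Q" "Zero D N M \<in> Mor D N M" using MQ arr_zero[OF No t(1)] by (auto simp: arr_def)
    show "m \<cdot> Zero D N M = Zero D N E" using comp_zero[OF m(3) No] .
    fix W g assume W: "W \<in> Q" and g: "g \<in> Mor D W M" "m \<cdot> g = Zero D W E"
    have ga: "arr W M g" using g Qobj[OF W] t(1) by (simp add: arr_def)
    have "g = Zero D W M" using hom_inj[OF T Q1[OF W C] ga] g(2) by simp
    show "\<exists>!h. h \<in> Mor D W N \<and> Zero D N M \<cdot> h = g"
    proof (rule ex1I[of _ "Zero D W N"])
      show "Zero D W N \<in> Mor D W N \<and> Zero D N M \<cdot> Zero D W N = g"
        using \<open>g = Zero D W M\<close> arr_zero[OF Qobj[OF W] No] zero_zero[OF Qobj[OF W] No t(1)]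
        by (simp add: arr_def)
      fix h assume "h \<in> Mor D W N \<and> Zero D N M \<cdot> h = g"
      then show "h = Zero D W N" using to_zero_object[OF N, of W h] Qobj[OF W] No by (simp add: arr_def)
    qed
  qed
  have coker: "cokernel_in D Q M E m C v" unfolding cokernel_in_def
  proof (intro conjI ballI impI)
    show "C \<in> Q" "v \<in> Mor D E C" using MQ t(5) by (auto simp: arr_def)
    show "v \<cdot> m = Zero D M C" using tri_comp_zero[OF T] .
    fix W g assume W: "W \<in> Q" and g: "g \<in> Mor D E W" "g \<cdot> m = Zero D M W"
    have ga: "arr E W g" using g Qobj[OF W] t(2) by (simp add: arr_def)
    obtain h where h: "arr C W h" "g = h \<cdot> v" using cohom_exact_mid[OF T ga g(2)] by blast
    show "\<exists>!h. h \<in> Mor D C W \<and> h \<cdot> v = g"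
      using h surj[OF W _ h(1)] Qobj[OF W] t(3) by (intro ex1I[of _ h]) (auto simp: arr_def)
  qed
  have coim: "cokernel_in D Q N M (Zero D N M) M (Ident D M)" unfolding cokernel_in_def
  proof (intro conjI ballI impI)
    show "M \<in> Q" "Ident D M \<in> Mor D M M" using MQ ident_mor[OF t(1)] by auto
    show "Ident D M \<cdot> Zero D N M = Zero D N M" using comp_zero[OF arr_ident[OF t(1)] No] .
    fix W g assume W: "W \<in> Q" and g: "g \<in> Mor D M W"
    have ga: "arr M W g" using g Qobj[OF W] t(1) by (simp add: arr_def)
    show "\<exists>!h. h \<in> Mor D M W \<and> h \<cdot> Ident D M = g"
      using ident_right[of M W] ga Qobj[OF W] t(1) by (intro ex1I[of _ g]) (auto simp: arr_def)
  qed
  have im: "kernel_in D Q E C v M m" unfolding kernel_in_def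
  proof (intro conjI ballI impI)
    show "M \<in> Q" "m \<in> Mor D M E" using MQ t(4) by (auto simp: arr_def)
    show "v \<cdot> m = Zero D M C" using tri_comp_zero[OF T] .
    fix W g assume W: "W \<in> Q" and g: "g \<in> Mor D W E" "v \<cdot> g = Zero D W C"
    have ga: "arr W E g" using g Qobj[OF W] t(2) by (simp add: arr_def)
    obtain h where h: "arr W M h" "g = m \<cdot> h" using hom_exact_mid[OF T ga g(2)] by blast
    show "\<exists>!h. h \<in> Mor D W M \<and> m \<cdot> h = g"
      using h inj[OF W _ h(1)] Qobj[OF W] t(1) by (intro ex1I[of _ h]) (auto simp: arr_def)
  qed
  have "is_iso D M M (Ident D M)" using iso_is_iso[OF t(1,1)] t(1) by simp
  moreover have "m = m \<cdot> Ident D M \<cdot> Ident D M" using t(4) by simp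
  moreover have "m \<in> Mor D M E" using t(4) by (simp add: arr_def)
  ultimately have "strict_in D Q M E m"
    unfolding strict_in_def using ker0 coker coim im MQ by blast
  then show ?thesis using mono_Q unfolding strict_subobject_in_def Q_def by blast
qed

lemma slice_chain_conditions:
  assumes "E \<in> P \<phi>" and mono: "\<And>n :: nat. mono_in D (P \<phi>) (M n) E (m n)"
  shows slice_noetherian: "(\<And>n. sub_le D (M n) (m n) (M (Suc n)) (m (Suc n))) \<Longrightarrow>
      \<exists>N. sub_le D (M (Suc N)) (m (Suc N)) (M N) (m N)"
    and slice_artinian: "(\<And>n. sub_le D (M (Suc n)) (m (Suc n)) (M n) (m n)) \<Longrightarrow>
      \<exists>N. sub_le D (M N) (m N) (M (Suc N)) (m (Suc N))"
proof -
  obtain \<eta> where \<eta>: "\<eta> > 0" "\<eta> < 1 / 2"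
    "finite_length_in D (slice_interval D P {\<phi> - \<eta><..<\<phi> + \<eta>})"
    using locally_finite by blast
  have strict: "\<forall>n. strict_subobject_in D (slice_interval D P {\<phi> - \<eta><..<\<phi> + \<eta>}) E (M n) (m n)"
    using strict_of_mono[OF mono \<eta>(1,2)] by blast
  then have E: "E \<in> slice_interval D P {\<phi> - \<eta><..<\<phi> + \<eta>}"
    unfolding strict_subobject_in_def mono_in_def by blast
  show "\<exists>N. sub_le D (M (Suc N)) (m (Suc N)) (M N) (m N)"
    if "\<And>n. sub_le D (M n) (m n) (M (Suc n)) (m (Suc n))"
    using \<eta>(3) E strict that unfolding finite_length_in_def noetherian_in_def by blast
  show "\<exists>N. sub_le D (M N) (m N) (M (Suc N)) (m (Suc N))"
    if "\<And>n. sub_le D (M (Suc n)) (m (Suc n)) (M n) (m n)"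
    using \<eta>(3) E strict that unfolding finite_length_in_def artinian_in_def by blast
qed

lemma sub_le_antisym:
  assumes m: "mono_in D (P \<phi>) M E m" and n: "mono_in D (P \<phi>) N E n"
    and h: "arr M N h" "m = n \<cdot> h" and le: "sub_le D N n M m"
  shows "iso M N h"
proof -
  note m' = monoD[OF m] and n' = monoD[OF n]
  obtain k where k: "arr N M k" "n = m \<cdot> k"
    using le monoD(1)[OF m] monoD(1)[OF n] sliceD unfolding sub_le_def arr_def by blast
  have "m \<cdot> (k \<cdot> h) = m \<cdot> Ident D M" using assoc[OF h(1) k(1) m'(3)] k(2)[symmetric] h(2)[symmetric] m'(3) by simp
  then have "k \<cdot> h = Ident D M"
    using m'(5)[OF arr_comp[OF h(1) k(1)] arr_ident[OF sliceD[OF m'(1)]] m'(1)] by simp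
  moreover have "n \<cdot> (h \<cdot> k) = n \<cdot> Ident D N" using assoc[OF k(1) h(1) n'(3)] k(2)[symmetric] h(2)[symmetric] n'(3) by simp
  then have "h \<cdot> k = Ident D N"
    using n'(5)[OF arr_comp[OF k(1) h(1)] arr_ident[OF sliceD[OF n'(1)]] n'(1)] by simp
  ultimately show ?thesis using h(1) k(1) unfolding iso_def by blast
qed

text \<open>Otherwise there is an infinite sequence of quotients of \<open>E\<close>. By \<open>kernel_of_composite\<close> the kernels of
  \<open>E \<rightarrow> B\<close> form a strictly ascending chain of subobjects of \<open>E\<close>.\<close>

lemma quotient_induct:
  assumes "E \<in> P \<phi>"
    and step: "\<And>B. B \<in> P \<phi> \<Longrightarrow>
      (\<And>A B' u v w. tri A B B' u v w \<Longrightarrow> A \<in> P \<phi> \<Longrightarrow> B' \<in> P \<phi> \<Longrightarrow> \<not> zero_object D A \<Longrightarrow> Q B') \<Longrightarrow> Q B"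
  shows "Q E"
proof (rule ccontr)
  assume nE: "\<not> Q E"
  \<comment> \<open>A state \<open>(A, m, B, q)\<close> is a quotient \<open>q : E \<rightarrow> B\<close> violating the claim, with its kernel \<open>m : A \<rightarrow> E\<close>.\<close>
  define good where "good = (\<lambda>x. case x of (A, m, B, q) \<Rightarrow> A \<in> P \<phi> \<and> B \<in> P \<phi> \<and> \<not> Q B \<and> (\<exists>r. tri A E B m q r))"
  define step_rel where "step_rel = (\<lambda>(x :: 'o \<times> 'm \<times> 'o \<times> 'm) (y :: 'o \<times> 'm \<times> 'o \<times> 'm). case x of (A, m, B, q) \<Rightarrow> case y of (A', m', B', q') \<Rightarrow>
     \<exists>h. arr A A' h \<and> m = m' \<cdot> h \<and> \<not> iso A A' h)"
  obtain N where N: "zero_object D N" using ex_zero_object by blast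
  have base: "good (N, Zero D N E, E, Ident D E)"
    using tri_from_zero[OF sliceD[OF assms(1)] N] slice_zero[OF N] assms(1) nE unfolding good_def by auto
  have next_exists: "\<exists>y. good y \<and> step_rel x y" if "good x" for x
  proof -
    obtain A m B q where x: "x = (A, m, B, q)" by (cases x)
    obtain r where T1: "tri A E B m q r" and AB: "A \<in> P \<phi>" "B \<in> P \<phi>" "\<not> Q B"
      using \<open>good x\<close> unfolding good_def x by auto
    obtain K B' s p w where T2: "tri K B B' s p w" "K \<in> P \<phi>" "B' \<in> P \<phi>" "\<not> zero_object D K" "\<not> Q B'"
      using step[OF AB(2)] AB(3) by blast
    obtain A' m' h c a b where T3: "tri A' E B' m' (p \<cdot> q) c" "tri A A' K h a b" "m = m' \<cdot> h"
      using kernel_of_composite[OF T1 T2(1)] by blast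
    have A': "A' \<in> P \<phi>" using slice_extension[OF T3(2) AB(1) T2(2)] .
    have "\<not> iso A A' h"
    proof
      assume "iso A A' h"
      then obtain g where g: "arr A' A g" "h \<cdot> g = Ident D A'" by (auto elim: isoE)
      note t3 = triD[OF T3(2)]
      have "a = a \<cdot> (h \<cdot> g)" using g t3 by simp
      also have "\<dots> = Zero D A' K"
        using assoc[OF g(1) t3(4,5)] tri_comp_zero[OF T3(2)] zero_comp[OF g(1) t3(3)] by simp
      finally have az: "a = Zero D A' K" .
      then have "Ident D K \<cdot> a = Zero D A' K" using t3 by simp
      then obtain k where k: "arr (sh A) K k" "Ident D K = k \<cdot> b"
        using cohom_exact_right[OF T3(2) arr_ident[OF t3(3)]] by blast
      have "orth (sh A) K" using slice_orth[OF slice_sh[OF AB(1)] T2(2)] by simp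
      then have "Ident D K = Zero D K K" using orthD[OF _ k(1)] k(2) zero_comp[OF t3(6,3)] by simp
      then show False using T2(4) t3(3) zero_object_iff by blast
    qed
    then have "good (A', m', B', p \<cdot> q) \<and> step_rel x (A', m', B', p \<cdot> q)"
      using A' T2 T3 triD(4)[OF T3(2)] unfolding good_def step_rel_def x by auto
    then show ?thesis by blast
  qed
  have "\<exists>F. \<forall>n :: nat. good (F n) \<and> step_rel (F n) (F (Suc n))"
    using dependent_nat_choice[of "\<lambda>n x. good x" "\<lambda>n. step_rel"] base next_exists by blast
  then obtain F where F: "\<And>n :: nat. good (F n)" "\<And>n. step_rel (F n) (F (Suc n))" by blast
  define M where "M n = fst (F n)" for n
  define m where "m n = fst (snd (F n))" for n
  have mono: "mono_in D (P \<phi>) (M n) E (m n)" for n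
  proof -
    obtain r where "tri (M n) E (fst (snd (snd (F n)))) (m n) (snd (snd (snd (F n)))) r"
      "M n \<in> P \<phi>" "fst (snd (snd (F n))) \<in> P \<phi>"
      using F(1)[of n] unfolding good_def M_def m_def by (auto split: prod.splits)
    then show ?thesis using mono_of_cone assms(1) by blast
  qed
  have step_rel: "\<exists>h. arr (M n) (M (Suc n)) h \<and> m n = m (Suc n) \<cdot> h \<and> \<not> iso (M n) (M (Suc n)) h" for n
    using F(2)[of n] unfolding step_rel_def M_def m_def by (auto split: prod.splits)
  have "\<exists>n. sub_le D (M (Suc n)) (m (Suc n)) (M n) (m n)"
    by (rule slice_noetherian[OF assms(1) mono]) (use step_rel in \<open>auto simp: sub_le_def arr_def\<close>)
  then obtain n where n: "sub_le D (M (Suc n)) (m (Suc n)) (M n) (m n)" by blast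
  obtain h where "arr (M n) (M (Suc n)) h" "m n = m (Suc n) \<cdot> h" "\<not> iso (M n) (M (Suc n)) h"
    using step_rel by blast
  then show False using sub_le_antisym[OF mono mono _ _ n] by blast
qed

text \<open>Otherwise every nonzero subobject has a smaller nonzero one, which gives a strictly descending chain.\<close>

lemma simple_subobject_exists:
  assumes "E \<in> P \<phi>" "\<not> zero_object D E"
  shows "\<exists>S m. simple_in D (P \<phi>) S \<and> mono_in D (P \<phi>) S E m"
proof (rule ccontr)
  assume no: "\<not> ?thesis"
  define good where "good = (\<lambda>x. case x of (M, m) \<Rightarrow> mono_in D (P \<phi>) M E m \<and> \<not> zero_object D M)"
  define step_rel where "step_rel = (\<lambda>x y. case x of (M, m) \<Rightarrow> case y of (M', m') \<Rightarrow>
     \<exists>h. arr M' M h \<and> m' = m \<cdot> h \<and> \<not> iso M' M h)"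
  have base: "good (E, Ident D E)" using mono_ident[OF assms(1)] assms(2) by (simp add: good_def)
  have next_exists: "\<exists>y. good y \<and> step_rel x y" if "good x" for x
  proof -
    obtain M m where x: "x = (M, m)" by (cases x)
    have M: "mono_in D (P \<phi>) M E m" "\<not> zero_object D M" using \<open>good x\<close> by (auto simp: good_def x)
    then have "\<not> simple_in D (P \<phi>) M" using no by blast
    then obtain K k where K: "mono_in D (P \<phi>) K M k" "\<not> zero_object D K" "\<not> is_iso D K M k"
      using monoD(1)[OF M(1)] M(2) unfolding simple_in_def by blast
    then have "\<not> iso K M k" using iso_is_iso[OF sliceD sliceD] monoD(1,2)[OF K(1)] by blast
    then have "good (K, m \<cdot> k) \<and> step_rel x (K, m \<cdot> k)"
      using mono_comp[OF K(1) M(1)] K(2) monoD(3)[OF K(1)] by (auto simp: good_def step_rel_def x)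
    then show ?thesis by blast
  qed
  have "\<exists>F. \<forall>n :: nat. good (F n) \<and> step_rel (F n) (F (Suc n))"
    using dependent_nat_choice[of "\<lambda>n x. good x" "\<lambda>n. step_rel"] base next_exists by blast
  then obtain F where F: "\<And>n :: nat. good (F n)" "\<And>n. step_rel (F n) (F (Suc n))" by blast
  define M where "M n = fst (F n)" for n
  define m where "m n = snd (F n)" for n
  have mono: "mono_in D (P \<phi>) (M n) E (m n)" for n
    using F(1)[of n] unfolding good_def M_def m_def by (auto split: prod.splits)
  have step_rel: "\<exists>h. arr (M (Suc n)) (M n) h \<and> m (Suc n) = m n \<cdot> h \<and> \<not> iso (M (Suc n)) (M n) h" for n
    using F(2)[of n] unfolding step_rel_def M_def m_def by (auto split: prod.splits)
  have "\<exists>n. sub_le D (M n) (m n) (M (Suc n)) (m (Suc n))"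
    by (rule slice_artinian[OF assms(1) mono]) (use step_rel in \<open>auto simp: sub_le_def arr_def\<close>)
  then obtain n where n: "sub_le D (M n) (m n) (M (Suc n)) (m (Suc n))" by blast
  obtain h where "arr (M (Suc n)) (M n) h" "m (Suc n) = m n \<cdot> h" "\<not> iso (M (Suc n)) (M n) h"
    using step_rel by blast
  then show False using sub_le_antisym[OF mono mono _ _ n] by blast
qed

subsection \<open>Isotypic objects\<close>

text \<open>Iterated self-extensions of \<open>S\<close>. The zero objects are admitted so that the largest isotypic subobject exists
  in every case.\<close>

definition isotypic :: "'o \<Rightarrow> 'o set" where
  "isotypic S = extension_closure D (insert S {N. zero_object D N})"

lemma isotypic_self: "S \<in> isotypic S"
  unfolding isotypic_def by (rule extension_closure.base) simp

lemma isotypic_zero: "zero_object D N \<Longrightarrow> N \<in> isotypic S"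
  unfolding isotypic_def by (rule extension_closure.base) simp

lemma isotypic_ext: "X \<in> isotypic S \<Longrightarrow> C \<in> isotypic S \<Longrightarrow> tri X Y C u v w \<Longrightarrow> Y \<in> isotypic S"
  unfolding isotypic_def tri_def by (rule extension_closure.ext)

lemma isotypic_induct [consumes 1, case_names self zero ext]:
  assumes "X \<in> isotypic S" "Q S" "\<And>N. zero_object D N \<Longrightarrow> Q N"
    and "\<And>X Y C u v w. X \<in> isotypic S \<Longrightarrow> C \<in> isotypic S \<Longrightarrow> tri X Y C u v w \<Longrightarrow> Q X \<Longrightarrow> Q C \<Longrightarrow> Q Y"
  shows "Q X"
  using assms(1) unfolding isotypic_def
proof (induction rule: extension_closure.induct)
  case (base X)
  then show ?case using assms(2,3) by blast
next
  case (ext X C Y u v w)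
  then show ?case using assms(4)[of X C Y u v w] by (simp add: tri_def isotypic_def)
qed

lemma isotypic_slice: "X \<in> isotypic S \<Longrightarrow> S \<in> P \<phi> \<Longrightarrow> X \<in> P \<phi>"
  by (induction rule: isotypic_induct) (auto intro: slice_zero slice_extension)

lemma isotypic_orth_left:
  assumes "X \<in> isotypic S" "orth S Y"
  shows "orth X Y"
  using assms(1)
proof (induction rule: isotypic_induct)
  case (zero N)
  have "Y \<in> Obj D" using assms(2) by (simp add: orth_def)
  then show ?case using zero_orth(1)[OF zero] by blast
next
  case (ext X Y C u v w)
  then show ?case using orth_mid_left by blast
qed (rule assms(2))

text \<open>If there is a nonzero morphism \<open>S \<rightarrow> B\<close>, it is a monomorphism. The largest isotypic subobject of \<open>B/S\<close>, which exists
  by induction, has the required subobject of \<open>B\<close> as its preimage.\<close>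

lemma maximal_isotypic_subobject:
  assumes S: "simple_in D (P \<phi>) S" and "B \<in> P \<phi>"
  shows "\<exists>A B' u v w. tri A B B' u v w \<and> A \<in> isotypic S \<and> B' \<in> P \<phi> \<and> orth S B'"
  using assms(2)
proof (rule quotient_induct)
  fix B assume B: "B \<in> P \<phi>"
    and IH: "\<And>A B' u v w. tri A B B' u v w \<Longrightarrow> A \<in> P \<phi> \<Longrightarrow> B' \<in> P \<phi> \<Longrightarrow> \<not> zero_object D A \<Longrightarrow>
      \<exists>A B'' u v w. tri A B' B'' u v w \<and> A \<in> isotypic S \<and> B'' \<in> P \<phi> \<and> orth S B''"
  show "\<exists>A B' u v w. tri A B B' u v w \<and> A \<in> isotypic S \<and> B' \<in> P \<phi> \<and> orth S B'"
  proof (cases "orth S B")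
    case True
    obtain N where N: "zero_object D N" using ex_zero_object by blast
    then show ?thesis using tri_from_zero[OF sliceD[OF B] N] isotypic_zero B True by blast
  next
    case False
    then obtain s where s: "arr S B s" "s \<noteq> Zero D S B"
      using sliceD[OF B] sliceD[OF simpleD(1)[OF S]] unfolding orth_def by blast
    obtain B1 p x where T1: "tri S B B1 s p x" using tri_complete_arr[OF s(1)] by blast
    have B1: "B1 \<in> P \<phi>" using mono_cone[OF simple_mono[OF S B s] T1] .
    obtain A1 B' u v w where T2: "tri A1 B1 B' u v w" "A1 \<in> isotypic S" "B' \<in> P \<phi>" "orth S B'"
      using IH[OF T1 simpleD(1)[OF S] B1 simpleD(2)[OF S]] by blast
    obtain A' m' h c a b where "tri A' B B' m' (v \<cdot> p) c" "tri S A' A1 h a b"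
      using kernel_of_composite[OF T1 T2(1)] by blast
    then show ?thesis using isotypic_ext[OF isotypic_self T2(2)] T2(3,4) by blast
  qed
qed

end

section \<open>Generic elements of spaces of morphisms\<close>

context triangulated_category
begin

abbreviation msum :: "'o \<Rightarrow> 'o \<Rightarrow> nat \<Rightarrow> (nat \<Rightarrow> complex) \<Rightarrow> (nat \<Rightarrow> 'm) \<Rightarrow> 'm" where
  "msum X Y \<equiv> complex_space.lsum (Hom D X Y)"

lemma arr_msum:
  assumes "X \<in> Obj D" "Y \<in> Obj D" "\<And>i. i < n \<Longrightarrow> arr X Y (b i)"
  shows "arr X Y (msum X Y n c b)"
proof -
  interpret complex_space "Hom D X Y" by (rule hom_space[OF assms(1,2)])
  have "lsum n c b \<in> Mor D X Y" by (rule lsum_closed) (use assms(3) in \<open>auto simp: arr_def\<close>)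
  then show ?thesis using assms(1,2) by (simp add: arr_def)
qed

lemma msum_comp:
  assumes "arr X Y f" "C \<in> Obj D" "\<And>i. i < n \<Longrightarrow> arr Y C (b i)"
  shows "msum Y C n c b \<cdot> f = msum X C n c (\<lambda>i. b i \<cdot> f)"
  using linear_map_lsum[OF hom_space hom_space comp_left_hom[OF assms(1,2)], of n b c] assms
  by (auto simp: arr_def)

lemma comp_msum:
  assumes "arr Y C g" "X \<in> Obj D" "\<And>i. i < n \<Longrightarrow> arr X Y (b i)"
  shows "g \<cdot> msum X Y n c b = msum X C n c (\<lambda>i. g \<cdot> b i)"
  using linear_map_lsum[OF hom_space hom_space comp_right_hom[OF assms(1,2)], of n b c] assms
  by (auto simp: arr_def)

text \<open>Left and right inverses exist wherever the equations \<open>a(t) x = id\<close> and \<open>x a(t) = id\<close> can be solved.\<close>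

lemma cofinite_iso:
  assumes X: "X \<in> Obj D" and g: "\<And>j. j < k \<Longrightarrow> arr X X (g j)"
    and id: "msum X X k (\<lambda>j. poly (q j) 0) g = Ident D X"
  shows "finite {t. \<not> iso X X (msum X X k (\<lambda>j. poly (q j) t) g)}"
proof -
  let ?V = "Hom D X X" and ?a = "\<lambda>t. msum X X k (\<lambda>j. poly (q j) t) g"
  have V: "complex_space ?V" "vectorspace.fin_dim class_ring ?V" using hom_space hom_fin_dim X by auto
  interpret V: complex_space ?V by (rule V(1))
  have I: "Ident D X \<in> carrier ?V" using ident_mor X .
  have a: "arr X X (?a t)" for t using arr_msum[OF X X g] .
  let ?r = "\<lambda>t x. V.lsum k (\<lambda>j. poly (q j) t) (\<lambda>j. g j \<cdot> x)"
    and ?l = "\<lambda>t x. V.lsum k (\<lambda>j. poly (q j) t) (\<lambda>j. x \<cdot> g j)"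
  have rl: "?r t x = ?a t \<cdot> x" "?l t x = x \<cdot> ?a t" if "arr X X x" for t x
    using msum_comp[OF that X g] comp_msum[OF that X g] by simp_all
  have r: "finite {t. \<not> (\<exists>x\<in>carrier ?V. ?r t x = Ident D X)}"
    by (rule cofinitely_many_solvable[OF V comp_right_hom[OF g X] _ I])
       (use rl(1)[of _ 0] id X in \<open>auto simp: arr_def\<close>)
  have l: "finite {t. \<not> (\<exists>x\<in>carrier ?V. ?l t x = Ident D X)}"
    by (rule cofinitely_many_solvable[OF V comp_left_hom[OF g X] _ I])
       (use rl(2)[of _ 0] id X in \<open>auto simp: arr_def\<close>)
  have "iso X X (?a t)" if t: "\<exists>x\<in>carrier ?V. ?r t x = Ident D X" "\<exists>x\<in>carrier ?V. ?l t x = Ident D X" for t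
  proof -
    obtain x x' where "arr X X x" "arr X X x'" "?r t x = Ident D X" "?l t x' = Ident D X"
      using t X unfolding arr_def by blast
    then show ?thesis using left_right_inverse_iso[OF a, of x' x t] rl by simp
  qed
  then have "{t. \<not> iso X X (?a t)} \<subseteq> {t. \<not> (\<exists>x\<in>carrier ?V. ?r t x = Ident D X)}
      \<union> {t. \<not> (\<exists>x\<in>carrier ?V. ?l t x = Ident D X)}" by blast
  then show ?thesis by (rule finite_subset) (rule finite_UnI[OF r l])
qed

text \<open>The tangent space at \<open>e\<close> of the orbit of \<open>e\<close> under \<open>Aut Y \<times> Aut X\<close> is all of \<open>Hom(X, Y)\<close>.\<close>

definition open_orbit :: "'o \<Rightarrow> 'o \<Rightarrow> 'm \<Rightarrow> bool" where
  "open_orbit X Y e \<longleftrightarrow> arr X Y e \<and>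
     (\<forall>v. arr X Y v \<longrightarrow> (\<exists>a b. arr Y Y a \<and> arr X X b \<and> v = a \<cdot> e \<oplus>\<^bsub>Hom D X Y\<^esub> e \<cdot> b))"

text \<open>The equation \<open>a e = (e + t d) b\<close> is linear in \<open>(a, b)\<close>, so the solution \<open>(id, id)\<close> at \<open>t = 0\<close> extends to a
  solution polynomial in \<open>t\<close>. Its components are invertible for all but finitely many \<open>t\<close>.\<close>

lemma line_in_orbit:
  assumes e: "open_orbit X Y e" and d: "arr X Y d"
  shows "finite {t. \<not> (\<exists>a b. iso Y Y a \<and> iso X X b \<and>
      a \<cdot> e = (e \<oplus>\<^bsub>Hom D X Y\<^esub> t \<odot>\<^bsub>Hom D X Y\<^esub> d) \<cdot> b)}"
proof -
  have X: "X \<in> Obj D" and Y: "Y \<in> Obj D" and ea: "arr X Y e" using d e by (auto simp: arr_def open_orbit_def)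
  let ?V = "Hom D X Y" and ?A = "Hom D Y Y" and ?B = "Hom D X X"
  have V: "complex_space ?V" "vectorspace.fin_dim class_ring ?V" using hom_space hom_fin_dim X Y by auto
  interpret V: complex_space ?V by (rule V(1))
  interpret A: complex_space ?A by (rule hom_space[OF Y Y])
  interpret B: complex_space ?B by (rule hom_space[OF X X])
  obtain n v c where vc: "V.coords n v c" using V.coords_exist[OF V(2)] by blast
  have vV: "\<And>i. i < n \<Longrightarrow> arr X Y (v i)" using vc X Y by (auto simp: V.coords_def arr_def)
  have cV: "\<And>i. i < n \<Longrightarrow> c i \<in> module_hom class_ring ?V ground_module" using vc by (auto simp: V.coords_def)
  have "\<forall>i. \<exists>a b. i < n \<longrightarrow> arr Y Y a \<and> arr X X b \<and> v i = a \<cdot> e \<oplus>\<^bsub>?V\<^esub> e \<cdot> b"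
    using e vV unfolding open_orbit_def by blast
  then obtain a' b' where ab': "\<And>i. i < n \<Longrightarrow> arr Y Y (a' i)" "\<And>i. i < n \<Longrightarrow> arr X X (b' i)"
    "\<And>i. i < n \<Longrightarrow> v i = a' i \<cdot> e \<oplus>\<^bsub>?V\<^esub> e \<cdot> b' i" by metis
  \<comment> \<open>A linear right inverse \<open>y \<mapsto> (\<alpha> y, \<beta> y)\<close> of the tangent map \<open>(a, b) \<mapsto> a e + e b\<close>.\<close>
  define \<alpha> where "\<alpha> y = msum Y Y n (\<lambda>i. c i y) a'" for y
  define \<beta> where "\<beta> y = msum X X n (\<lambda>i. c i y) b'" for y
  have "(\<lambda>y. A.lsum n (\<lambda>i. c i y) a') \<in> module_hom class_ring ?V ?A"
    by (rule coordinate_combination_linear[OF V(1) A.complex_space_axioms cV])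
       (use ab'(1) in \<open>auto dest: arrD(3)\<close>)
  then have \<alpha>: "\<alpha> \<in> module_hom class_ring ?V ?A" by (simp add: \<alpha>_def[abs_def])
  have "(\<lambda>y. B.lsum n (\<lambda>i. c i y) b') \<in> module_hom class_ring ?V ?B"
    by (rule coordinate_combination_linear[OF V(1) B.complex_space_axioms cV])
       (use ab'(2) in \<open>auto dest: arrD(3)\<close>)
  then have \<beta>: "\<beta> \<in> module_hom class_ring ?V ?B" by (simp add: \<beta>_def[abs_def])
  have \<alpha>a: "arr Y Y (\<alpha> y)" and \<beta>a: "arr X X (\<beta> y)" if "arr X Y y" for y
    using linear_mapD(1)[OF \<alpha>] linear_mapD(1)[OF \<beta>] that by (auto simp: arr_def)
  have split: "\<alpha> y \<cdot> e \<oplus>\<^bsub>?V\<^esub> e \<cdot> \<beta> y = y" if y: "arr X Y y" for y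
  proof -
    have s1: "\<alpha> y \<cdot> e = V.lsum n (\<lambda>i. c i y) (\<lambda>i. a' i \<cdot> e)"
      unfolding \<alpha>_def by (rule msum_comp[OF ea Y ab'(1)])
    have s2: "e \<cdot> \<beta> y = V.lsum n (\<lambda>i. c i y) (\<lambda>i. e \<cdot> b' i)"
      unfolding \<beta>_def by (rule comp_msum[OF ea X ab'(2)])
    have "\<alpha> y \<cdot> e \<oplus>\<^bsub>?V\<^esub> e \<cdot> \<beta> y = V.lsum n (\<lambda>i. c i y) (\<lambda>i. a' i \<cdot> e \<oplus>\<^bsub>?V\<^esub> e \<cdot> b' i)"
      unfolding s1 s2
      by (rule V.lsum_add_vectors[symmetric])
         (use arrD(3)[OF arr_comp[OF ea ab'(1)]] arrD(3)[OF arr_comp[OF ab'(2) ea]] in blast)+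
    also have "\<dots> = V.lsum n (\<lambda>i. c i y) v" by (rule V.lsum_cong) (simp_all add: ab'(3)[symmetric])
    also have "\<dots> = y" using vc y by (simp add: V.coords_def arr_def)
    finally show ?thesis .
  qed
  \<comment> \<open>With \<open>a = id + \<alpha> y\<close> and \<open>b = id - \<beta> y\<close> the equation \<open>a e = (e + t d) b\<close> becomes \<open>y + t d (\<beta> y) = t d\<close>.\<close>
  define T where "T j = (if j = 0 then (\<lambda>y. y) else (\<lambda>y. d \<cdot> \<beta> y))" for j :: nat
  define q where "q j = (if j = 0 then 1 else [:0, 1:] :: complex poly)" for j :: nat
  have Th: "T j \<in> module_hom class_ring ?V ?V" for j
  proof (cases "j = 0")
    case True
    then have "T j = (\<lambda>y. y)" by (simp add: T_def)
    then show ?thesis by (simp only:) (rule linear_map_ident)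
  next
    case False
    then have "T j = (\<lambda>y. d \<cdot> \<beta> y)" by (simp add: T_def)
    then show ?thesis using linear_map_comp[OF \<beta> comp_right_hom[OF d X]] by simp
  qed
  have Ts: "V.lsum 2 (\<lambda>j. poly (q j) t) (\<lambda>j. T j y) = y \<oplus>\<^bsub>?V\<^esub> t \<odot>\<^bsub>?V\<^esub> (d \<cdot> \<beta> y)" if "arr X Y y" for t y
    using that linear_mapD(1)[OF Th, of y 1] by (simp add: numeral_2_eq_2 T_def q_def arr_def)
  have Ti: "V.lsum 2 (\<lambda>j. poly (q j) 0) (\<lambda>j. T j y) = y" if "y \<in> carrier ?V" for y
    using Ts[of y 0] that X Y arr_comp[OF \<beta>a[of y] d] by (simp add: arr_def)
  obtain p m s b where pm: "poly p 0 = 1" "\<forall>i<m. b i \<in> carrier ?V"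
    "\<forall>t. V.lsum 2 (\<lambda>j. poly (q j) t) (\<lambda>j. T j (V.lsum m (\<lambda>i. poly (s i) t) b)) = poly p t \<odot>\<^bsub>?V\<^esub> d"
    using polynomial_cramer[OF V, of 2 T q d] Th Ti arrD(3)[OF d] by blast
  define y where "y t = V.lsum m (\<lambda>i. poly (s i) t) b" for t
  have bV: "\<And>i. i < m \<Longrightarrow> arr X Y (b i)" using pm(2) X Y by (simp add: arr_def)
  have ya: "arr X Y (y t)" for t unfolding y_def by (rule arr_msum[OF X Y bV])
  have yeq: "y t \<oplus>\<^bsub>?V\<^esub> t \<odot>\<^bsub>?V\<^esub> (d \<cdot> \<beta> (y t)) = poly p t \<odot>\<^bsub>?V\<^esub> d" for t
    using Ts[OF ya, of t t] pm(3) unfolding y_def by simp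
  \<comment> \<open>Multiplying by the determinant \<open>p\<close> gives the polynomial solution \<open>a(t) = p(t) id + t \<alpha> (y t)\<close> and
    \<open>b(t) = p(t) id - t \<beta> (y t)\<close>, written as a sum with the identity as last term.\<close>
  define ga where "ga j = (if j < m then \<alpha> (b j) else Ident D Y)" for j
  define gb where "gb j = (if j < m then \<beta> (b j) else Ident D X)" for j
  define qa where "qa j = (if j < m then [:0, 1:] * s j else p)" for j
  define qb where "qb j = (if j < m then - ([:0, 1:] * s j) else p)" for j
  define a where "a t = msum Y Y (Suc m) (\<lambda>j. poly (qa j) t) ga" for t
  define bb where "bb t = msum X X (Suc m) (\<lambda>j. poly (qb j) t) gb" for t
  have a_eq: "a t = t \<odot>\<^bsub>?A\<^esub> \<alpha> (y t) \<oplus>\<^bsub>?A\<^esub> poly p t \<odot>\<^bsub>?A\<^esub> Ident D Y" for t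
  proof -
    have "A.lsum m (\<lambda>j. poly (qa j) t) ga = A.lsum m (\<lambda>j. t * poly (s j) t) (\<lambda>j. \<alpha> (b j))"
      by (rule A.lsum_cong) (auto simp: ga_def qa_def)
    also have "\<dots> = t \<odot>\<^bsub>?A\<^esub> A.lsum m (\<lambda>j. poly (s j) t) (\<lambda>j. \<alpha> (b j))"
      by (rule A.lsum_smult) (use \<alpha>a bV in \<open>auto simp: arr_def\<close>)
    also have "A.lsum m (\<lambda>j. poly (s j) t) (\<lambda>j. \<alpha> (b j)) = \<alpha> (y t)"
      unfolding y_def using linear_map_lsum[OF V(1) A.complex_space_axioms \<alpha>, of m b] pm(2) by simp
    finally have sum: "A.lsum m (\<lambda>j. poly (qa j) t) ga = t \<odot>\<^bsub>?A\<^esub> \<alpha> (y t)" .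
    have last: "ga m = Ident D Y" "qa m = p" by (simp_all add: ga_def qa_def)
    show ?thesis unfolding a_def A.lsum.simps sum last ..
  qed
  have b_eq: "bb t = (- t) \<odot>\<^bsub>?B\<^esub> \<beta> (y t) \<oplus>\<^bsub>?B\<^esub> poly p t \<odot>\<^bsub>?B\<^esub> Ident D X" for t
  proof -
    have "B.lsum m (\<lambda>j. poly (qb j) t) gb = B.lsum m (\<lambda>j. (- t) * poly (s j) t) (\<lambda>j. \<beta> (b j))"
      by (rule B.lsum_cong) (auto simp: gb_def qb_def)
    also have "\<dots> = (- t) \<odot>\<^bsub>?B\<^esub> B.lsum m (\<lambda>j. poly (s j) t) (\<lambda>j. \<beta> (b j))"
      by (rule B.lsum_smult) (use \<beta>a bV in \<open>auto simp: arr_def\<close>)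
    also have "B.lsum m (\<lambda>j. poly (s j) t) (\<lambda>j. \<beta> (b j)) = \<beta> (y t)"
      unfolding y_def using linear_map_lsum[OF V(1) B.complex_space_axioms \<beta>, of m b] pm(2) by simp
    finally have sum: "B.lsum m (\<lambda>j. poly (qb j) t) gb = (- t) \<odot>\<^bsub>?B\<^esub> \<beta> (y t)" .
    have last: "gb m = Ident D X" "qb m = p" by (simp_all add: gb_def qb_def)
    show ?thesis unfolding bb_def B.lsum.simps sum last ..
  qed
  have IY: "arr Y Y (Ident D Y)" and IX: "arr X X (Ident D X)" using X Y by auto
  have eqn: "a t \<cdot> e = (e \<oplus>\<^bsub>?V\<^esub> t \<odot>\<^bsub>?V\<^esub> d) \<cdot> bb t" for t
  proof -
    let ?\<alpha>e = "\<alpha> (y t) \<cdot> e" and ?e\<beta> = "e \<cdot> \<beta> (y t)" and ?d\<beta> = "d \<cdot> \<beta> (y t)"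
    note ar = \<alpha>a[OF ya, of t] \<beta>a[OF ya, of t]
    have car: "?\<alpha>e \<in> carrier ?V" "?e\<beta> \<in> carrier ?V" "?d\<beta> \<in> carrier ?V" "e \<in> carrier ?V" "d \<in> carrier ?V"
      using arr_comp[OF ea ar(1)] arr_comp[OF ar(2) ea] arr_comp[OF ar(2) d] ea d by (auto simp: arr_def)
    have L: "a t \<cdot> e = t \<odot>\<^bsub>?V\<^esub> ?\<alpha>e \<oplus>\<^bsub>?V\<^esub> poly p t \<odot>\<^bsub>?V\<^esub> e"
      unfolding a_eq using comp_add_left[OF ea arr_smult[OF ar(1)] arr_smult[OF IY]]
        comp_smult_left[OF ea ar(1)] comp_smult_left[OF ea IY] ident_left[OF ea] by simp
    have eb: "e \<cdot> bb t = (- t) \<odot>\<^bsub>?V\<^esub> ?e\<beta> \<oplus>\<^bsub>?V\<^esub> poly p t \<odot>\<^bsub>?V\<^esub> e"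
      unfolding b_eq using comp_add_right[OF ea arr_smult[OF ar(2)] arr_smult[OF IX]]
        comp_smult_right[OF ar(2) ea] comp_smult_right[OF IX ea] ident_right[OF ea] by simp
    have db: "d \<cdot> bb t = (- t) \<odot>\<^bsub>?V\<^esub> ?d\<beta> \<oplus>\<^bsub>?V\<^esub> poly p t \<odot>\<^bsub>?V\<^esub> d"
      unfolding b_eq using comp_add_right[OF d arr_smult[OF ar(2)] arr_smult[OF IX]]
        comp_smult_right[OF ar(2) d] comp_smult_right[OF IX d] ident_right[OF d] by simp
    have bba: "arr X X (bb t)" unfolding b_eq using arr_add[OF arr_smult[OF ar(2)] arr_smult[OF IX]] .
    have R: "(e \<oplus>\<^bsub>?V\<^esub> t \<odot>\<^bsub>?V\<^esub> d) \<cdot> bb t = e \<cdot> bb t \<oplus>\<^bsub>?V\<^esub> t \<odot>\<^bsub>?V\<^esub> (d \<cdot> bb t)"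
      using comp_add_left[OF bba ea arr_smult[OF d]] comp_smult_left[OF bba d] by simp
    have s: "?\<alpha>e \<oplus>\<^bsub>?V\<^esub> ?e\<beta> = y t" using split[OF ya] .
    show ?thesis
    proof (rule V.coords_eqI[OF vc])
      fix i assume i: "i < n"
      note f = V.functionalD[OF cV[OF i]]
      have "c i ?\<alpha>e + c i ?e\<beta> = c i (y t)" using f(1)[OF car(1,2)] s by simp
      then have 1: "c i ?\<alpha>e = c i (y t) - c i ?e\<beta>" by (simp add: eq_diff_eq)
      have "c i (y t) + t * c i ?d\<beta> = poly p t * c i d"
        using f(1)[of "y t" "t \<odot>\<^bsub>?V\<^esub> ?d\<beta>"] f(2) yeq[of t] car arrD(3)[OF ya[of t]] by simp
      then have 2: "c i (y t) = poly p t * c i d - t * c i ?d\<beta>" by (simp add: eq_diff_eq)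
      have e1: "c i (a t \<cdot> e) = t * c i ?\<alpha>e + poly p t * c i e" unfolding L using car f by simp
      have e2: "c i ((e \<oplus>\<^bsub>?V\<^esub> t \<odot>\<^bsub>?V\<^esub> d) \<cdot> bb t)
          = - t * c i ?e\<beta> + poly p t * c i e + t * (- t * c i ?d\<beta> + poly p t * c i d)"
        unfolding R eb db using car f by simp
      show "c i (a t \<cdot> e) = c i ((e \<oplus>\<^bsub>?V\<^esub> t \<odot>\<^bsub>?V\<^esub> d) \<cdot> bb t)"
        unfolding e1 e2 1 2 by (simp add: algebra_simps)
    qed (simp_all add: L R eb db car)
  qed
  have "finite {t. \<not> iso Y Y (a t)}" unfolding a_def
  proof (rule cofinite_iso[OF Y])
    show "arr Y Y (ga j)" if "j < Suc m" for j using \<alpha>a bV IY by (simp add: ga_def)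
    show "msum Y Y (Suc m) (\<lambda>j. poly (qa j) 0) ga = Ident D Y"
    proof -
      have "a 0 = Ident D Y" using a_eq[of 0] \<alpha>a[OF ya, of 0] IY pm(1) by (simp add: arr_def)
      then show ?thesis by (simp only: a_def)
    qed
  qed
  moreover have "finite {t. \<not> iso X X (bb t)}" unfolding bb_def
  proof (rule cofinite_iso[OF X])
    show "arr X X (gb j)" if "j < Suc m" for j using \<beta>a bV IX by (simp add: gb_def)
    show "msum X X (Suc m) (\<lambda>j. poly (qb j) 0) gb = Ident D X"
    proof -
      have "bb 0 = Ident D X" using b_eq[of 0] \<beta>a[OF ya, of 0] IX pm(1) by (simp add: arr_def)
      then show ?thesis by (simp only: bb_def)
    qed
  qed
  ultimately have "finite ({t. \<not> iso Y Y (a t)} \<union> {t. \<not> iso X X (bb t)})" by simp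
  then show ?thesis by (rule finite_subset[rotated]) (use eqn in blast)
qed

text \<open>On the line through two such elements both orbits contain all but finitely many points, so they meet.\<close>

lemma open_orbit_unique:
  assumes e: "open_orbit X Y e" and e': "open_orbit X Y e'"
  shows "\<exists>a b. iso Y Y a \<and> iso X X b \<and> a \<cdot> e = e' \<cdot> b"
proof -
  have ea: "arr X Y e" "arr X Y e'" using e e' by (auto simp: open_orbit_def)
  have X: "X \<in> Obj D" and Y: "Y \<in> Obj D" using ea by (auto simp: arr_def)
  let ?V = "Hom D X Y"
  interpret V: complex_space ?V by (rule hom_space[OF X Y])
  \<comment> \<open>The line through \<open>e\<close> and \<open>e'\<close>, parametrised from either end: \<open>?pt t = ?pt' (1 - t)\<close>.\<close>
  let ?pt = "\<lambda>t. e \<oplus>\<^bsub>?V\<^esub> t \<odot>\<^bsub>?V\<^esub> (e' \<ominus>\<^bsub>?V\<^esub> e)" and ?pt' = "\<lambda>t. e' \<oplus>\<^bsub>?V\<^esub> t \<odot>\<^bsub>?V\<^esub> (e \<ominus>\<^bsub>?V\<^esub> e')"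
  let ?Q = "\<lambda>e g. \<exists>a b. iso Y Y a \<and> iso X X b \<and> a \<cdot> e = g \<cdot> b"
  have "finite ({t. \<not> ?Q e (?pt t)} \<union> (\<lambda>t. 1 - t) ` {t. \<not> ?Q e' (?pt' t)})"
    using line_in_orbit[OF e arr_diff[OF ea(2,1)]] line_in_orbit[OF e' arr_diff[OF ea]] by simp
  then obtain t where t: "t \<notin> {t. \<not> ?Q e (?pt t)} \<union> (\<lambda>t. 1 - t) ` {t. \<not> ?Q e' (?pt' t)}"
    using ex_new_if_finite[OF infinite_UNIV_char_0] by blast
  then obtain a b where ab: "iso Y Y a" "iso X X b" "a \<cdot> e = ?pt t \<cdot> b" by blast
  have "?Q e' (?pt' (1 - t))"
  proof (rule ccontr)
    assume "\<not> ?thesis"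
    then have "1 - (1 - t) \<in> (\<lambda>t. 1 - t) ` {t. \<not> ?Q e' (?pt' t)}" by blast
    then show False using t by simp
  qed
  then obtain a' b' where ab': "iso Y Y a'" "iso X X b'" "a' \<cdot> e' = ?pt' (1 - t) \<cdot> b'" by blast
  have pt: "?pt' (1 - t) = ?pt t"
  proof -
    obtain n v c where vc: "V.coords n v c" using V.coords_exist[OF hom_fin_dim[OF X Y]] by blast
    have car: "e \<in> carrier ?V" "e' \<in> carrier ?V" using ea by (auto simp: arr_def)
    show ?thesis
    proof (rule V.coords_eqI[OF vc])
      fix i assume "i < n"
      then have ci: "c i \<in> module_hom class_ring ?V ground_module" using vc by (auto simp: V.coords_def)
      note f = V.functionalD[OF ci]
      have minus: "c i (x \<ominus>\<^bsub>?V\<^esub> z) = c i x - c i z" if "x \<in> carrier ?V" "z \<in> carrier ?V" for x z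
      proof -
        have "c i (\<ominus>\<^bsub>?V\<^esub> z) = - c i z"
          using f(2)[OF that(2), of "-1"] unfolding V.smult_minus_one[OF that(2)] by simp
        then show ?thesis using f(1)[OF that(1) V.M.a_inv_closed[OF that(2)]] by (simp add: a_minus_def)
      qed
      have "c i (?pt' (1 - t)) = c i e' + (1 - t) * (c i e - c i e')"
        "c i (?pt t) = c i e + t * (c i e' - c i e)"
        by (simp_all add: f minus car)
      then show "c i (?pt' (1 - t)) = c i (?pt t)" by (simp only:) (simp add: algebra_simps)
    qed (use car in auto)
  qed
  have pa: "arr X Y (?pt t)" using ea arr_add arr_smult arr_diff by blast
  obtain a1 where a1: "arr Y Y a'" "iso Y Y a1" "arr Y Y a1" "a1 \<cdot> a' = Ident D Y"
    using ab'(1) by (auto simp: iso_def)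
  obtain b1 where b1: "arr X X b'" "iso X X b1" "arr X X b1" "b' \<cdot> b1 = Ident D X"
    using ab'(2) by (auto simp: iso_def)
  have ba: "arr X X b" and aa: "arr Y Y a" using ab iso_arr by auto
  have e'b: "e' \<cdot> b1 = a1 \<cdot> ?pt t"
  proof -
    have "a1 \<cdot> ?pt t = a1 \<cdot> (?pt t \<cdot> (b' \<cdot> b1))" using b1 pa by simp
    also have "\<dots> = a1 \<cdot> (a' \<cdot> (e' \<cdot> b1))"
      using assoc[OF b1(3,1) pa] assoc[OF b1(3) ea(2) a1(1)] ab'(3) pt by simp
    also have "\<dots> = e' \<cdot> b1"
      using assoc[OF arr_comp[OF b1(3) ea(2)] a1(1,3)] a1(4) ident_left[OF arr_comp[OF b1(3) ea(2)]] by simp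
    finally show ?thesis by simp
  qed
  have "(a1 \<cdot> a) \<cdot> e = a1 \<cdot> (?pt t \<cdot> b)" using assoc[OF ea(1) aa a1(3)] ab(3) by simp
  also have "\<dots> = e' \<cdot> (b1 \<cdot> b)" using assoc[OF ba pa a1(3)] assoc[OF ba b1(3) ea(2)] e'b by simp
  finally have "(a1 \<cdot> a) \<cdot> e = e' \<cdot> (b1 \<cdot> b)" .
  then show ?thesis using iso_comp[OF ab(1) a1(2)] iso_comp[OF ab(2) b1(2)] by blast
qed

end

section \<open>Serre duality and rigid extensions\<close>

context K3_category
begin

subsection \<open>Serre duality\<close>

text \<open>The condition on \<open>\<eta>\<close> by which \<open>serre_functor\<close> characterises the Serre functor, for the functor \<open>[2]\<close>.\<close>

definition serre_duality :: "('o \<Rightarrow> 'o \<Rightarrow> 'm \<Rightarrow> 'm \<Rightarrow> complex) \<Rightarrow> bool" where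
  "serre_duality \<eta> \<longleftrightarrow>
     (\<forall>A\<in>Obj D. \<forall>B\<in>Obj D.
        \<eta> A B \<in> module_hom class_ring (Hom D A B) (dual_space (Hom D B (sh (sh A)))) \<and>
        bij_betw (\<eta> A B) (Mor D A B) (carrier (dual_space (Hom D B (sh (sh A)))))) \<and>
     (\<forall>A\<in>Obj D. \<forall>A'\<in>Obj D. \<forall>B\<in>Obj D. \<forall>B'\<in>Obj D.
        \<forall>a\<in>Mor D A' A. \<forall>b\<in>Mor D B B'. \<forall>f\<in>Mor D A B. \<forall>g\<in>Mor D B' (sh (sh A')).
          \<eta> A' B' (b \<cdot> f \<cdot> a) g = \<eta> A B f (shm (shm a) \<cdot> g \<cdot> b))"

definition serre :: "'o \<Rightarrow> 'o \<Rightarrow> 'm \<Rightarrow> 'm \<Rightarrow> complex" where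
  "serre = (SOME \<eta>. serre_duality \<eta>)"

lemma serre_duality_serre: "serre_duality serre"
proof -
  have "\<exists>\<eta>. serre_duality \<eta>"
    using double_shift_serre unfolding serre_functor_def serre_duality_def comp_fun_def by simp
  then show ?thesis unfolding serre_def by (rule someI_ex)
qed

lemmas serre_properties =
  conjunct1[OF serre_duality_serre[unfolded serre_duality_def]]
  conjunct2[OF serre_duality_serre[unfolded serre_duality_def]]

lemma serre_natural:
  assumes "arr A' A a" "arr B B' b" "arr A B f" "arr B' (sh (sh A')) g"
  shows "serre A' B' (b \<cdot> f \<cdot> a) g = serre A B f (shm (shm a) \<cdot> g \<cdot> b)"
  using serre_properties(2) assms unfolding arr_def by blast

lemma serre_functional:
  assumes "arr A B f"
  shows "serre A B f \<in> module_hom class_ring (Hom D B (sh (sh A))) ground_module"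
    "serre A B f \<in> extensional (Mor D B (sh (sh A)))"
proof -
  have "serre A B \<in> module_hom class_ring (Hom D A B) (dual_space (Hom D B (sh (sh A))))"
    using serre_properties(1) assms by (simp add: arr_def)
  from linear_mapD(1)[OF this arrD(3)[OF assms]]
  have "serre A B f \<in> carrier (dual_space (Hom D B (sh (sh A))))" .
  then show "serre A B f \<in> module_hom class_ring (Hom D B (sh (sh A))) ground_module"
    "serre A B f \<in> extensional (Mor D B (sh (sh A)))" by (auto simp: dual_space_def)
qed

lemma serre_left_linear:
  assumes "arr A B f" "arr B (sh (sh A)) g"
  shows "arr A B f' \<Longrightarrow> serre A B (f \<oplus>\<^bsub>Hom D A B\<^esub> f') g = serre A B f g + serre A B f' g"
    "serre A B (c \<odot>\<^bsub>Hom D A B\<^esub> f) g = c * serre A B f g"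
proof -
  have h: "serre A B \<in> module_hom class_ring (Hom D A B) (dual_space (Hom D B (sh (sh A))))"
    using serre_properties(1) assms by (simp add: arr_def)
  note g = arrD(3)[OF assms(2)] and f = arrD(3)[OF assms(1)]
  show "serre A B (c \<odot>\<^bsub>Hom D A B\<^esub> f) g = c * serre A B f g"
    using linear_mapD(3)[OF h f] g by (simp add: dual_space_def)
  assume "arr A B f'"
  then show "serre A B (f \<oplus>\<^bsub>Hom D A B\<^esub> f') g = serre A B f g + serre A B f' g"
    using linear_mapD(2)[OF h f arrD(3)] g by (simp add: dual_space_def)
qed

lemma serre_inj:
  assumes "arr A B f" "arr A B f'" "\<And>g. arr B (sh (sh A)) g \<Longrightarrow> serre A B f g = serre A B f' g"
  shows "f = f'"
proof -
  have o: "A \<in> Obj D" "B \<in> Obj D" using assms by (auto simp: arr_def)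
  have "serre A B f = serre A B f'"
    by (rule extensionalityI[OF serre_functional(2)[OF assms(1)] serre_functional(2)[OF assms(2)]])
       (use assms(3) o in \<open>simp add: arr_def\<close>)
  moreover have "inj_on (serre A B) (Mor D A B)"
    using serre_properties(1) o by (simp add: bij_betw_def)
  ultimately show ?thesis using assms(1,2) by (auto simp: inj_on_def arr_def)
qed

lemma serre_surj:
  assumes "A \<in> Obj D" "B \<in> Obj D" "\<phi> \<in> module_hom class_ring (Hom D B (sh (sh A))) ground_module"
  shows "\<exists>f. arr A B f \<and> (\<forall>g. arr B (sh (sh A)) g \<longrightarrow> serre A B f g = \<phi> g)"
proof -
  let ?W = "Hom D B (sh (sh A))"
  interpret W: complex_space ?W using hom_space assms by simp
  have "restrict \<phi> (carrier ?W) \<in> carrier (dual_space ?W)"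
    using assms(3) by (auto simp: dual_space_def LinearCombinations.module_hom_def)
  moreover have "serre A B ` Mor D A B = carrier (dual_space ?W)"
    using serre_properties(1) assms by (simp add: bij_betw_def)
  ultimately obtain f where "f \<in> Mor D A B" "serre A B f = restrict \<phi> (carrier ?W)"
    by (metis imageE)
  then show ?thesis using assms by (intro exI[of _ f]) (simp add: arr_def)
qed

text \<open>The duality \<open>Hom(A, B) \<cong> Hom(B, A[2])\<^sup>*\<close> is the pairing \<open>(f, g) \<mapsto> trace (g f)\<close> with this functional.\<close>

definition trace :: "'o \<Rightarrow> 'm \<Rightarrow> complex" where
  "trace A g = serre A A (Ident D A) g"

text \<open>Naturality allows \<open>f\<close> to be moved into the second argument, either from the right or from the left.\<close>

lemma serre_trace:
  assumes "arr A B f" "arr B (sh (sh A)) g"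
  shows "serre A B f g = trace A (g \<cdot> f)" "serre A B f g = trace B (shm (shm f) \<cdot> g)"
proof -
  have o: "A \<in> Obj D" "B \<in> Obj D" using assms by (auto simp: arr_def)
  have "serre A B (f \<cdot> Ident D A \<cdot> Ident D A) g = serre A A (Ident D A) (shm (shm (Ident D A)) \<cdot> g \<cdot> f)"
    using serre_natural[OF arr_ident[OF o(1)] assms(1) arr_ident[OF o(1)] assms(2)] .
  then show "serre A B f g = trace A (g \<cdot> f)" using assms o by (simp add: trace_def)
  have "serre A B (Ident D B \<cdot> Ident D B \<cdot> f) g = serre B B (Ident D B) (shm (shm f) \<cdot> g \<cdot> Ident D B)"
    using serre_natural[OF assms(1) arr_ident[OF o(2)] arr_ident[OF o(2)] assms(2)] .
  moreover have "arr B (sh (sh B)) (shm (shm f) \<cdot> g)" using assms by blast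
  moreover have "Ident D B \<cdot> Ident D B = Ident D B" by (rule ident_left[OF arr_ident[OF o(2)]])
  ultimately show "serre A B f g = trace B (shm (shm f) \<cdot> g)" using assms o by (simp add: trace_def)
qed

lemma trace_cyclic:
  "arr A B f \<Longrightarrow> arr B (sh (sh A)) g \<Longrightarrow> trace A (g \<cdot> f) = trace B (shm (shm f) \<cdot> g)"
  using serre_trace by metis

lemma trace_nondegenerate:
  assumes "arr A B f" "f \<noteq> Zero D A B"
  shows "\<exists>g. arr B (sh (sh A)) g \<and> trace A (g \<cdot> f) \<noteq> 0"
proof (rule ccontr)
  assume no: "\<not> ?thesis"
  have o: "A \<in> Obj D" "B \<in> Obj D" using assms by (auto simp: arr_def)
  have "serre A B f g = serre A B (Zero D A B) g" if g: "arr B (sh (sh A)) g" for g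
  proof -
    interpret V: complex_space "Hom D A B" using hom_space o by simp
    have "serre A B (Zero D A B) g = 0"
      using serre_left_linear(2)[OF arr_zero[OF o] g, of 0] by simp
    then show ?thesis using no serre_trace(1)[OF assms(1) g] g by auto
  qed
  then have "f = Zero D A B" by (rule serre_inj[OF assms(1) arr_zero[OF o]])
  then show False using assms(2) by simp
qed

lemma trace_linear: "A \<in> Obj D \<Longrightarrow> trace A \<in> module_hom class_ring (Hom D A (sh (sh A))) ground_module"
  using serre_functional(1)[OF arr_ident] by (simp add: trace_def[abs_def])

lemma trace_nondegenerate_right:
  assumes "arr B (sh (sh A)) g" "g \<noteq> Zero D B (sh (sh A))" "A \<in> Obj D"
  shows "\<exists>f. arr A B f \<and> trace A (g \<cdot> f) \<noteq> 0"
proof -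
  have o: "A \<in> Obj D" "B \<in> Obj D" "sh (sh A) \<in> Obj D" using assms by (auto simp: arr_def)
  let ?W = "Hom D B (sh (sh A))"
  interpret W: complex_space ?W using hom_space o by simp
  obtain \<phi> where \<phi>: "\<phi> \<in> module_hom class_ring ?W ground_module" "\<phi> g \<noteq> 0"
    using W.ex_nonzero_functional[OF hom_fin_dim[OF o(2,3)] arrD(3)[OF assms(1)] assms(2)] by blast
  obtain f where "arr A B f" "serre A B f g = \<phi> g" using serre_surj[OF o(1,2) \<phi>(1)] assms(1) by blast
  then show ?thesis using \<phi>(2) serre_trace(1)[OF _ assms(1)] by metis
qed

lemma trace_ext:
  assumes g: "arr B (sh (sh A)) g" "arr B (sh (sh A)) g'" and A: "A \<in> Obj D"
    and eq: "\<And>f. arr A B f \<Longrightarrow> trace A (g \<cdot> f) = trace A (g' \<cdot> f)"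
  shows "g = g'"
proof (rule ccontr)
  assume "g \<noteq> g'"
  then have "g \<ominus>\<^bsub>Hom D B (sh (sh A))\<^esub> g' \<noteq> Zero D B (sh (sh A))" using diff_eq_zero_iff[OF g] by simp
  then obtain f where f: "arr A B f" "trace A ((g \<ominus>\<^bsub>Hom D B (sh (sh A))\<^esub> g') \<cdot> f) \<noteq> 0"
    using trace_nondegenerate_right[OF arr_diff[OF g] _ A] by blast
  interpret V: complex_space "Hom D A (sh (sh A))" using hom_space A by simp
  note l = V.functionalD[OF trace_linear[OF A]]
  have h: "g \<cdot> f \<in> Mor D A (sh (sh A))" "g' \<cdot> f \<in> Mor D A (sh (sh A))"
    using arr_comp[OF f(1) g(1)] arr_comp[OF f(1) g(2)] by (auto simp: arr_def)
  have "trace A (g \<cdot> f \<ominus>\<^bsub>Hom D A (sh (sh A))\<^esub> g' \<cdot> f) = trace A (g \<cdot> f) + (-1) * trace A (g' \<cdot> f)"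
    using l(1)[OF h(1) V.smult_in[OF h(2)], of "-1"] l(2)[OF h(2), of "-1"]
    unfolding a_minus_def V.smult_minus_one[OF h(2)] by simp
  then show False using f(2) diff_comp[OF f(1) g] eq[OF f(1)] by simp
qed

lemma serre_orth:
  assumes "orth A B"
  shows "orth B (sh (sh A))"
proof -
  have o: "A \<in> Obj D" "B \<in> Obj D" using assms by (auto simp: orth_def)
  have "g = Zero D B (sh (sh A))" if g: "arr B (sh (sh A)) g" for g
  proof (rule ccontr)
    assume "g \<noteq> Zero D B (sh (sh A))"
    then obtain f where f: "arr A B f" "trace A (g \<cdot> f) \<noteq> 0"
      using trace_nondegenerate_right[OF g _ o(1)] by blast
    have "f = Zero D A B" by (rule orthD[OF assms f(1)])
    then have "trace A (g \<cdot> f) = trace A (Zero D A (sh (sh A)))" using comp_zero[OF g o(1)] by simp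
    moreover interpret V: complex_space "Hom D A (sh (sh A))" using hom_space o by simp
    have "trace A (Zero D A (sh (sh A))) = 0" by (rule V.functional_zero[OF trace_linear[OF o(1)]])
    ultimately show False using f(2) by simp
  qed
  then show ?thesis using o by (auto simp: orth_def)
qed

abbreviation hdim :: "'o \<Rightarrow> 'o \<Rightarrow> nat" where
  "hdim X Y \<equiv> vectorspace.dim class_ring (Hom D X Y)"

text \<open>The dual of a basis of \<open>Hom(B, A[2])\<close> is a basis of \<open>Hom(A, B)\<close>.\<close>

lemma serre_dim:
  assumes A: "A \<in> Obj D" and B: "B \<in> Obj D"
  shows "hdim A B = hdim B (sh (sh A))"
proof -
  let ?V = "Hom D A B" and ?W = "Hom D B (sh (sh A))"
  interpret V: complex_space ?V using hom_space A B by simp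
  interpret W: complex_space ?W using hom_space A B by simp
  obtain b c where bc: "W.coords W.dim b c" using W.coords_exist[OF hom_fin_dim] A B by blast
  define n where "n = W.dim"
  have bW: "\<And>i. i < n \<Longrightarrow> arr B (sh (sh A)) (b i)" and cW: "\<And>i. i < n \<Longrightarrow> c i \<in> module_hom class_ring ?W ground_module"
    and dual: "\<And>i j. i < n \<Longrightarrow> j < n \<Longrightarrow> c i (b j) = (if i = j then 1 else 0)"
    and recon: "\<And>w. w \<in> carrier ?W \<Longrightarrow> W.lsum n (\<lambda>i. c i w) b = w"
    using bc A B unfolding W.coords_def n_def arr_def by blast+
  have "\<forall>i. \<exists>f. i < n \<longrightarrow> arr A B f \<and> (\<forall>g. arr B (sh (sh A)) g \<longrightarrow> serre A B f g = c i g)"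
    using serre_surj[OF A B cW] by blast
  then obtain f where f: "\<And>i. i < n \<Longrightarrow> arr A B (f i)"
    "\<And>i g. i < n \<Longrightarrow> arr B (sh (sh A)) g \<Longrightarrow> serre A B (f i) g = c i g" by metis
  have serre_sum: "serre A B (V.lsum n x f) g = (\<Sum>i<n. x i * c i g)" if g: "arr B (sh (sh A)) g" for x g
  proof -
    have "(\<lambda>h. serre A B h g) \<in> module_hom class_ring ?V ground_module"
      using serre_left_linear[OF _ g] A B
      by (auto simp: LinearCombinations.module_hom_def ground_module_def arr_def)
    from V.functional_lsum[OF this, of n f x] f g show ?thesis by (simp add: arr_def)
  qed
  have "V.coords n f (\<lambda>i h. serre A B h (b i))"
    unfolding V.coords_def
  proof (intro conjI allI impI ballI)
    fix i assume i: "i < n"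
    show "f i \<in> carrier ?V" using f(1)[OF i] by (simp add: arr_def)
    show "(\<lambda>h. serre A B h (b i)) \<in> module_hom class_ring ?V ground_module"
      using serre_left_linear[OF _ bW[OF i]] A B
      by (auto simp: LinearCombinations.module_hom_def ground_module_def arr_def)
    fix j assume j: "j < n"
    show "serre A B (f j) (b i) = (if i = j then 1 else 0)"
      using f(2)[OF j bW[OF i]] dual[OF j i] by auto
  next
    fix v assume v: "v \<in> carrier ?V"
    have va: "arr A B v" using v A B by (simp add: arr_def)
    have sa: "arr A B (V.lsum n (\<lambda>i. serre A B v (b i)) f)" by (rule arr_msum[OF A B f(1)])
    show "V.lsum n (\<lambda>i. serre A B v (b i)) f = v"
    proof (rule serre_inj[OF sa va])
      fix g assume g: "arr B (sh (sh A)) g"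
      have "serre A B v g = serre A B v (W.lsum n (\<lambda>i. c i g) b)" using recon arrD(3)[OF g] by simp
      also have "\<dots> = (\<Sum>i<n. c i g * serre A B v (b i))"
        by (rule W.functional_lsum[OF serre_functional(1)[OF va]]) (use bW in \<open>auto simp: arr_def\<close>)
      also have "\<dots> = serre A B (V.lsum n (\<lambda>i. serre A B v (b i)) f) g"
        unfolding serre_sum[OF g] by (simp add: mult.commute)
      finally show "serre A B (V.lsum n (\<lambda>i. serre A B v (b i)) f) g = serre A B v g" by simp
    qed
  qed
  then show ?thesis using V.coords_dim(1) n_def by blast
qed

subsection \<open>Extensions of rigid objects\<close>

lemma rigid_iff: "E \<in> Obj D \<Longrightarrow> rigid D E \<longleftrightarrow> orth E (sh E)"
  using orth_iff[of E "sh E"] by (simp add: rigid_def shift_obj_def)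

text \<open>By Serre duality \<open>Hom(B, A[2]) = 0\<close>. For \<open>\<beta> : B \<rightarrow> B[1]\<close> the composite \<open>E \<rightarrow> B \<rightarrow> B[1]\<close> therefore lifts to
  \<open>E \<rightarrow> E[1]\<close> and vanishes, so \<open>\<beta>\<close> factors through \<open>A[1] \<rightarrow> B[1]\<close> and is zero. The argument for \<open>A\<close> is dual, with the
  factorisation through \<open>A \<rightarrow> B\<close> in the last step.\<close>

lemma mukai:
  assumes T: "tri A E B u v w" and AB: "orth A B" and E: "orth E (sh E)"
  shows "orth A (sh A)" "orth B (sh B)"
proof -
  note t = triD[OF T]
  have BA: "orth B (sh (sh A))" using serre_orth[OF AB] .
  show "orth B (sh B)"
  proof -
    have "\<beta> = Zero D B (sh B)" if \<beta>: "arr B (sh B) \<beta>" for \<beta>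
    proof -
      have "shm w \<cdot> \<beta> = Zero D B (sh (sh A))" using orthD[OF BA arr_comp[OF \<beta> sh_arr[OF t(6)]]] .
      then have "shm w \<cdot> (\<beta> \<cdot> v) = Zero D E (sh (sh A))"
        using assoc[OF t(5) \<beta> sh_arr[OF t(6)]] zero_comp[OF t(5)] t by simp
      moreover have "(\<ominus>\<^bsub>Hom D (sh B) (sh (sh A))\<^esub> shm w) \<cdot> (\<beta> \<cdot> v)
          = \<ominus>\<^bsub>Hom D E (sh (sh A))\<^esub> (shm w \<cdot> (\<beta> \<cdot> v))"
        by (rule neg_comp[OF arr_comp[OF t(5) \<beta>] sh_arr[OF t(6)]])
      ultimately have "(\<ominus>\<^bsub>Hom D (sh B) (sh (sh A))\<^esub> shm w) \<cdot> (\<beta> \<cdot> v) = Zero D E (sh (sh A))"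
        using neg_eq_zero_iff[OF arr_zero[OF t(2) sh_obj[OF sh_obj[OF t(1)]]]] by simp
      then obtain h where h: "arr E (sh E) h" "\<beta> \<cdot> v = shm v \<cdot> h"
        using hom_exact_right[OF tri_shift[OF T] arr_comp[OF t(5) \<beta>]] by blast
      then have "\<beta> \<cdot> v = Zero D E (sh B)"
        using orthD[OF E h(1)] comp_zero[OF sh_arr[OF t(5)] t(2)] by simp
      then obtain k where k: "arr (sh A) (sh B) k" "\<beta> = k \<cdot> w" using cohom_exact_right[OF T \<beta>] by blast
      have "orth (sh A) (sh B)" using AB sh_orth t by blast
      then show ?thesis using orthD[OF _ k(1)] k(2) zero_comp[OF t(6)] t by simp
    qed
    then show ?thesis using t by (simp add: orth_def)
  qed
  show "orth A (sh A)"
  proof -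
    have "\<alpha> = Zero D A (sh A)" if \<alpha>: "arr A (sh A) \<alpha>" for \<alpha>
    proof -
      have "shm \<alpha> \<cdot> w = Zero D B (sh (sh A))" using orthD[OF BA arr_comp[OF t(6) sh_arr[OF \<alpha>]]] .
      then obtain h where h: "arr (sh E) (sh (sh A)) h" "shm \<alpha> = h \<cdot> shm u"
        using cohom_exact_shift[OF T sh_arr[OF \<alpha>]] by blast
      obtain \<gamma> where \<gamma>: "arr E (sh A) \<gamma>" "shm \<gamma> = h" using sh_full[OF t(2) sh_obj[OF t(1)] h(1)] by blast
      have "shm \<alpha> = shm (\<gamma> \<cdot> u)" using h(2) \<gamma> sh_comp[OF t(4) \<gamma>(1)] by simp
      then have au: "\<alpha> = \<gamma> \<cdot> u" using sh_faithful[OF \<alpha> arr_comp[OF t(4) \<gamma>(1)]] by simp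
      have "shm u \<cdot> \<gamma> = Zero D E (sh E)" using orthD[OF E arr_comp[OF \<gamma>(1) sh_arr[OF t(4)]]] .
      then obtain \<delta> where \<delta>: "arr E B \<delta>" "\<gamma> = w \<cdot> \<delta>" using hom_exact_shift[OF T \<gamma>(1)] by blast
      have "\<delta> \<cdot> u = Zero D A B" using orthD[OF AB arr_comp[OF t(4) \<delta>(1)]] .
      then show ?thesis using au \<delta> assoc[OF t(4) \<delta>(1) t(6)] comp_zero[OF t(6,1)] by simp
    qed
    then show ?thesis using t by (simp add: orth_def)
  qed
qed

text \<open>Since \<open>E\<close> is rigid, \<open>\<eta> v : E \<rightarrow> A[1]\<close> factors through \<open>w\<close>; since \<open>Hom(A, B) = 0\<close>, the factor \<open>E \<rightarrow> B\<close> comes from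
  an endomorphism \<open>b\<close> of \<open>B\<close>. Then \<open>\<eta> - w b\<close> is killed by \<open>v\<close>, hence is a multiple \<open>a w\<close>.\<close>

lemma rigid_extension_open_orbit:
  assumes T: "tri A E B u v w" and AB: "orth A B" and E: "orth E (sh E)"
  shows "open_orbit B (sh A) w"
  unfolding open_orbit_def
proof (intro conjI allI impI)
  note t = triD[OF T]
  show "arr B (sh A) w" by (rule t)
  fix \<eta> assume \<eta>: "arr B (sh A) \<eta>"
  have \<eta>v: "arr E (sh A) (\<eta> \<cdot> v)" using arr_comp[OF t(5) \<eta>] .
  have "shm u \<cdot> (\<eta> \<cdot> v) = Zero D E (sh E)" using orthD[OF E arr_comp[OF \<eta>v sh_arr[OF t(4)]]] .
  then obtain \<delta> where \<delta>: "arr E B \<delta>" "\<eta> \<cdot> v = w \<cdot> \<delta>" using hom_exact_shift[OF T \<eta>v] by blast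
  have "\<delta> \<cdot> u = Zero D A B" using orthD[OF AB arr_comp[OF t(4) \<delta>(1)]] .
  then obtain b where b: "arr B B b" "\<delta> = b \<cdot> v" using cohom_exact_mid[OF T \<delta>(1)] by blast
  have wb: "arr B (sh A) (w \<cdot> b)" using arr_comp[OF b(1) t(6)] .
  have "\<eta> \<cdot> v = w \<cdot> b \<cdot> v" using \<delta>(2) b assoc[OF t(5) b(1) t(6)] by simp
  then have "(\<eta> \<ominus>\<^bsub>Hom D B (sh A)\<^esub> w \<cdot> b) \<cdot> v = Zero D E (sh A)"
    using diff_comp[OF t(5) \<eta> wb] diff_eq_zero_iff[OF \<eta>v arr_comp[OF t(5) wb]] by simp
  then obtain a where a: "arr (sh A) (sh A) a" "\<eta> \<ominus>\<^bsub>Hom D B (sh A)\<^esub> w \<cdot> b = a \<cdot> w"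
    using cohom_exact_right[OF T arr_diff[OF \<eta> wb]] by blast
  have "\<eta> = a \<cdot> w \<oplus>\<^bsub>Hom D B (sh A)\<^esub> w \<cdot> b" using add_diff_cancel[OF \<eta> wb a(2)[symmetric]] .
  then show "\<exists>a b. arr (sh A) (sh A) a \<and> arr B B b \<and> \<eta> = a \<cdot> w \<oplus>\<^bsub>Hom D B (sh A)\<^esub> w \<cdot> b"
    using a(1) b(1) by blast
qed

text \<open>An isomorphism between the classes of two extensions completes to one between their middle terms.\<close>

lemma rigid_extension_unique:
  assumes T: "tri A E B u v w" and T': "tri A E' B u' v' w'" and AB: "orth A B"
    and E: "orth E (sh E)" and E': "orth E' (sh E')"
  shows "isom E E'"
proof -
  note t = triD[OF T]
  obtain a b where ab: "iso (sh A) (sh A) a" "iso B B b" "a \<cdot> w = w' \<cdot> b"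
    using open_orbit_unique[OF rigid_extension_open_orbit[OF T AB E] rigid_extension_open_orbit[OF T' AB E']]
    by blast
  obtain a0 where a0: "arr A A a0" "shm a0 = a" using sh_full[OF t(1,1) iso_arr[OF ab(1)]] by blast
  have "iso A A a0" using equivalence_reflects_iso[OF shift_autoequivalence a0(1)] ab(1) a0(2) by simp
  then show ?thesis using tri_iso_second[OF T T' _ ab(2)] ab(3) a0(2) by blast
qed

lemma autoequivalence_triangle:
  assumes F: "F \<in> Aut D" and T: "tri A E B u v w"
    and A: "isom (onObj F A) A" and B: "isom (onObj F B) B"
  shows "\<exists>u' v' w'. tri A (onObj F E) B u' v' w'"
proof -
  obtain \<eta> where "(onObj F A, onObj F E, onObj F B, onMor F u, onMor F v, \<eta> A \<cdot> onMor F w) \<in> Tri D"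
    using F T unfolding Aut_def exact_functor_def tri_def by blast
  then have T': "tri (onObj F A) (onObj F E) (onObj F B) (onMor F u) (onMor F v) (\<eta> A \<cdot> onMor F w)"
    by (simp add: tri_def)
  obtain a b where ab: "iso (onObj F A) A a" "iso (onObj F B) B b" using A B by (auto simp: isom_def)
  show ?thesis using tri_transport[OF T' ab(1) iso_ident[OF triD(2)[OF T']] ab(2)] by blast
qed

lemma autoequivalence_rigid:
  assumes F: "F \<in> Aut D" and E: "orth E (sh E)"
  shows "orth (onObj F E) (sh (onObj F E))"
proof -
  have o: "E \<in> Obj D" using E by (simp add: orth_def)
  have eq: "linear_autoequivalence D F" using F by (simp add: Aut_def)
  then have lin: "linear_functor D F" by (simp add: linear_autoequivalence_def)
  obtain \<eta> where "nat_iso D (comp_fun F (Shift D)) (comp_fun (Shift D) F) \<eta>"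
    using F unfolding Aut_def exact_functor_def by blast
  then have "is_iso D (onObj F (sh E)) (sh (onObj F E)) (\<eta> E)"
    using o by (simp add: nat_iso_def comp_fun_def)
  then have i: "isom (onObj F (sh E)) (sh (onObj F E))"
    using iso_is_iso functor_obj[OF lin] o sh_obj unfolding isom_def by blast
  have "orth (onObj F E) (onObj F (sh E))" using equivalence_orth[OF eq o sh_obj[OF o]] E by blast
  then show ?thesis using orth_isom[OF _ isom_refl[OF functor_obj[OF lin o]] i] by blast
qed

lemma rigid_extension_fixed:
  assumes F: "F \<in> Aut D" and T: "tri A E B u v w" and AB: "orth A B" and E: "orth E (sh E)"
    and A: "isom (onObj F A) A" and B: "isom (onObj F B) B"
  shows "isom (onObj F E) E"
proof -
  obtain u' v' w' where "tri A (onObj F E) B u' v' w'" using autoequivalence_triangle[OF F T A B] by blast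
  then show ?thesis using rigid_extension_unique[OF _ T AB autoequivalence_rigid[OF F E] E] by blast
qed

text \<open>Here \<open>E\<close> and \<open>f(E)\<close> are both the direct sum of \<open>A\<close> and \<open>B\<close>.\<close>

lemma split_extension_fixed:
  assumes F: "F \<in> Aut D" and T: "tri A E B u v w" and BA: "orth B (sh A)"
    and A: "isom (onObj F A) A" and B: "isom (onObj F B) B"
  shows "isom (onObj F E) E"
proof -
  note t = triD[OF T]
  obtain u' v' w' where T': "tri A (onObj F E) B u' v' w'" using autoequivalence_triangle[OF F T A B] by blast
  have "w = Zero D B (sh A)" "w' = Zero D B (sh A)" using orthD[OF BA] t(6) triD(6)[OF T'] by blast+
  moreover have "Ident D (sh A) \<cdot> Zero D B (sh A) = Zero D B (sh A) \<cdot> Ident D B"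
    using comp_zero[OF arr_ident[OF sh_obj[OF t(1)]] t(3)] zero_comp[OF arr_ident[OF t(3)] sh_obj[OF t(1)]] by simp
  ultimately have "shm (Ident D A) \<cdot> w' = w \<cdot> Ident D B" using t(1) by simp
  then show ?thesis using tri_iso_second[OF T' T iso_ident[OF t(1)] iso_ident[OF t(3)]] by blast
qed

end

section \<open>Euler characteristics and self-extensions\<close>

context K3_category
begin

subsection \<open>Euler characteristics\<close>

lemma hdim_zero_iff: "X \<in> Obj D \<Longrightarrow> Y \<in> Obj D \<Longrightarrow> hdim X Y = 0 \<longleftrightarrow> orth X Y"
  using complex_space.dim_eq_0_iff[OF hom_space hom_fin_dim] orth_iff by simp

lemma hdim_shift:
  assumes X: "X \<in> Obj D" and Y: "Y \<in> Obj D"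
  shows "hdim (sh X) (sh Y) = hdim X Y"
proof -
  interpret V: complex_space "Hom D X Y" by (rule hom_space[OF X Y])
  interpret W: complex_space "Hom D (sh X) (sh Y)" using hom_space X Y by simp
  interpret T: linear_map class_ring "Hom D X Y" "Hom D (sh X) (sh Y)" shm
    by unfold_locales (rule functor_hom[OF sh_functor X Y])
  have "inj_on shm (Mor D X Y)"
    using sh_faithful X Y by (auto simp: inj_on_def arr_def)
  moreover have "shm ` Mor D X Y = Mor D (sh X) (sh Y)"
  proof
    show "shm ` Mor D X Y \<subseteq> Mor D (sh X) (sh Y)" using sh_arr X Y by (auto simp: arr_def)
    show "Mor D (sh X) (sh Y) \<subseteq> shm ` Mor D X Y"
    proof
      fix h assume "h \<in> Mor D (sh X) (sh Y)"
      then obtain f where "arr X Y f" "shm f = h" using sh_full[OF X Y, of h] X Y by (auto simp: arr_def)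
      then show "h \<in> shm ` Mor D X Y" by (auto simp: arr_def)
    qed
  qed
  ultimately show ?thesis using T.dim_eq[OF hom_fin_dim[OF X Y]] by simp
qed

lemma connecting_hom:
  assumes "arr C (sh X) w" "T \<in> Obj D" "X \<in> Obj D"
  shows "(\<lambda>f. shm f \<cdot> w) \<in> module_hom class_ring (Hom D X T) (Hom D C (sh T))"
  using linear_map_comp[OF functor_hom[OF sh_functor assms(3,2)] comp_left_hom[OF assms(1) sh_obj[OF assms(2)]]] .

text \<open>Exactness of the sequence \<open>Hom(C, T) \<rightarrow> Hom(Y, T) \<rightarrow> Hom(X, T) \<rightarrow> Hom(C, T[1]) \<rightarrow> Hom(Y, T[1])\<close>, in the form
  suited to counting dimensions.\<close>

lemma cohom_exact_images:
  assumes T: "tri X Y C u v w" and O: "T \<in> Obj D"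
  shows "(\<lambda>g. g \<cdot> v) ` Mor D C T = {g \<in> Mor D Y T. g \<cdot> u = Zero D X T}"
    "(\<lambda>g. g \<cdot> u) ` Mor D Y T = {f \<in> Mor D X T. shm f \<cdot> w = Zero D C (sh T)}"
    "(\<lambda>f. shm f \<cdot> w) ` Mor D X T = {g \<in> Mor D C (sh T). g \<cdot> v = Zero D Y (sh T)}"
proof -
  note t = triD[OF T]
  have "g \<cdot> v \<in> {g \<in> Mor D Y T. g \<cdot> u = Zero D X T}" if "g \<in> Mor D C T" for g
  proof -
    have g: "arr C T g" using that t O by (simp add: arr_def)
    show ?thesis using arr_comp[OF t(5) g] assoc[OF t(4,5) g] tri_comp_zero[OF T] comp_zero[OF g t(1)]
      by (simp add: arr_def)
  qed
  moreover have "g \<in> (\<lambda>g. g \<cdot> v) ` Mor D C T" if "g \<in> Mor D Y T" "g \<cdot> u = Zero D X T" for g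
    using cohom_exact_mid[OF T, of T g] that t O by (auto simp: arr_def)
  ultimately show "(\<lambda>g. g \<cdot> v) ` Mor D C T = {g \<in> Mor D Y T. g \<cdot> u = Zero D X T}" by blast
  have "g \<cdot> u \<in> {f \<in> Mor D X T. shm f \<cdot> w = Zero D C (sh T)}" if "g \<in> Mor D Y T" for g
  proof -
    have g: "arr Y T g" using that t O by (simp add: arr_def)
    have "shm (g \<cdot> u) \<cdot> w = Zero D C (sh T)"
      using sh_comp[OF t(4) g] assoc[OF t(6) sh_arr[OF t(4)] sh_arr[OF g]] tri_comp_zero''[OF T]
        comp_zero[OF sh_arr[OF g] t(3)] by simp
    then show ?thesis using arr_comp[OF t(4) g] by (simp add: arr_def)
  qed
  moreover have "f \<in> (\<lambda>g. g \<cdot> u) ` Mor D Y T" if f0: "f \<in> Mor D X T" "shm f \<cdot> w = Zero D C (sh T)" for f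
  proof -
    have f: "arr X T f" using f0 t O by (simp add: arr_def)
    obtain h where h: "arr (sh Y) (sh T) h" "shm f = h \<cdot> shm u"
      using cohom_exact_shift[OF T sh_arr[OF f] f0(2)] by blast
    obtain k where k: "arr Y T k" "shm k = h" using sh_full[OF t(2) O h(1)] by blast
    have "shm f = shm (k \<cdot> u)" using h(2) k sh_comp[OF t(4) k(1)] by simp
    then have "f = k \<cdot> u" by (rule sh_faithful[OF f arr_comp[OF t(4) k(1)]])
    then show ?thesis using k(1) by (auto simp: arr_def)
  qed
  ultimately show "(\<lambda>g. g \<cdot> u) ` Mor D Y T = {f \<in> Mor D X T. shm f \<cdot> w = Zero D C (sh T)}" by blast
  have "shm f \<cdot> w \<in> {g \<in> Mor D C (sh T). g \<cdot> v = Zero D Y (sh T)}" if "f \<in> Mor D X T" for f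
  proof -
    have f: "arr X T f" using that t O by (simp add: arr_def)
    show ?thesis
      using arr_comp[OF t(6) sh_arr[OF f]] assoc[OF t(5,6) sh_arr[OF f]] tri_comp_zero'[OF T]
        comp_zero[OF sh_arr[OF f] t(2)] by (simp add: arr_def)
  qed
  moreover have "g \<in> (\<lambda>f. shm f \<cdot> w) ` Mor D X T" if g0: "g \<in> Mor D C (sh T)" "g \<cdot> v = Zero D Y (sh T)" for g
  proof -
    have g: "arr C (sh T) g" using g0 t O by (simp add: arr_def)
    obtain h where h: "arr (sh X) (sh T) h" "g = h \<cdot> w" using cohom_exact_right[OF T g g0(2)] by blast
    obtain k where k: "arr X T k" "shm k = h" using sh_full[OF t(1) O h(1)] by blast
    then show ?thesis using h(2) by (auto simp: arr_def)
  qed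
  ultimately show "(\<lambda>f. shm f \<cdot> w) ` Mor D X T = {g \<in> Mor D C (sh T). g \<cdot> v = Zero D Y (sh T)}" by blast
qed

text \<open>Only the degrees \<open>0\<close>, \<open>1\<close>, \<open>2\<close> are counted. In a K3 category this is the full Euler characteristic of two
  semistable objects of the same phase.\<close>

definition euler :: "'o \<Rightarrow> 'o \<Rightarrow> int" where
  "euler X T = int (hdim X T) - int (hdim X (sh T)) + int (hdim X (sh (sh T)))"

text \<open>The alternating sum over nine consecutive terms of the long exact sequence equals the sum of the ranks of the two
  maps at its ends, which are nonnegative.\<close>

lemma euler_subadditive:
  assumes T: "tri X Y C u v w" and O: "T \<in> Obj D"
  shows "euler Y T \<le> euler X T + euler C T"
proof -
  note t = triD[OF T]
  have dims: "hdim Y R = rank (Hom D C R) (Hom D Y R) (\<lambda>g. g \<cdot> v) + rank (Hom D Y R) (Hom D X R) (\<lambda>g. g \<cdot> u)"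
      "hdim X R = rank (Hom D Y R) (Hom D X R) (\<lambda>g. g \<cdot> u) + rank (Hom D X R) (Hom D C (sh R)) (\<lambda>f. shm f \<cdot> w)"
      "hdim C (sh R) = rank (Hom D X R) (Hom D C (sh R)) (\<lambda>f. shm f \<cdot> w)
          + rank (Hom D C (sh R)) (Hom D Y (sh R)) (\<lambda>g. g \<cdot> v)"
      "rank (Hom D C R) (Hom D Y R) (\<lambda>g. g \<cdot> v) \<le> hdim C R" if R: "R \<in> Obj D" for R
    using dim_of_exact[OF hom_space[OF t(2) R] hom_space[OF t(1) R] hom_fin_dim[OF t(2) R] comp_left_hom[OF t(4) R]
        cohom_exact_images(1)[OF T R]]
      dim_of_exact[OF hom_space[OF t(1) R] hom_space[OF t(3) sh_obj[OF R]] hom_fin_dim[OF t(1) R]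
        connecting_hom[OF t(6) R t(1)] cohom_exact_images(2)[OF T R]]
      dim_of_exact[OF hom_space[OF t(3) sh_obj[OF R]] hom_space[OF t(2) sh_obj[OF R]] hom_fin_dim[OF t(3) sh_obj[OF R]]
        comp_left_hom[OF t(5) sh_obj[OF R]] cohom_exact_images(3)[OF T R]]
      rank_le_dim[OF hom_space[OF t(3) R] hom_space[OF t(2) R] hom_fin_dim[OF t(3) R] comp_left_hom[OF t(5) R]]
    by blast+
  note O1 = sh_obj[OF O] and O2 = sh_obj[OF sh_obj[OF O]]
  show ?thesis
    using dims[OF O] dims[OF O1] dims[OF O2] unfolding euler_def by linarith
qed

lemma euler_serre:
  assumes "A \<in> Obj D" "B \<in> Obj D"
  shows "euler A B = euler B A"
proof -
  have "hdim A B = hdim B (sh (sh A))" by (rule serre_dim[OF assms])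
  moreover have "hdim A (sh (sh B)) = hdim B A" using serre_dim[OF assms(2,1)] by simp
  moreover have "hdim A (sh B) = hdim B (sh A)"
    using serre_dim[OF assms(1) sh_obj[OF assms(2)]] hdim_shift[OF assms(2) sh_obj[OF assms(1)]] by simp
  ultimately show ?thesis by (simp add: euler_def)
qed

text \<open>Schur's lemma over the complex numbers. Composition with \<open>g\<close> on \<open>End S\<close> has an eigenvector \<open>v\<close>, and \<open>g v = l v\<close> gives
  \<open>g = l id\<close> because \<open>v\<close> is invertible.\<close>

lemma endomorphisms_scalar:
  assumes S: "S \<in> Obj D" "\<not> zero_object D S"
    and div: "\<And>g. arr S S g \<Longrightarrow> g \<noteq> Zero D S S \<Longrightarrow> iso S S g"
    and g: "arr S S g"
  shows "\<exists>c. g = c \<odot>\<^bsub>Hom D S S\<^esub> Ident D S"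
proof -
  let ?V = "Hom D S S"
  interpret V: complex_space ?V by (rule hom_space[OF S(1,1)])
  obtain b c where bc: "V.coords V.dim b c" using V.coords_exist[OF hom_fin_dim[OF S(1,1)]] by blast
  define n where "n = V.dim"
  have bV: "\<And>i. i < n \<Longrightarrow> arr S S (b i)" and cV: "\<And>i. i < n \<Longrightarrow> c i \<in> module_hom class_ring ?V ground_module"
    using bc S by (auto simp: V.coords_def n_def arr_def)
  have bc': "V.coords n b c" using bc by (simp add: n_def)
  have "n \<noteq> 0" using hdim_zero_iff[OF S(1,1)] orth_self_iff[OF S(1)] S(2) n_def by simp
  define M where "M = mat n n (\<lambda>(i,j). c i (g \<cdot> b j))"
  have M: "M \<in> carrier_mat n n" by (simp add: M_def)
  have "\<not> constant (poly (char_poly M))"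
    using degree_monic_char_poly[OF M] \<open>n \<noteq> 0\<close> constant_degree[of "char_poly M"] by simp
  then obtain l where "poly (char_poly M) l = 0" using fundamental_theorem_of_algebra by blast
  then obtain x where x: "x \<in> carrier_vec n" "x \<noteq> 0\<^sub>v n" "M *\<^sub>v x = l \<cdot>\<^sub>v x"
    using eigenvalue_root_char_poly[OF M] M unfolding eigenvalue_def eigenvector_def by auto
  define v where "v = V.lsum n (\<lambda>i. x $ i) b"
  have v: "arr S S v" unfolding v_def by (rule arr_msum[OF S(1,1) bV])
  have cv: "c i v = x $ i" if "i < n" for i unfolding v_def by (rule V.coords_lsum[OF bc' that])
  have "v \<noteq> Zero D S S"
  proof
    assume "v = Zero D S S"
    then have "x $ i = 0" if "i < n" for i using cv[OF that] V.functional_zero[OF cV[OF that]] by simp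
    then have "x = 0\<^sub>v n" using x(1) by (intro eq_vecI) auto
    then show False using x(2) by simp
  qed
  then have iv: "iso S S v" using div v by blast
  have gv: "g \<cdot> v = l \<odot>\<^bsub>?V\<^esub> v"
  proof (rule V.coords_eqI[OF bc'])
    fix i assume i: "i < n"
    have "c i (g \<cdot> v) = (\<Sum>j<n. x $ j * c i (g \<cdot> b j))"
    proof -
      have "g \<cdot> v = V.lsum n (\<lambda>i. x $ i) (\<lambda>i. g \<cdot> b i)"
        unfolding v_def by (rule comp_msum[OF g S(1) bV])
      then show ?thesis
        using V.functional_lsum[OF cV[OF i], of n "\<lambda>i. g \<cdot> b i" "\<lambda>i. x $ i"] arrD(3)[OF arr_comp[OF bV g]]
        by simp
    qed
    also have "\<dots> = (M *\<^sub>v x) $ i"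
      using i x(1) M by (simp add: mult_mat_vec_def scalar_prod_def M_def lessThan_atLeast0 mult.commute)
    also have "\<dots> = l * c i v" using x i cv by simp
    also have "\<dots> = c i (l \<odot>\<^bsub>?V\<^esub> v)" using V.functionalD(2)[OF cV[OF i] arrD(3)[OF v]] by simp
    finally show "c i (g \<cdot> v) = c i (l \<odot>\<^bsub>?V\<^esub> v)" .
  qed (use arr_comp[OF v g] v in \<open>auto simp: arr_def\<close>)
  have I: "arr S S (Ident D S)" using S(1) by simp
  have "g \<cdot> v = (l \<odot>\<^bsub>?V\<^esub> Ident D S) \<cdot> v" using gv comp_smult_left[OF v I] ident_left[OF v] by simp
  then have "g = l \<odot>\<^bsub>?V\<^esub> Ident D S" by (rule iso_cancel_right[OF iv g arr_smult[OF I]])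
  then show ?thesis by blast
qed

lemma smult_eq_zeroD:
  assumes "arr X Y f" "a \<odot>\<^bsub>Hom D X Y\<^esub> f = Zero D X Y" "f \<noteq> Zero D X Y"
  shows "a = 0"
proof -
  interpret V: complex_space "Hom D X Y" using assms(1) by (intro hom_space arrD)
  show ?thesis using V.smult_eq_0D[OF assms(2) arrD(3)[OF assms(1)]] assms(3) by blast
qed

lemma smult_cancel:
  assumes "arr X Y f" "a \<odot>\<^bsub>Hom D X Y\<^esub> f = b \<odot>\<^bsub>Hom D X Y\<^esub> f" "f \<noteq> Zero D X Y"
  shows "a = b"
proof -
  interpret V: complex_space "Hom D X Y" using assms(1) by (intro hom_space arrD)
  have f: "f \<in> carrier (Hom D X Y)" using assms(1) by (simp add: arr_def)
  have "(a + - b) \<odot>\<^bsub>Hom D X Y\<^esub> f = (b + - b) \<odot>\<^bsub>Hom D X Y\<^esub> f"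
    using V.smult_add_left[OF f, of a "- b"] V.smult_add_left[OF f, of b "- b"] assms(2) by simp
  then show ?thesis using V.smult_eq_0D[of "a + - b" f] V.smult_0[OF f] f assms(3) by force
qed

text \<open>On the first self-extensions of an object with \<open>End S = \<complex>\<close> Serre duality is skew-symmetric, which a
  one-dimensional space does not allow. Skew-symmetry itself would require the behaviour of the trace under the
  shift. Instead, let \<open>A\<close> be the self-extension \<open>S \<rightarrow> A \<rightarrow> S\<close> with class \<open>x\<close>. Its endomorphism
  \<open>\<epsilon> : A \<rightarrow> S \<rightarrow> A\<close> is central, so by cyclicity of the trace it commutes with every \<open>z : A \<rightarrow> A[2]\<close>. Choosing \<open>z\<close> with
  \<open>trace (z \<epsilon>) \<noteq> 0\<close> yields a nonzero \<open>y : S \<rightarrow> S[2]\<close> and a morphism from a rotation of the triangle to its double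
  shift. Its third component is a multiple of \<open>x[1]\<close> and shows that \<open>y\<close> and \<open>-y\<close> are the same multiple of
  \<open>x[1] x\<close>.\<close>

lemma self_extension_dim_neq_1:
  assumes S: "S \<in> Obj D" "\<not> zero_object D S"
    and scalar: "\<And>g. arr S S g \<Longrightarrow> \<exists>c. g = c \<odot>\<^bsub>Hom D S S\<^esub> Ident D S"
    and neg: "orth (sh S) S"
  shows "hdim S (sh S) \<noteq> 1"
proof
  assume one: "hdim S (sh S) = 1"
  note shS = sh_obj[OF S(1)] and sh2S = sh_obj[OF sh_obj[OF S(1)]]
  interpret V: complex_space "Hom D S (sh S)" by (rule hom_space[OF S(1) shS])
  obtain x where x: "arr S (sh S) x" "x \<noteq> Zero D S (sh S)"
    using one hdim_zero_iff[OF S(1) shS] S(1) shS unfolding orth_def by auto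
  have span: "\<exists>a. f = a \<odot>\<^bsub>Hom D S (sh S)\<^esub> x" if "arr S (sh S) f" for f
    using V.dim_1_span[OF hom_fin_dim[OF S(1) shS] one arrD(3)[OF x(1)] x(2) arrD(3)[OF that]] .
  \<comment> \<open>The self-extension \<open>A\<close> with class \<open>x\<close>.\<close>
  obtain A p q where T0: "tri A S (sh S) p x q" using fiber_exists[OF x(1)] by blast
  note A = triD(1)[OF T0]
  obtain i where i: "arr S A i" "shm i = \<ominus>\<^bsub>Hom D (sh S) (sh A)\<^esub> q"
    using sh_full[OF S(1) A arr_neg[OF triD(6)[OF T0]]] by blast
  have T: "tri S A S i p x"
    using tri_unrot[OF i(1)] i(2) T0 neg_neg[OF triD(6)[OF T0]] by simp
  note t = triD[OF T]
  have shA_S: "orth (sh A) S" using orth_mid_left[OF tri_shift[OF T] neg neg] .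
  have p0: "p \<noteq> Zero D A S"
  proof
    assume "p = Zero D A S"
    then have "Ident D S \<cdot> p = Zero D A S" using comp_zero[OF arr_ident[OF S(1)] A] by simp
    then obtain h where h: "arr (sh S) S h" "Ident D S = h \<cdot> x"
      using cohom_exact_right[OF T arr_ident[OF S(1)]] by blast
    then have "Ident D S = Zero D S S" using orthD[OF neg h(1)] zero_comp[OF x(1) S(1)] by simp
    then show False using S zero_object_iff by blast
  qed
  define \<epsilon> where "\<epsilon> = i \<cdot> p"
  have \<epsilon>: "arr A A \<epsilon>" unfolding \<epsilon>_def using arr_comp[OF t(5,4)] .
  have \<epsilon>0: "\<epsilon> \<noteq> Zero D A A" using hom_inj[OF T shA_S t(5)] p0 unfolding \<epsilon>_def by blast
  \<comment> \<open>Since \<open>x \<noteq> 0\<close>, an endomorphism of \<open>A\<close> preserves the subobject \<open>S\<close>, and it acts by the same scalar on the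
    subobject and on the quotient.\<close>
  have central: "g \<cdot> \<epsilon> = \<epsilon> \<cdot> g" if g: "arr A A g" for g
  proof -
    have gi: "arr S A (g \<cdot> i)" and pg: "arr A S (p \<cdot> g)" using g t by blast+
    have pgi: "arr S S (p \<cdot> (g \<cdot> i))" using arr_comp[OF gi t(5)] .
    obtain l where l: "p \<cdot> (g \<cdot> i) = l \<odot>\<^bsub>Hom D S S\<^esub> Ident D S" using scalar[OF pgi] by blast
    have "l \<odot>\<^bsub>Hom D S (sh S)\<^esub> x = x \<cdot> (p \<cdot> (g \<cdot> i))"
      unfolding l using comp_smult_right[OF arr_ident[OF S(1)] x(1)] ident_right[OF x(1)] by simp
    also have "\<dots> = Zero D S (sh S)"
      using assoc[OF gi t(5,6)] tri_comp_zero'[OF T] zero_comp[OF gi shS] by simp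
    finally have "l = 0" using smult_eq_zeroD[OF x(1) _ x(2)] by blast
    then have pgi0: "p \<cdot> (g \<cdot> i) = Zero D S S" using l complex_space.smult_0[OF hom_space[OF S(1,1)]] ident_mor[OF S(1)] by simp
    obtain a where a: "arr S S a" "g \<cdot> i = i \<cdot> a" using hom_exact_mid[OF T gi pgi0] by blast
    have "(p \<cdot> g) \<cdot> i = Zero D S S" using pgi0 assoc[OF i(1) g t(5)] by simp
    then obtain b where b: "arr S S b" "p \<cdot> g = b \<cdot> p" using cohom_exact_mid[OF T pg] by blast
    obtain c where c: "arr S S c" "c \<cdot> p = p \<cdot> g" "shm a \<cdot> x = x \<cdot> c"
      using tri_map[OF T T a(1) g a(2)] by blast
    obtain a0 where a0: "a = a0 \<odot>\<^bsub>Hom D S S\<^esub> Ident D S" using scalar[OF a(1)] by blast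
    obtain b0 where b0: "b = b0 \<odot>\<^bsub>Hom D S S\<^esub> Ident D S" using scalar[OF b(1)] by blast
    obtain c0 where c0: "c = c0 \<odot>\<^bsub>Hom D S S\<^esub> Ident D S" using scalar[OF c(1)] by blast
    note sc = a0 b0 c0
    have "c0 \<odot>\<^bsub>Hom D A S\<^esub> p = b0 \<odot>\<^bsub>Hom D A S\<^esub> p"
      using c(2) b(2) unfolding sc comp_smult_left[OF t(5) arr_ident[OF S(1)]] ident_left[OF t(5)] by simp
    then have "c0 = b0" using smult_cancel[OF t(5)] p0 by blast
    have "shm a = a0 \<odot>\<^bsub>Hom D (sh S) (sh S)\<^esub> Ident D (sh S)"
      unfolding sc using sh_smult[OF arr_ident[OF S(1)]] sh_ident[OF S(1)] by simp
    then have "a0 \<odot>\<^bsub>Hom D S (sh S)\<^esub> x = c0 \<odot>\<^bsub>Hom D S (sh S)\<^esub> x"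
      using c(3) unfolding sc
      by (simp add: comp_smult_left[OF x(1) arr_ident[OF shS]] comp_smult_right[OF arr_ident[OF S(1)] x(1)]
          ident_left[OF x(1)] ident_right[OF x(1)])
    then have "a0 = c0" using smult_cancel[OF x(1)] x(2) by blast
    have "g \<cdot> \<epsilon> = i \<cdot> a \<cdot> p" unfolding \<epsilon>_def using assoc[OF t(5) i(1) g] a(2) by simp
    also have "\<dots> = i \<cdot> (b \<cdot> p)"
      using assoc[OF t(5) a(1) i(1)] sc \<open>c0 = b0\<close> \<open>a0 = c0\<close> by simp
    also have "\<dots> = \<epsilon> \<cdot> g" unfolding \<epsilon>_def using assoc[OF g t(5) i(1)] b(2) by simp
    finally show ?thesis .
  qed
  note sh2A = sh_obj[OF sh_obj[OF A]]
  obtain z where z: "arr A (sh (sh A)) z" "trace A (z \<cdot> \<epsilon>) \<noteq> 0" using trace_nondegenerate[OF \<epsilon> \<epsilon>0] by blast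
  have s2\<epsilon>: "arr (sh (sh A)) (sh (sh A)) (shm (shm \<epsilon>))" using \<epsilon> by blast
  have z\<epsilon>: "z \<cdot> \<epsilon> = shm (shm \<epsilon>) \<cdot> z"
  proof (rule trace_ext[OF arr_comp[OF \<epsilon> z(1)] arr_comp[OF z(1) s2\<epsilon>] A])
    fix g assume g: "arr A A g"
    have "z \<cdot> \<epsilon> \<cdot> g = z \<cdot> g \<cdot> \<epsilon>" using assoc[OF g \<epsilon> z(1)] assoc[OF \<epsilon> g z(1)] central[OF g] by simp
    then show "trace A (z \<cdot> \<epsilon> \<cdot> g) = trace A (shm (shm \<epsilon>) \<cdot> z \<cdot> g)"
      using trace_cyclic[OF \<epsilon> arr_comp[OF g z(1)]] assoc[OF g z(1) s2\<epsilon>] by simp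
  qed
  define q' where "q' = z \<cdot> i"
  define s where "s = shm (shm p) \<cdot> z"
  have s2p: "arr (sh (sh A)) (sh (sh S)) (shm (shm p))" and s2i: "arr (sh (sh S)) (sh (sh A)) (shm (shm i))"
    using t by blast+
  have q': "arr S (sh (sh A)) q'" and s: "arr A (sh (sh S)) s"
    unfolding q'_def s_def using arr_comp[OF i(1) z(1)] arr_comp[OF z(1) s2p] by blast+
  define y where "y = s \<cdot> i"
  have y: "arr S (sh (sh S)) y" unfolding y_def using arr_comp[OF i(1) s] .
  have y': "y = shm (shm p) \<cdot> q'" unfolding y_def s_def q'_def using assoc[OF i(1) z(1) s2p] by simp
  have y0: "y \<noteq> Zero D S (sh (sh S))"
  proof
    assume yz: "y = Zero D S (sh (sh S))"
    have "trace A (q' \<cdot> p) = trace S y" using trace_cyclic[OF t(5) q'] y' by simp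
    also have "\<dots> = 0" unfolding yz
      using complex_space.functional_zero[OF hom_space[OF S(1) sh2S] trace_linear[OF S(1)]] .
    finally show False using z(2) assoc[OF t(5) i(1) z(1)] unfolding q'_def \<epsilon>_def by simp
  qed
  have square: "q' \<cdot> p = shm (shm i) \<cdot> s"
  proof -
    have "q' \<cdot> p = z \<cdot> \<epsilon>" unfolding q'_def \<epsilon>_def using assoc[OF t(5) i(1) z(1)] by simp
    also have "\<dots> = shm (shm i \<cdot> shm p) \<cdot> z" unfolding z\<epsilon> unfolding \<epsilon>_def using sh_comp[OF t(5) i(1)] by simp
    also have "\<dots> = shm (shm i) \<cdot> s"
      unfolding s_def using sh_comp[OF sh_arr[OF t(5)] sh_arr[OF i(1)]] assoc[OF z(1) s2p s2i] by simp
    finally show ?thesis .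
  qed
  \<comment> \<open>The rotation contributes a sign on the left, the double shift none on the right.\<close>
  obtain c where c: "arr (sh S) (sh (sh S)) c" "c \<cdot> x = shm (shm p) \<cdot> q'"
      "shm s \<cdot> (\<ominus>\<^bsub>Hom D (sh S) (sh A)\<^esub> shm i) = shm (shm x) \<cdot> c"
    using tri_map[OF tri_rot[OF T] tri_shift2[OF T] s q' square] by blast
  obtain c' where c': "arr S (sh S) c'" "shm c' = c" using sh_full[OF S(1) shS c(1)] by blast
  obtain \<gamma> where \<gamma>: "c' = \<gamma> \<odot>\<^bsub>Hom D S (sh S)\<^esub> x" using span[OF c'(1)] by blast
  have cx: "c = \<gamma> \<odot>\<^bsub>Hom D (sh S) (sh (sh S))\<^esub> shm x" using c'(2) sh_smult[OF x(1)] \<gamma> by simp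
  have xx: "arr S (sh (sh S)) (shm x \<cdot> x)" using arr_comp[OF x(1) sh_arr[OF x(1)]] .
  have y1: "y = \<gamma> \<odot>\<^bsub>Hom D S (sh (sh S))\<^esub> (shm x \<cdot> x)"
    using c(2) y' cx comp_smult_left[OF x(1) sh_arr[OF x(1)]] by simp
  have "shm (shm x) \<cdot> c = \<gamma> \<odot>\<^bsub>Hom D (sh S) (sh (sh (sh S)))\<^esub> (shm (shm x) \<cdot> shm x)"
    unfolding cx by (rule comp_smult_right[OF sh_arr[OF x(1)] sh_arr[OF sh_arr[OF x(1)]]])
  also have "\<dots> = shm y" unfolding y1 using sh_comp[OF x(1) sh_arr[OF x(1)]] sh_smult[OF xx] by simp
  finally have 1: "shm (shm x) \<cdot> c = shm y" .
  have "shm s \<cdot> (\<ominus>\<^bsub>Hom D (sh S) (sh A)\<^esub> shm i) = \<ominus>\<^bsub>Hom D (sh S) (sh (sh (sh S)))\<^esub> shm y"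
    using comp_neg[OF sh_arr[OF i(1)] sh_arr[OF s]] sh_comp[OF i(1) s] y_def by simp
  then have "(-1) \<odot>\<^bsub>Hom D (sh S) (sh (sh (sh S)))\<^esub> shm y = 1 \<odot>\<^bsub>Hom D (sh S) (sh (sh (sh S)))\<^esub> shm y"
    using 1 c(3) neg_smult[OF sh_arr[OF y]] complex_space.smult_1[OF hom_space arrD(3)[OF sh_arr[OF y]]] shS sh_obj[OF sh2S] by simp
  moreover have "shm y \<noteq> Zero D (sh S) (sh (sh (sh S)))" using y0 sh_zero_iff[OF y] by simp
  ultimately have "(-1::complex) = 1" using smult_cancel[OF sh_arr[OF y]] by blast
  then show False by simp
qed

end

section \<open>Rigid objects and stable spherical objects\<close>

locale K3_stability = K3_category D + stability_condition D Z P
  for D :: "('o, 'm, 'z) tri_cat_scheme" (structure)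
    and Z :: "('o \<Rightarrow>\<^sub>0 int) set \<Rightarrow> complex" and P :: "real \<Rightarrow> 'o set"
begin

lemma simple_endomorphism_iso:
  assumes "simple_in D (P \<phi>) S" "arr S S g" "g \<noteq> Zero D S S"
  shows "iso S S g"
  using simple_mono[OF assms(1) simpleD(1)[OF assms(1)] assms(2,3)] simpleD(2,3)[OF assms(1)] by blast

lemma simple_scalar:
  assumes "simple_in D (P \<phi>) S" "arr S S g"
  shows "\<exists>c. g = c \<odot>\<^bsub>Hom D S S\<^esub> Ident D S"
  by (rule endomorphisms_scalar[OF sliceD[OF simpleD(1)[OF assms(1)]] simpleD(2)[OF assms(1)] _ assms(2)])
     (rule simple_endomorphism_iso[OF assms(1)])

lemma simple_hdim:
  assumes "simple_in D (P \<phi>) S"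
  shows "hdim S S = 1"
proof -
  have S: "S \<in> Obj D" using sliceD[OF simpleD(1)[OF assms]] .
  interpret V: complex_space "Hom D S S" by (rule hom_space[OF S S])
  show ?thesis
  proof (rule V.spanning_vector_dim)
    show "Ident D S \<in> Mor D S S" by (rule ident_mor[OF S])
    show "Ident D S \<noteq> Zero D S S" using simpleD(2)[OF assms] zero_object_iff S by blast
    show "\<exists>a. v = a \<odot>\<^bsub>Hom D S S\<^esub> Ident D S" if "v \<in> Mor D S S" for v
      using simple_scalar[OF assms] that S by (simp add: arr_def)
  qed
qed

text \<open>Subadditivity propagates nonpositivity from \<open>S\<close> to its iterated extensions.\<close>

lemma isotypic_euler:
  assumes "A \<in> isotypic S" "T \<in> Obj D" "euler S T \<le> 0"
  shows "euler A T \<le> 0"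
  using assms(1)
proof (induction rule: isotypic_induct)
  case (zero N)
  have "hdim N R = 0" if "R \<in> Obj D" for R
    using hdim_zero_iff[OF zero_object_obj[OF zero] that] zero_orth(1)[OF zero that] by simp
  then show ?case using assms(2) sh_obj by (simp add: euler_def)
next
  case (ext X Y C u v w)
  then show ?case using euler_subadditive[OF ext(3) assms(2)] by linarith
qed (rule assms(3))

text \<open>If \<open>dim Hom(S, S[1]) \<ge> 2\<close> then \<open>\<chi>(S, S) \<le> 0\<close>. Passing from \<open>S\<close> to \<open>A\<close> in one argument at a time, with Serre duality
  in between, gives \<open>\<chi>(A, A) \<le> 0\<close>. But \<open>\<chi>(A, A)\<close> is positive, since \<open>A\<close> is nonzero and rigid.\<close>

lemma simple_rigid:
  assumes S: "simple_in D (P \<phi>) S" and A: "A \<in> isotypic S" "\<not> zero_object D A" "orth A (sh A)"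
  shows "orth S (sh S)"
proof -
  have So: "S \<in> Obj D" using sliceD[OF simpleD(1)[OF S]] .
  have Ao: "A \<in> Obj D" using A(3) by (simp add: orth_def)
  have neg: "orth (sh S) S" using slice_orth[OF slice_sh[OF simpleD(1)[OF S]] simpleD(1)[OF S]] by simp
  have one: "hdim S (sh S) \<noteq> 1"
    by (rule self_extension_dim_neq_1[OF So simpleD(2)[OF S] simple_scalar[OF S] neg])
  have "\<not> hdim S (sh S) \<ge> 2"
  proof
    assume two: "hdim S (sh S) \<ge> 2"
    have "hdim S (sh (sh S)) = 1" using serre_dim[OF So So] simple_hdim[OF S] by simp
    then have "euler S S \<le> 0" using two simple_hdim[OF S] by (simp add: euler_def)
    then have "euler A S \<le> 0" by (rule isotypic_euler[OF A(1) So])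
    then have "euler S A \<le> 0" using euler_serre[OF Ao So] by simp
    then have "euler A A \<le> 0" by (rule isotypic_euler[OF A(1) Ao])
    moreover have "hdim A (sh A) = 0" using hdim_zero_iff[OF Ao sh_obj[OF Ao]] A(3) by simp
    ultimately have "hdim A A = 0" by (simp add: euler_def)
    then show False using hdim_zero_iff[OF Ao Ao] orth_self_iff[OF Ao] A(2) by simp
  qed
  then have "hdim S (sh S) = 0" using one by linarith
  then show ?thesis using hdim_zero_iff[OF So sh_obj[OF So]] by simp
qed

lemma slice_sh_pow: "X \<in> P \<phi> \<Longrightarrow> (sh ^^ n) X \<in> P (\<phi> + real n)"
proof (induction n)
  case (Suc n)
  then show ?case using slice_sh[of "(sh ^^ n) X" "\<phi> + real n"] by (simp add: add_ac)
qed simp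

text \<open>An object whose shift is isomorphic to the shift of \<open>Y\<close> is isomorphic to \<open>Y\<close>.\<close>

lemma slice_unshift:
  assumes "X \<in> P \<phi>"
  shows "onObj (unshift D) X \<in> P (\<phi> - 1)"
proof -
  let ?G = "unshift D"
  have "\<exists>G. quasi_inverse D (Shift D) G" using shift_autoequivalence by (simp add: linear_autoequivalence_def)
  then have qi: "quasi_inverse D (Shift D) ?G" unfolding unshift_def by (rule someI_ex)
  have X: "X \<in> Obj D" using sliceD[OF assms] .
  have GX: "onObj ?G X \<in> Obj D" using qi X functor_obj by (auto simp: quasi_inverse_def)
  have "isom (sh (onObj ?G X)) X" using quasi_inverse_isos[OF sh_functor qi] X unfolding isom_def by blast
  moreover obtain Y where Y: "Y \<in> P (\<phi> - 1)" "isom X (sh Y)" using slice_unsh[of X "\<phi> - 1"] assms by auto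
  ultimately have "isom (sh Y) (sh (onObj ?G X))" using isom_trans isom_sym by blast
  then obtain h where h: "iso (sh Y) (sh (onObj ?G X)) h" by (auto simp: isom_def)
  obtain k where k: "arr Y (onObj ?G X) k" "shm k = h" using sh_full[OF sliceD[OF Y(1)] GX iso_arr[OF h]] by blast
  have "iso Y (onObj ?G X) k" using equivalence_reflects_iso[OF shift_autoequivalence k(1)] h k(2) by simp
  then show ?thesis using slice_isom[OF Y(1)] by (auto simp: isom_def)
qed

lemma slice_unshift_pow: "X \<in> P \<phi> \<Longrightarrow> (onObj (unshift D) ^^ n) X \<in> P (\<phi> - real n)"
proof (induction n)
  case (Suc n)
  then show ?case using slice_unshift[of "(onObj (unshift D) ^^ n) X" "\<phi> - real n"] by (simp add: algebra_simps)
qed simp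

text \<open>Negative degrees vanish by the order of the phases, degrees above \<open>2\<close> are Serre dual to negative ones, and degree
  \<open>2\<close> is dual to \<open>End S\<close>.\<close>

lemma simple_spherical:
  assumes S: "simple_in D (P \<phi>) S" and rig: "orth S (sh S)"
  shows "spherical D S"
proof -
  have SP: "S \<in> P \<phi>" using simpleD(1)[OF S] .
  have So: "S \<in> Obj D" using sliceD[OF SP] .
  have "hdim S (shift_obj D 0 S) = 1" using simple_hdim[OF S] by (simp add: shift_obj_def)
  moreover have "hdim S (shift_obj D 2 S) = 1"
  proof -
    have "shift_obj D 2 S = sh (sh S)" by (simp add: shift_obj_def numeral_2_eq_2)
    then show ?thesis using serre_dim[OF So So] simple_hdim[OF S] by (simp only:)
  qed
  moreover have "Mor D S (shift_obj D i S) = {Zero D S (shift_obj D i S)}" if i: "i \<notin> {0, 2}" for i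
  proof -
    have "orth S (shift_obj D i S)"
    proof (cases "i < 0")
      case True
      then have "shift_obj D i S \<in> P (\<phi> - real (nat (- i)))"
        using slice_unshift_pow[OF SP, of "nat (- i)"] by (simp add: shift_obj_def)
      then show ?thesis using slice_orth[OF SP] True by simp
    next
      case False
      show ?thesis
      proof (cases "i = 1")
        case True
        then show ?thesis using rig by (simp add: shift_obj_def)
      next
        case False
        define n where "n = nat i - 2"
        have n: "nat i = Suc (Suc n)" "n > 0" using i \<open>\<not> i < 0\<close> False unfolding n_def by (auto simp: nat_eq_iff)
        have "orth ((sh ^^ n) S) S" using slice_orth[OF slice_sh_pow[OF SP] SP] n(2) by simp
        then have "orth S (sh (sh ((sh ^^ n) S)))" by (rule serre_orth)
        then show ?thesis using \<open>\<not> i < 0\<close> n(1) by (simp add: shift_obj_def)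
      qed
    qed
    then show ?thesis using orth_iff by (auto simp: orth_def)
  qed
  ultimately show ?thesis using So unfolding spherical_def by auto
qed

text \<open>Since \<open>Hom(S, S[1]) = 0\<close>, all extensions of isotypic objects by one another split.\<close>

lemma isotypic_fixed:
  assumes F: "F \<in> Aut D" and S: "S \<in> Obj D" "orth S (sh S)" "isom (onObj F S) S" and A: "A \<in> isotypic S"
  shows "isom (onObj F A) A"
proof -
  have "orth S (sh X)" if "X \<in> isotypic S" for X
    using that
  proof (induction rule: isotypic_induct)
    case (zero N)
    then show ?case using zero_orth(2)[OF sh_zero_object[OF zero] S(1)] by simp
  next
    case (ext X Y C u v w)
    then show ?case using orth_mid_right[OF tri_shift[OF ext(3)]] by blast
  qed (rule S(2))
  then have ext0: "orth C (sh X)" if "C \<in> isotypic S" "X \<in> isotypic S" for C X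
    using isotypic_orth_left that by blast
  have lin: "linear_functor D F" using F by (simp add: Aut_def linear_autoequivalence_def)
  show ?thesis using A
  proof (induction rule: isotypic_induct)
    case (zero N)
    then show ?case using zero_isom functor_zero_object[OF lin] by blast
  next
    case (ext X Y C u v w)
    then show ?case using split_extension_fixed[OF F ext(3) ext0[OF ext(2,1)]] by blast
  qed (rule S(3))
qed

context
  fixes F :: "('o, 'm) endofun"
  assumes F: "F \<in> Aut D"
    and fixed: "\<And>S \<phi>. simple_in D (P \<phi>) S \<Longrightarrow> spherical D S \<Longrightarrow> isom (onObj F S) S"
begin

lemma zero_object_fixed: "zero_object D N \<Longrightarrow> isom (onObj F N) N"
  using F zero_isom functor_zero_object by (auto simp: Aut_def linear_autoequivalence_def)

text \<open>Noetherian induction: split off the largest \<open>S\<close>-isotypic subobject for a simple subobject \<open>S\<close>.\<close>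

lemma semistable_rigid_fixed:
  assumes "E \<in> P \<phi>" "orth E (sh E)"
  shows "isom (onObj F E) E"
proof -
  have "orth E (sh E) \<longrightarrow> isom (onObj F E) E"
    using assms(1)
  proof (rule quotient_induct, intro impI)
    fix B assume B: "B \<in> P \<phi>" and rig: "orth B (sh B)"
      and IH: "\<And>A B' u v w. tri A B B' u v w \<Longrightarrow> A \<in> P \<phi> \<Longrightarrow> B' \<in> P \<phi> \<Longrightarrow> \<not> zero_object D A \<Longrightarrow>
        orth B' (sh B') \<longrightarrow> isom (onObj F B') B'"
    show "isom (onObj F B) B"
    proof (cases "zero_object D B")
      case True
      then show ?thesis by (rule zero_object_fixed)
    next
      case False
      obtain S m where S: "simple_in D (P \<phi>) S" and m: "mono_in D (P \<phi>) S B m"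
        using simple_subobject_exists[OF B False] by blast
      obtain A B' u v w where T: "tri A B B' u v w" and A: "A \<in> isotypic S" and B': "B' \<in> P \<phi>" and SB': "orth S B'"
        using maximal_isotypic_subobject[OF S B] by blast
      have AP: "A \<in> P \<phi>" by (rule isotypic_slice[OF A simpleD(1)[OF S]])
      have AB': "orth A B'" by (rule isotypic_orth_left[OF A SB'])
      note rigid = mukai[OF T AB' rig]
      have A0: "\<not> zero_object D A"
      proof
        assume "zero_object D A"
        then have "isom B' B" using tri_iso_of_zero_left[OF T] isom_sym unfolding isom_def by blast
        then have "orth S B" using orth_isom[OF SB' isom_refl[OF sliceD[OF simpleD(1)[OF S]]]] by blast
        then have "m \<cdot> Ident D S = Zero D S B" using orthD[OF _ monoD(3)[OF m]] monoD(3)[OF m] by simp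
        then have "Ident D S = Zero D S S"
          using monoD(4)[OF m simpleD(1)[OF S] arr_ident[OF sliceD[OF simpleD(1)[OF S]]]] by simp
        then show False using simpleD(2)[OF S] zero_object_iff sliceD[OF simpleD(1)[OF S]] by blast
      qed
      have rS: "orth S (sh S)" by (rule simple_rigid[OF S A A0 rigid(1)])
      have "isom (onObj F S) S" by (rule fixed[OF S simple_spherical[OF S rS]])
      then have "isom (onObj F A) A" using isotypic_fixed[OF F sliceD[OF simpleD(1)[OF S]] rS _ A] by blast
      moreover have "isom (onObj F B') B'" using IH[OF T AP B' A0] rigid(2) by blast
      ultimately show ?thesis using rigid_extension_fixed[OF F T AB' rig] by blast
    qed
  qed
  then show ?thesis using assms(2) by blast
qed

text \<open>The last factor of a Harder--Narasimhan filtration has smaller phase than all others, so there are no nonzero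
  morphisms to it from the previous step.\<close>

lemma rigid_fixed_hn: "hn E L \<Longrightarrow> orth E (sh E) \<Longrightarrow> isom (onObj F E) E"
proof (induction rule: hn.induct)
  case (hn_zero X)
  then show ?case using zero_object_fixed by blast
next
  case (hn_step X L Y A u v w \<psi>)
  have XA: "orth X A" by (rule hn_orth_right[OF hn_step(1,3,5)])
  note rigid = mukai[OF hn_step(2) XA hn_step.prems]
  show ?case
    by (rule rigid_extension_fixed[OF F hn_step(2) XA hn_step.prems hn_step.IH[OF rigid(1)]
          semistable_rigid_fixed[OF hn_step(3) rigid(2)]])
qed

lemma rigid_fixed:
  assumes "E \<in> Obj D" "rigid D E"
  shows "isom (onObj F E) E"
  using hn_exists[OF assms(1)] rigid_fixed_hn assms(2) rigid_iff[OF assms(1)] by blast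

end

end

theorem proposition1p2:
  fixes D :: "('o, 'm) tri_cat"
    and \<sigma> :: "(('o \<Rightarrow>\<^sub>0 int) set \<Rightarrow> complex) \<times> (real \<Rightarrow> 'o set)"
    and f :: "('o, 'm) endofun"
  assumes "K3_category D"
    and "\<sigma> \<in> Stab D"
    and "f \<in> Aut D"
    and "\<And>A. \<lbrakk>A \<in> Obj D; spherical D A; stable_object D \<sigma> A\<rbrakk> \<Longrightarrow> isomorphic D (onObj f A) A"
  shows "\<forall>E\<in>Obj D. rigid D E \<longrightarrow> isomorphic D (onObj f E) E"
proof (intro ballI impI)
  fix E assume E: "E \<in> Obj D" "rigid D E"
  obtain Z P where \<sigma>: "\<sigma> = (Z, P)" by (cases \<sigma>)
  interpret K3_category D by (rule assms(1))
  interpret stability_condition D Z P using assms(2) by (simp add: \<sigma> Stab_def)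
  interpret K3_stability D Z P ..
  have fo: "onObj f X \<in> Obj D" if "X \<in> Obj D" for X
    using assms(3) that functor_obj by (auto simp: Aut_def linear_autoequivalence_def)
  have "isom (onObj f S) S" if "simple_in D (P \<phi>) S" "spherical D S" for S \<phi>
  proof -
    have S: "S \<in> Obj D" using sliceD[OF simpleD(1)[OF that(1)]] .
    moreover have "stable_object D \<sigma> S"
      using that(1) by (auto simp: stable_object_def stable_of_phase_def \<sigma>)
    ultimately show ?thesis using assms(4) that(2) isom_iff[OF fo[OF S] S] by blast
  qed
  then have "isom (onObj f E) E" by (rule rigid_fixed[OF assms(3) _ E])
  then show "isomorphic D (onObj f E) E" using isom_iff[OF fo[OF E(1)] E(1)] by blast
qed

end
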